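(* Suppose that Assumptions (A), (B), (C) hold, that $(T_n)_{n\ge1}$ is the regular sequence of designs generated by a density $f$, that $T_n\cap[x-h,x+h]\neq\emptyset$, $nh\ge1$ and $\frac1h\sup_{1\le i\le n}d_{i,n}\le1$, and that Assumption (E) holds. Then there exist positive constants $C$ and $C'$ such that for any $x\in\,]0,1[$ and any positive integer $m$, $$\limsup_{n\to\infty}\ mn^2h\Big(\frac{\sigma_{x,h}^2}{m}-\mathrm{Var}\,\hat g_n^{pro}(x)\Big)\le C\qquad\text{and}\qquad\liminf_{n\to\infty}\ mn^2h\Big(\frac{\sigma_{x,h}^2}{m}-\mathrm{Var}\,\hat g_n^{pro}(x)\Big)\ge C'.$$
   Context: Model: $Y_j(t_i)=g(t_i)+\varepsilon_j(t_i)$, $1\le i\le n$, $1\le j\le m$, with $g\in C^2([0,1])$ and $\varepsilon_1,\dots,\varepsilon_m$ i.i.d. copies of a centered second-order process $\varepsilon$ on $[0,1]$ with known continuous autocovariance $R$ such that $(R(s,t))_{s,t\in T}$ is non-singular for every finite $T\subset[0,1]$. $\overline Y(t_i)=\frac1m\sum_jY_j(t_i)$. $K$ is a kernel of class $C^1$ with support $[-1,1]$, $\int_{-1}^1K=1$, $\int_{-1}^1tK(t)dt=0$, $\int_{-1}^1t^2K(t)dt<\infty$; $\varphi_{x,h}(s)=\frac1hK(\frac{x-s}h)$, $h=h(n)\in(0,1)$. Projection estimator: $f_{x,h}(t)=\int_0^1R(s,t)\varphi_{x,h}(s)ds$, $(m_{x,h}(t_1),\dots,m_{x,h}(t_n))=(f_{x,h}(t_1),\dots,f_{x,h}(t_n))R_{|T_n}^{-1}$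 with $R_{|T_n}=(R(t_i,t_j))_{i,j}$, and $\hat g_n^{pro}(x)=\sum_{i=1}^nm_{x,h}(t_i)\overline Y(t_i)$. Also $\sigma_{x,h}^2=\int_0^1\int_0^1\varphi_{x,h}(s)R(s,t)\varphi_{x,h}(t)\,ds\,dt$. Regular designs: $T_n=\{t_{i,n}=F^{-1}(i/n),\ i=1,\dots,n\}$, where $F$ is the distribution function of a density $f\in C^2([0,1])$ with $\inf_{0<t<1}f(t)>0$ and $\sup_{0<t<1}f(t)<\infty$. $t_{0,n}=0$, $t_{n+1,n}=1$, $d_{j,n}=t_{j+1,n}-t_{j,n}$; $N_{T_n}=\mathrm{Card}\{i\in\{1,\dots,n\}:[t_{i-1,n},t_{i+1,n}]\cap\,]x-h,x+h[\,\ne\emptyset\}$. Notation: $R^{(k,l)}$ is the partial derivative of order $k$ in the first and $l$ in the second variable; $R^{(0,1)}(t,t^-)=\lim_{s\uparrow t}\partial R(t,s)/\partial s$, $R^{(0,1)}(t,t^+)=\lim_{s\downarrow t}\partial R(t,s)/\partial s$, similarly for order 2. $\alpha(t)=R^{(0,1)}(t,t^-)-R^{(0,1)}(t,t^+)$ for $t\in]0,1[$. RKHS($R$) is the reproducing kernel Hilbert space with kernel $R$ and norm $\|\cdot\|$. (A) $R$ is continuous on $[0,1]^2$, $R^{(0,1)}(t,t^\pm)$ and $R^{(0,2)}(t,t^\pm)$ exist and are continuous, and off the diagonal $R$ has continuous derivatives up to order two. (B) $\alpha$ is Lipschitz on $]0,1[$, $\inf_{0<t<1}\alpha(t)>0$,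 $\sup_{0<t<1}\alpha(t)<\infty$. (C) For each $t\in[0,1]$, $R^{(0,2)}(\cdot,t^+)\in$ RKHS($R$) and $\sup_{0\le t\le1}\|R^{(0,2)}(\cdot,t^+)\|<\infty$. (E) As $n\to\infty$: $\sup_{0\le j\le n}d_{j,n}\to0$, $\frac1h\sup_jd_{j,n}\to0$, $\frac{N_{T_n}}{h^2}\sup_jd_{j,n}^2\to0$, $\limsup_n\frac{N_{T_n}^2}{h^2}\sup_jd_{j,n}^2<\infty$. *)

theory Defs
  imports "HOL-Probability.Probability" "Jordan_Normal_Form.Gauss_Jordan_Elimination"
begin

definition second_order_process :: "'w measure \<Rightarrow> (real \<Rightarrow> 'w \<Rightarrow> real) \<Rightarrow> bool" where
  "second_order_process M eps \<longleftrightarrow>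
     (\<forall>t\<in>{0..1}. eps t \<in> borel_measurable M \<and> integrable M (\<lambda>\<omega>. (eps t \<omega>)\<^sup>2))"

definition centered_process :: "'w measure \<Rightarrow> (real \<Rightarrow> 'w \<Rightarrow> real) \<Rightarrow> bool" where
  "centered_process M eps \<longleftrightarrow> (\<forall>t\<in>{0..1}. prob_space.expectation M (eps t) = 0)"

definition autocovariance :: "'w measure \<Rightarrow> (real \<Rightarrow> 'w \<Rightarrow> real) \<Rightarrow> (real \<Rightarrow> real \<Rightarrow> real) \<Rightarrow> bool" where
  "autocovariance M eps R \<longleftrightarrow>
     (\<forall>s\<in>{0..1}. \<forall>t\<in>{0..1}. R s t =
        prob_space.expectation M (\<lambda>\<omega>. (eps s \<omega> - prob_space.expectation M (eps s))
                                   * (eps t \<omega> - prob_space.expectation M (eps t))))"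

abbreviation path_space :: "(real \<Rightarrow> real) measure" where
  "path_space \<equiv> PiM {0..1} (\<lambda>_. borel)"

definition sample_path :: "(real \<Rightarrow> 'w \<Rightarrow> real) \<Rightarrow> 'w \<Rightarrow> real \<Rightarrow> real" where
  "sample_path eps \<omega> = (\<lambda>t\<in>{0..1}. eps t \<omega>)"

definition iid_copies ::
  "'w measure \<Rightarrow> (real \<Rightarrow> 'w \<Rightarrow> real) \<Rightarrow> nat \<Rightarrow> (nat \<Rightarrow> real \<Rightarrow> 'w \<Rightarrow> real) \<Rightarrow> bool" where
  "iid_copies M eps m epss \<longleftrightarrow>
     prob_space.indep_vars M (\<lambda>_. path_space) (\<lambda>j. sample_path (epss j)) {1..m} \<and>
     (\<forall>j\<in>{1..m}. distr M path_space (sample_path (epss j)) = distr M path_space (sample_path eps))"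

definition Y :: "(real \<Rightarrow> real) \<Rightarrow> (nat \<Rightarrow> real \<Rightarrow> 'w \<Rightarrow> real) \<Rightarrow> nat \<Rightarrow> real \<Rightarrow> 'w \<Rightarrow> real" where
  "Y g epss j t \<omega> = g t + epss j t \<omega>"

definition Ybar :: "(real \<Rightarrow> real) \<Rightarrow> (nat \<Rightarrow> real \<Rightarrow> 'w \<Rightarrow> real) \<Rightarrow> nat \<Rightarrow> real \<Rightarrow> 'w \<Rightarrow> real" where
  "Ybar g epss m t \<omega> = (1 / real m) * (\<Sum>j=1..m. Y g epss j t \<omega>)"

definition cov_matrix :: "(real \<Rightarrow> real \<Rightarrow> real) \<Rightarrow> real list \<Rightarrow> real Matrix.mat" where
  "cov_matrix R ts = Matrix.mat (length ts) (length ts) (\<lambda>(i, j). R (ts ! i) (ts ! j))"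

text \<open>Distinct lists enumerate the finite subsets of the unit interval.\<close>
definition nonsingular_kernel :: "(real \<Rightarrow> real \<Rightarrow> real) \<Rightarrow> bool" where
  "nonsingular_kernel R \<longleftrightarrow>
     (\<forall>ts. distinct ts \<and> set ts \<subseteq> {0..1} \<longrightarrow> invertible_mat (cov_matrix R ts))"

definition phi :: "(real \<Rightarrow> real) \<Rightarrow> real \<Rightarrow> real \<Rightarrow> real \<Rightarrow> real" where
  "phi K x h s = (1 / h) * K ((x - s) / h)"

definition f_xh :: "(real \<Rightarrow> real \<Rightarrow> real) \<Rightarrow> (real \<Rightarrow> real) \<Rightarrow> real \<Rightarrow> real \<Rightarrow> real \<Rightarrow> real" where
  "f_xh R K x h t = integral {0..1} (\<lambda>s. R s t * phi K x h s)"

definition sigma2 :: "(real \<Rightarrow> real \<Rightarrow> real) \<Rightarrow> (real \<Rightarrow> real) \<Rightarrow> real \<Rightarrow> real \<Rightarrow> real" where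
  "sigma2 R K x h =
     integral {0..1} (\<lambda>s. integral {0..1} (\<lambda>t. phi K x h s * R s t * phi K x h t))"

text \<open>The row vector of weights.  The inverse exists for every distinct list under
  \<^const>\<open>nonsingular_kernel\<close>.\<close>
definition weights ::
  "(real \<Rightarrow> real \<Rightarrow> real) \<Rightarrow> (real \<Rightarrow> real) \<Rightarrow> real \<Rightarrow> real \<Rightarrow> real list \<Rightarrow> real Matrix.vec" where
  "weights R K x h ts =
     Matrix.row (mat_of_row (vec_of_list (map (f_xh R K x h) ts))
                 * the (mat_inverse (cov_matrix R ts))) 0"

definition g_pro ::
  "(real \<Rightarrow> real \<Rightarrow> real) \<Rightarrow> (real \<Rightarrow> real) \<Rightarrow> real \<Rightarrow> real \<Rightarrow> real list
     \<Rightarrow> (real \<Rightarrow> 'w \<Rightarrow> real) \<Rightarrow> 'w \<Rightarrow> real" where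
  "g_pro R K x h ts ybar \<omega> =
     (\<Sum>i<length ts. vec_index (weights R K x h ts) i * ybar (ts ! i) \<omega>)"

text \<open>Twice continuously differentiable on a closed interval, with one-sided derivatives at its
  end points.\<close>
definition C2_on :: "real set \<Rightarrow> (real \<Rightarrow> real) \<Rightarrow> bool" where
  "C2_on S u \<longleftrightarrow>
     (\<exists>u' u''. (\<forall>t\<in>S. (u has_real_derivative u' t) (at t within S)) \<and>
               (\<forall>t\<in>S. (u' has_real_derivative u'' t) (at t within S)) \<and>
               continuous_on S u'')"

definition smoothing_kernel :: "(real \<Rightarrow> real) \<Rightarrow> bool" where
  "smoothing_kernel K \<longleftrightarrow>
     K C1_differentiable_on UNIV \<and>
     closure {t. K t \<noteq> 0} = {-1..1} \<and>
     integral {-1..1} K = 1 \<and>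
     integral {-1..1} (\<lambda>t. t * K t) = 0 \<and>
     (\<lambda>t. t\<^sup>2 * K t) integrable_on {-1..1}"

definition design_density :: "(real \<Rightarrow> real) \<Rightarrow> bool" where
  "design_density f \<longleftrightarrow>
     C2_on {0..1} f \<and> (\<forall>t\<in>{0..1}. 0 \<le> f t) \<and> integral {0..1} f = 1 \<and>
     (INF t\<in>{0<..<1}. ereal (f t)) > 0 \<and> (SUP t\<in>{0<..<1}. ereal (f t)) < \<infinity>"

definition distribution_fun :: "(real \<Rightarrow> real) \<Rightarrow> real \<Rightarrow> real" where
  "distribution_fun f t = integral {0..t} f"

text \<open>Design points, including the conventions for the indices \<open>0\<close> and \<open>n + 1\<close>.\<close>
definition design_pt :: "(real \<Rightarrow> real) \<Rightarrow> nat \<Rightarrow> nat \<Rightarrow> real" where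
  "design_pt f n i =
     (if i = 0 then 0
      else if i \<le> n then the_inv_into {0..1} (distribution_fun f) (real i / real n)
      else 1)"

definition design_list :: "(real \<Rightarrow> real) \<Rightarrow> nat \<Rightarrow> real list" where
  "design_list f n = map (design_pt f n) [1..<Suc n]"

definition gap :: "(real \<Rightarrow> real) \<Rightarrow> nat \<Rightarrow> nat \<Rightarrow> real" where
  "gap f n j = design_pt f n (j + 1) - design_pt f n j"

definition N_T :: "(real \<Rightarrow> real) \<Rightarrow> real \<Rightarrow> real \<Rightarrow> nat \<Rightarrow> nat" where
  "N_T f x h n =
     card {i\<in>{1..n}. {design_pt f n (i - 1)..design_pt f n (i + 1)} \<inter> {x - h<..<x + h} \<noteq> {}}"

text \<open>Derivatives relative to the unit interval, hence one-sided at its end points.  On the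
  diagonal these values are not used; there only one-sided limits enter.\<close>
definition d_fst :: "(real \<Rightarrow> real \<Rightarrow> real) \<Rightarrow> real \<Rightarrow> real \<Rightarrow> real" where
  "d_fst Q s t = vector_derivative (\<lambda>u. Q u t) (at s within {0..1})"

definition d_snd :: "(real \<Rightarrow> real \<Rightarrow> real) \<Rightarrow> real \<Rightarrow> real \<Rightarrow> real" where
  "d_snd Q s t = vector_derivative (\<lambda>u. Q s u) (at t within {0..1})"

abbreviation R01 :: "(real \<Rightarrow> real \<Rightarrow> real) \<Rightarrow> real \<Rightarrow> real \<Rightarrow> real" where
  "R01 R \<equiv> d_snd R"

abbreviation R02 :: "(real \<Rightarrow> real \<Rightarrow> real) \<Rightarrow> real \<Rightarrow> real \<Rightarrow> real" where
  "R02 R \<equiv> d_snd (d_snd R)"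

definition off_diagonal :: "(real \<times> real) set" where
  "off_diagonal = {(s, t). s \<in> {0..1} \<and> t \<in> {0..1} \<and> s \<noteq> t}"

definition C1_off_diagonal :: "(real \<Rightarrow> real \<Rightarrow> real) \<Rightarrow> bool" where
  "C1_off_diagonal Q \<longleftrightarrow>
     (\<forall>(s, t)\<in>off_diagonal. (\<lambda>u. Q u t) differentiable (at s within {0..1}) \<and>
                            (\<lambda>u. Q s u) differentiable (at t within {0..1})) \<and>
     continuous_on off_diagonal (\<lambda>(s, t). d_fst Q s t) \<and>
     continuous_on off_diagonal (\<lambda>(s, t). d_snd Q s t)"

definition C2_off_diagonal :: "(real \<Rightarrow> real \<Rightarrow> real) \<Rightarrow> bool" where
  "C2_off_diagonal R \<longleftrightarrow>
     C1_off_diagonal R \<and> C1_off_diagonal (d_fst R) \<and> C1_off_diagonal (d_snd R)"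

definition diag_left :: "(real \<Rightarrow> real \<Rightarrow> real) \<Rightarrow> real \<Rightarrow> real" where
  "diag_left Q t = Lim (at_left t) (\<lambda>s. Q t s)"

definition diag_right :: "(real \<Rightarrow> real \<Rightarrow> real) \<Rightarrow> real \<Rightarrow> real" where
  "diag_right Q t = Lim (at_right t) (\<lambda>s. Q t s)"

text \<open>A left limit at \<open>(t, t)\<close> makes sense for \<open>0 < t\<close>, a right limit for \<open>t < 1\<close>.\<close>
definition diag_limits_exist_continuous :: "(real \<Rightarrow> real \<Rightarrow> real) \<Rightarrow> bool" where
  "diag_limits_exist_continuous Q \<longleftrightarrow>
     (\<forall>t\<in>{0<..1}. \<exists>l. ((\<lambda>s. Q t s) \<longlongrightarrow> l) (at_left t)) \<and>
     (\<forall>t\<in>{0..<1}. \<exists>l. ((\<lambda>s. Q t s) \<longlongrightarrow> l) (at_right t)) \<and>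
     continuous_on {0<..1} (diag_left Q) \<and> continuous_on {0..<1} (diag_right Q)"

definition alpha :: "(real \<Rightarrow> real \<Rightarrow> real) \<Rightarrow> real \<Rightarrow> real" where
  "alpha R t = diag_left (R01 R) t - diag_right (R01 R) t"

text \<open>The value at \<open>(s, t+)\<close> of the second derivative in the second variable.  At \<open>t = 1\<close> there
  are no points to the right in the unit interval, and the limit is taken from inside.\<close>
definition R02_plus :: "(real \<Rightarrow> real \<Rightarrow> real) \<Rightarrow> real \<Rightarrow> real \<Rightarrow> real" where
  "R02_plus R s t = Lim (if t < 1 then at_right t else at_left t) (\<lambda>u. R02 R s u)"

text \<open>\<open>H\<close>, with inner product \<open>ip\<close>, is a Hilbert space of real functions on \<open>X\<close> (represented
  as extensional functions) with reproducing kernel \<open>R\<close>.  By the Moore--Aronszajn theorem, \<open>R\<close>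
  determines \<open>H\<close>, and \<open>ip\<close> on \<open>H\<close>.\<close>
definition is_rkhs ::
  "'a set \<Rightarrow> ('a \<Rightarrow> 'a \<Rightarrow> real) \<Rightarrow> ('a \<Rightarrow> real) set \<Rightarrow> (('a \<Rightarrow> real) \<Rightarrow> ('a \<Rightarrow> real) \<Rightarrow> real) \<Rightarrow> bool"
where
  "is_rkhs X R H ip \<longleftrightarrow>
     H \<subseteq> extensional X \<and>
     (\<lambda>s\<in>X. 0) \<in> H \<and>
     (\<forall>u\<in>H. \<forall>v\<in>H. (\<lambda>s\<in>X. u s + v s) \<in> H) \<and>
     (\<forall>c. \<forall>u\<in>H. (\<lambda>s\<in>X. c * u s) \<in> H) \<and>
     (\<forall>u\<in>H. \<forall>v\<in>H. ip u v = ip v u) \<and>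
     (\<forall>u\<in>H. \<forall>v\<in>H. \<forall>w\<in>H. ip (\<lambda>s\<in>X. u s + v s) w = ip u w + ip v w) \<and>
     (\<forall>c. \<forall>u\<in>H. \<forall>v\<in>H. ip (\<lambda>s\<in>X. c * u s) v = c * ip u v) \<and>
     (\<forall>u\<in>H. 0 \<le> ip u u \<and> (ip u u = 0 \<longrightarrow> u = (\<lambda>s\<in>X. 0))) \<and>
     (let dst = (\<lambda>u v. sqrt (ip (\<lambda>s\<in>X. u s - v s) (\<lambda>s\<in>X. u s - v s))) in
        \<forall>U. (\<forall>n. U n \<in> H) \<and> (\<forall>e>0. \<exists>N. \<forall>p\<ge>N. \<forall>q\<ge>N. dst (U p) (U q) < e)
          \<longrightarrow> (\<exists>u\<in>H. (\<lambda>n. dst (U n) u) \<longlonglongrightarrow> 0)) \<and>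
     (\<forall>t\<in>X. (\<lambda>s\<in>X. R s t) \<in> H) \<and>
     (\<forall>t\<in>X. \<forall>u\<in>H. ip u (\<lambda>s\<in>X. R s t) = u t)"

definition assumption_A :: "(real \<Rightarrow> real \<Rightarrow> real) \<Rightarrow> bool" where
  "assumption_A R \<longleftrightarrow>
     continuous_on ({0..1} \<times> {0..1}) (\<lambda>(s, t). R s t) \<and>
     diag_limits_exist_continuous (R01 R) \<and>
     diag_limits_exist_continuous (R02 R) \<and>
     C2_off_diagonal R"

definition assumption_B :: "(real \<Rightarrow> real \<Rightarrow> real) \<Rightarrow> bool" where
  "assumption_B R \<longleftrightarrow>
     (\<exists>L. L-lipschitz_on {0<..<1} (alpha R)) \<and>
     (INF t\<in>{0<..<1}. ereal (alpha R t)) > 0 \<and>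
     (SUP t\<in>{0<..<1}. ereal (alpha R t)) < \<infinity>"

definition assumption_C :: "(real \<Rightarrow> real \<Rightarrow> real) \<Rightarrow> bool" where
  "assumption_C R \<longleftrightarrow>
     (\<exists>H ip. is_rkhs {0..1} R H ip \<and>
        (\<forall>t\<in>{0..1}. (\<lambda>s\<in>{0..1}. R02_plus R s t) \<in> H) \<and>
        (SUP t\<in>{0..1}. ereal (sqrt (ip (\<lambda>s\<in>{0..1}. R02_plus R s t)
                                        (\<lambda>s\<in>{0..1}. R02_plus R s t)))) < \<infinity>)"

definition assumption_E :: "(real \<Rightarrow> real) \<Rightarrow> (nat \<Rightarrow> real) \<Rightarrow> real \<Rightarrow> bool" where
  "assumption_E f h x \<longleftrightarrow>
     (\<lambda>n. (MAX j\<in>{0..n}. gap f n j)) \<longlonglongrightarrow> 0 \<and>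
     (\<lambda>n. (1 / h n) * (MAX j\<in>{0..n}. gap f n j)) \<longlonglongrightarrow> 0 \<and>
     (\<lambda>n. real (N_T f x (h n) n) / (h n)\<^sup>2 * (MAX j\<in>{0..n}. (gap f n j)\<^sup>2)) \<longlonglongrightarrow> 0 \<and>
     limsup (\<lambda>n. ereal ((real (N_T f x (h n) n))\<^sup>2 / (h n)\<^sup>2
                          * (MAX j\<in>{0..n}. (gap f n j)\<^sup>2))) < \<infinity>"

end

theory Submission
  imports Defs
begin

text \<open>
  Write \<open>w = phi K x h\<close>, let \<open>c\<close> be the weights and \<open>\<lambda>(F) = \<integral> w F - \<Sum> c\<^sub>i F(t\<^sub>i)\<close>.  The weights are chosen so
  that \<open>p(u) = \<lambda>(R(\<cdot>, u))\<close> vanishes at all design points, and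
  \<open>D\<^sup>2 = \<sigma>\<^sup>2 - m Var = \<lambda>\<^sub>s \<lambda>\<^sub>t R = \<integral> w p\<close>.  On an interval between consecutive design points \<open>p\<close> solves
  \<open>- p'' = \<alpha> w - \<lambda>(R02(\<cdot>, u+))\<close>, where by (C) the last term is at most \<open>B D\<close>.  If \<open>q\<close> solves
  \<open>- q'' = w\<close> with zero boundary values on each interval, then \<open>D\<^sup>2 = \<integral> w \<alpha> q + O(D \<integral> \<bar>q\<bar>)\<close> up to the
  contribution of \<open>[0, t\<^sub>1]\<close>.  The main term is of exact order \<open>n\<^sup>-\<^sup>2 \<integral> w\<^sup>2\<close>, that is \<open>1 / (n\<^sup>2 h)\<close>, and the
  remaining terms are of smaller order.
\<close>

subsection \<open>Reproducing kernel Hilbert spaces\<close>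

text \<open>It is integrated against \<open>q\<close> for each section \<open>R s\<close>
  separately, and \<open>\<lambda>\<close> is applied to the resulting identity; the boundary terms
  die because \<open>p\<close> vanishes at the nodes. The exact order comes from locally constant
  \<open>w\<close>: then \<open>q\<close> is a parabola, an interval of length \<open>d\<close>
  contributes about \<open>\<alpha> w\<^sup>2 d\<^sup>3 / 12\<close>, and all gaps are comparable to
  1 / n. Two obstacles shape the rest. The remainder contains \<open>D\<close> itself, so the
  estimate is read as a quadratic inequality in \<open>D\<close>. And the constants must be uniform
  in x while h may stay away from 0, so that the window can reach \<open>[0, t\<^sub>1]\<close> for
  every n; there only the uniform continuity of R helps. It supplies a factor \<theta> as small as
  desired, at the price of a threshold for n that depends on x, which limsup and liminf do not
  see.\<close>

lemma
  assumes "is_rkhs X R H ip"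
  shows rkhs_zero: "(\<lambda>s\<in>X. 0) \<in> H"
    and rkhs_add: "u \<in> H \<Longrightarrow> v \<in> H \<Longrightarrow> (\<lambda>s\<in>X. u s + v s) \<in> H"
    and rkhs_scale: "u \<in> H \<Longrightarrow> (\<lambda>s\<in>X. a * u s) \<in> H"
    and rkhs_ip_sym: "u \<in> H \<Longrightarrow> v \<in> H \<Longrightarrow> ip u v = ip v u"
    and rkhs_ip_add: "u \<in> H \<Longrightarrow> v \<in> H \<Longrightarrow> w \<in> H \<Longrightarrow> ip (\<lambda>s\<in>X. u s + v s) w = ip u w + ip v w"
    and rkhs_ip_scale: "u \<in> H \<Longrightarrow> v \<in> H \<Longrightarrow> ip (\<lambda>s\<in>X. a * u s) v = a * ip u v"
    and rkhs_ip_nonneg: "u \<in> H \<Longrightarrow> 0 \<le> ip u u"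
    and rkhs_kernel: "t \<in> X \<Longrightarrow> (\<lambda>s\<in>X. R s t) \<in> H"
    and rkhs_reproducing: "t \<in> X \<Longrightarrow> u \<in> H \<Longrightarrow> ip u (\<lambda>s\<in>X. R s t) = u t"
  using assms unfolding is_rkhs_def Let_def by ((elim conjE; blast)+)

text \<open>The inner product lives on a set of extensional functions, hence the elementary
  argument: \<open>u + a * v\<close> has nonnegative square for every \<open>a\<close>. The best
  \<open>a\<close> gives the claim if \<open>ip v v\<close> is positive; otherwise the square is
  affine in \<open>a\<close>, so its slope must vanish.\<close>

lemma rkhs_Cauchy_Schwarz:
  assumes rk: "is_rkhs X R H ip" and u: "u \<in> H" and v: "v \<in> H"
  shows "\<bar>ip u v\<bar> \<le> sqrt (ip u u) * sqrt (ip v v)"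
proof -
  have quad: "0 \<le> ip u u + 2 * a * ip u v + a\<^sup>2 * ip v v" for a
  proof -
    let ?av = "\<lambda>s\<in>X. a * v s" and ?w = "\<lambda>s\<in>X. u s + (\<lambda>s\<in>X. a * v s) s"
    have av: "?av \<in> H" using rkhs_scale[OF rk v] .
    have w: "?w \<in> H" using rkhs_add[OF rk u av] .
    have "ip ?w ?w = ip u ?w + ip ?av ?w" using rkhs_ip_add[OF rk u av w] .
    also have "ip u ?w = ip u u + a * ip v u"
      using rkhs_ip_sym[OF rk u w] rkhs_ip_add[OF rk u av u] rkhs_ip_scale[OF rk v u] by simp
    also have "ip ?av ?w = a * ip v u + a\<^sup>2 * ip v v"
      using rkhs_ip_sym[OF rk av w] rkhs_ip_add[OF rk u av av] rkhs_ip_sym[OF rk u av]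
        rkhs_ip_scale[OF rk v u] rkhs_ip_scale[OF rk v av] rkhs_ip_sym[OF rk v av]
        rkhs_ip_scale[OF rk v v] by (simp add: power2_eq_square)
    finally have "0 \<le> ip u u + a * ip v u + (a * ip v u + a\<^sup>2 * ip v v)"
      using rkhs_ip_nonneg[OF rk w] by (simp only:)
    then show ?thesis using rkhs_ip_sym[OF rk u v] by (simp add: algebra_simps)
  qed
  have "(ip u v)\<^sup>2 \<le> ip u u * ip v v"
  proof (cases "ip v v = 0")
    case True
    have "ip u v = 0"
    proof (rule ccontr)
      assume ne: "ip u v \<noteq> 0"
      \<comment> \<open>This \<open>a\<close> gives the quadratic the value -1.\<close>
      show False using quad[of "- (ip u u + 1) / (2 * ip u v)"] True ne by (simp add: field_simps)
    qed
    then show ?thesis using True by simp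
  next
    case False
    then have pos: "ip v v > 0" using rkhs_ip_nonneg[OF rk v] by simp
    have "0 \<le> ip u u - (ip u v)\<^sup>2 / ip v v"
      using quad[of "- ip u v / ip v v"] pos by (simp add: field_simps power2_eq_square)
    then show ?thesis using pos by (simp add: field_simps)
  qed
  then have "sqrt ((ip u v)\<^sup>2) \<le> sqrt (ip u u * ip v v)" by (rule real_sqrt_le_mono)
  then show ?thesis by (simp add: real_sqrt_mult)
qed

text \<open>Constructs the Riesz representer of a finite combination of point evaluations.
  Membership and formula go through one induction, since additivity of \<open>ip\<close> presupposes
  membership.\<close>

lemma rkhs_finite_combination:
  assumes rk: "is_rkhs X R H ip" and "finite I" and "\<And>i. i \<in> I \<Longrightarrow> s i \<in> X"
  shows "(\<lambda>r\<in>X. \<Sum>i\<in>I. a i * R r (s i)) \<in> H \<and>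
    (\<forall>w\<in>H. ip w (\<lambda>r\<in>X. \<Sum>i\<in>I. a i * R r (s i)) = (\<Sum>i\<in>I. a i * w (s i)))"
  using assms(2,3)
proof (induction I rule: finite_induct)
  case empty
  have z: "(\<lambda>s\<in>X. 0) \<in> H" using rkhs_zero[OF rk] .
  have "ip w (\<lambda>s\<in>X. 0) = 0" if w: "w \<in> H" for w
    using rkhs_ip_scale[OF rk z w, of 0] rkhs_ip_sym[OF rk z w] by (simp cong: restrict_cong)
  then show ?case using z by (simp del: restrict_apply)
next
  case (insert j I)
  let ?u = "\<lambda>r\<in>X. \<Sum>i\<in>I. a i * R r (s i)" and ?k = "\<lambda>r\<in>X. R r (s j)"
  let ?ak = "\<lambda>r\<in>X. a j * ?k r"
  have sj: "s j \<in> X" using insert by simp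
  have u: "?u \<in> H" and ipu: "\<And>w. w \<in> H \<Longrightarrow> ip w ?u = (\<Sum>i\<in>I. a i * w (s i))"
    using insert.IH[OF insert.prems[OF insertI2]] by blast+
  have k: "?k \<in> H" using rkhs_kernel[OF rk sj] .
  have ak: "?ak \<in> H" using rkhs_scale[OF rk k] .
  have eq: "(\<lambda>r\<in>X. \<Sum>i\<in>insert j I. a i * R r (s i)) = (\<lambda>r\<in>X. ?ak r + ?u r)"
    using insert(1,2) by (intro ext) (simp add: restrict_def)
  have sum: "(\<lambda>r\<in>X. ?ak r + ?u r) \<in> H" using rkhs_add[OF rk ak u] .
  have "ip w (\<lambda>r\<in>X. ?ak r + ?u r) = (\<Sum>i\<in>insert j I. a i * w (s i))" if w: "w \<in> H" for w
  proof -
    have "ip w (\<lambda>r\<in>X. ?ak r + ?u r) = ip ?ak w + ip ?u w"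
      using rkhs_ip_sym[OF rk w sum] rkhs_ip_add[OF rk ak u w] by simp
    also have "ip ?ak w = a j * w (s j)"
      using rkhs_ip_scale[OF rk k w] rkhs_ip_sym[OF rk k w] rkhs_reproducing[OF rk sj w] by simp
    also have "ip ?u w = (\<Sum>i\<in>I. a i * w (s i))" using rkhs_ip_sym[OF rk u w] ipu[OF w] by simp
    finally show ?thesis by (simp only: sum.insert[OF insert(1,2)])
  qed
  then show ?case unfolding eq using sum by blast
qed

text \<open>Cauchy-Schwarz against the representer, whose squared norm is this Gram form.\<close>

lemma rkhs_functional_bound:
  assumes rk: "is_rkhs X R H ip" and I: "finite I" "\<And>i. i \<in> I \<Longrightarrow> s i \<in> X" and w: "w \<in> H"
  shows "\<bar>\<Sum>i\<in>I. a i * w (s i)\<bar> \<le>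
      sqrt (ip w w) * sqrt (\<Sum>i\<in>I. \<Sum>j\<in>I. a i * (a j * R (s i) (s j)))"
    and "0 \<le> (\<Sum>i\<in>I. \<Sum>j\<in>I. a i * (a j * R (s i) (s j)))"
proof -
  let ?u = "\<lambda>r\<in>X. \<Sum>i\<in>I. a i * R r (s i)"
  have u: "?u \<in> H" and ipu: "\<And>w. w \<in> H \<Longrightarrow> ip w ?u = (\<Sum>i\<in>I. a i * w (s i))"
    using rkhs_finite_combination[OF rk I, where a = a] by auto
  have uu: "ip ?u ?u = (\<Sum>i\<in>I. \<Sum>j\<in>I. a i * (a j * R (s i) (s j)))"
    unfolding ipu[OF u] using I(2) by (intro sum.cong refl) (simp add: sum_distrib_left)
  show "\<bar>\<Sum>i\<in>I. a i * w (s i)\<bar> \<le>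
      sqrt (ip w w) * sqrt (\<Sum>i\<in>I. \<Sum>j\<in>I. a i * (a j * R (s i) (s j)))"
    using rkhs_Cauchy_Schwarz[OF rk w u] unfolding ipu[OF w] uu .
  show "0 \<le> (\<Sum>i\<in>I. \<Sum>j\<in>I. a i * (a j * R (s i) (s j)))"
    using rkhs_ip_nonneg[OF rk u] unfolding uu .
qed

text \<open>Both values are the inner product of the sections at \<open>s\<close> and at
  \<open>t\<close>.\<close>

lemma rkhs_kernel_sym:
  assumes rk: "is_rkhs X R H ip" and "s \<in> X" "t \<in> X"
  shows "R s t = R t s"
  using rkhs_ip_sym[OF rk rkhs_kernel[OF rk assms(2)] rkhs_kernel[OF rk assms(3)]]
    rkhs_reproducing[OF rk assms(3) rkhs_kernel[OF rk assms(2)]]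
    rkhs_reproducing[OF rk assms(2) rkhs_kernel[OF rk assms(3)]] assms by simp

text \<open>The squared distance of two sections is the variance of an increment of the process; it
  controls the interval to the left of the first node. The type \<open>bool\<close> serves as an
  index set with two elements.\<close>

lemma rkhs_kernel_diff:
  assumes rk: "is_rkhs X R H ip" and u: "u \<in> X" and v: "v \<in> X"
  shows "(\<lambda>s\<in>X. R s u - R s v) \<in> H"
    and "ip (\<lambda>s\<in>X. R s u - R s v) (\<lambda>s\<in>X. R s u - R s v) = R u u - 2 * R u v + R v v"
proof -
  let ?a = "\<lambda>b. if b then 1 else -1::real" and ?s = "\<lambda>b. if b then u else v"
  have eq: "(\<lambda>r\<in>X. \<Sum>i\<in>UNIV. ?a i * R r (?s i)) = (\<lambda>s\<in>X. R s u - R s v)"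
    by (simp add: UNIV_bool cong: restrict_cong)
  have *: "(\<lambda>s\<in>X. R s u - R s v) \<in> H \<and>
    (\<forall>w\<in>H. ip w (\<lambda>s\<in>X. R s u - R s v) = (\<Sum>i\<in>UNIV. ?a i * w (?s i)))"
    using rkhs_finite_combination[OF rk, of UNIV ?s ?a] u v unfolding eq by simp
  then show "(\<lambda>s\<in>X. R s u - R s v) \<in> H" by blast
  then show "ip (\<lambda>s\<in>X. R s u - R s v) (\<lambda>s\<in>X. R s u - R s v) = R u u - 2 * R u v + R v v"
    using * u v rkhs_kernel_sym[OF rk u v] by (simp add: UNIV_bool)
qed

subsection \<open>Riemann sums\<close>

lemma continuous_on_section:
  assumes "continuous_on (A \<times> B) (\<lambda>(s, t). F s t)" "s \<in> A"
  shows "continuous_on B (F s)"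
proof -
  have p: "continuous_on B (\<lambda>t. (s, t))" by (intro continuous_intros)
  have im: "(\<lambda>t. (s, t)) ` B \<subseteq> A \<times> B" using assms by auto
  show ?thesis using continuous_on_compose2[OF assms(1) p im] by simp
qed

definition riemann_sum :: "nat \<Rightarrow> (real \<Rightarrow> real) \<Rightarrow> real" where
  "riemann_sum N F = (\<Sum>k<N. F (real k / real N)) / real N"

text \<open>A cell has length 1 / N and the integrand stays within \<open>e\<close> of its value at
  the left end, so each cell contributes at most e / N. The induction runs over the number of cells
  already compared.\<close>

lemma riemann_sum_error:
  assumes N: "N > 0" and F: "continuous_on {0..1} F"
    and osc: "\<And>s t. s \<in> {0..1} \<Longrightarrow> t \<in> {0..1} \<Longrightarrow> \<bar>s - t\<bar> \<le> 1 / real N \<Longrightarrow> \<bar>F s - F t\<bar> \<le> e"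
  shows "\<bar>riemann_sum N F - integral {0..1} F\<bar> \<le> e"
proof -
  have int: "F integrable_on {a..b}" if "0 \<le> a" "b \<le> 1" for a b
    using F that by (intro integrable_continuous_real) (auto intro: continuous_on_subset)
  have *: "\<bar>(\<Sum>k<m. F (real k / real N)) / real N - integral {0..real m / real N} F\<bar>
      \<le> e * real m / real N" if "m \<le> N" for m
    using that
  proof (induction m)
    case (Suc m)
    let ?a = "real m / real N" and ?b = "real (Suc m) / real N"
    have ab: "0 \<le> ?a" "?a \<le> ?b" "?b \<le> 1" "?b - ?a = 1 / real N"
      using Suc.prems N by (auto simp: field_simps)
    have "integral {0..?b} F = integral {0..?a} F + integral {?a..?b} F"
      using ab by (intro Henstock_Kurzweil_Integration.integral_combine[symmetric] int) auto
    moreover have "\<bar>F ?a / real N - integral {?a..?b} F\<bar> \<le> e * (1 / real N)"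
    proof -
      have "((\<lambda>t. F ?a - F t) has_integral (?b - ?a) * F ?a - integral {?a..?b} F) {?a..?b}"
        using ab has_integral_const_real[of "F ?a" ?a ?b]
        by (intro has_integral_diff integrable_integral int) auto
      moreover have "norm (F ?a - F t) \<le> e" if "t \<in> {?a..?b}" for t
        using osc[of ?a t] that ab order_trans[OF ab(1), of t] by auto
      moreover have "0 \<le> e" using osc[of 0 0] N by simp
      ultimately have "norm ((?b - ?a) * F ?a - integral {?a..?b} F) \<le> e * (?b - ?a)"
        using has_integral_bound_real[of e "{}" "\<lambda>t. F ?a - F t" _ ?a ?b] ab by simp
      then show ?thesis unfolding ab(4) by (simp add: mult.commute)
    qed
    ultimately show ?case using Suc by (simp add: add_divide_distrib distrib_left)
  qed simp
  show ?thesis using *[of N] N unfolding riemann_sum_def by simp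
qed

lemma riemann_sum_tendsto:
  assumes F: "continuous_on {0..1} F"
  shows "(\<lambda>N. riemann_sum N F) \<longlonglongrightarrow> integral {0..1} F"
proof (rule LIMSEQ_I)
  fix r :: real assume r: "0 < r"
  have "uniformly_continuous_on {0..1} F" using F by (intro compact_uniformly_continuous) auto
  then obtain d where d: "d > 0"
    "\<And>s t. s \<in> {0..1} \<Longrightarrow> t \<in> {0..1} \<Longrightarrow> dist t s < d \<Longrightarrow> dist (F t) (F s) < r / 2"
    using r unfolding uniformly_continuous_on_def by (metis half_gt_zero)
  obtain n0 where n0: "real n0 > 1 / d" using reals_Archimedean2 by blast
  show "\<exists>no. \<forall>n\<ge>no. norm (riemann_sum n F - integral {0..1} F) < r"
  proof (intro exI[of _ n0] allI impI)
    fix n assume n: "n \<ge> n0"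
    have p: "real n > 1 / d" using n n0 by linarith
    then have n: "0 < n" using d(1) by (metis of_nat_0_less_iff less_trans zero_less_divide_1_iff)
    have nd: "1 / real n < d" using p d(1) n by (simp add: field_simps)
    have "\<bar>riemann_sum n F - integral {0..1} F\<bar> \<le> r / 2"
      using nd d(2) n by (intro riemann_sum_error F) (force simp: dist_real_def)+
    then show "norm (riemann_sum n F - integral {0..1} F) < r" using r by simp
  qed
qed

text \<open>One modulus of uniform continuity serves twice: the inner sums are close to the inner
  integrals uniformly in \<open>s\<close>, and the inner integral oscillates as little as
  \<open>F\<close> itself. Each comparison costs r / 3, which leaves the final inequality
  strict.\<close>

lemma riemann_sum_tendsto_double:
  assumes F: "continuous_on ({0..1} \<times> {0..1}) (\<lambda>(s, t). F s t)"
  shows "(\<lambda>N. riemann_sum N (\<lambda>s. riemann_sum N (F s))) \<longlonglongrightarrow>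
    integral {0..1} (\<lambda>s. integral {0..1} (F s))"
proof (rule LIMSEQ_I)
  fix r :: real assume r: "0 < r"
  have cF: "continuous_on {0..1} (F s)" if "s \<in> {0..1}" for s
    using continuous_on_section[OF F that] .
  have "compact ({0..1::real} \<times> {0..1::real})" by (intro compact_Times) auto
  then have "uniformly_continuous_on ({0..1} \<times> {0..1}) (\<lambda>(s, t). F s t)"
    using F by (intro compact_uniformly_continuous) auto
  then obtain d where d: "d > 0"
    "\<And>p q. p \<in> {0..1} \<times> {0..1} \<Longrightarrow> q \<in> {0..1} \<times> {0..1} \<Longrightarrow> dist q p < d \<Longrightarrow>
      dist (case q of (s, t) \<Rightarrow> F s t) (case p of (s, t) \<Rightarrow> F s t) < r / 3"
    using r unfolding uniformly_continuous_on_def by (metis divide_pos_pos zero_less_numeral)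
  have d1: "\<bar>F s t - F s t'\<bar> \<le> r / 3" if "s \<in> {0..1}" "t \<in> {0..1}" "t' \<in> {0..1}" "\<bar>t - t'\<bar> < d" for s t t'
    using d(2)[of "(s, t')" "(s, t)"] that by (simp add: dist_prod_def dist_real_def)
  have d2: "\<bar>F s t - F s' t\<bar> \<le> r / 3" if "s \<in> {0..1}" "t \<in> {0..1}" "s' \<in> {0..1}" "\<bar>s - s'\<bar> < d" for s t s'
    using d(2)[of "(s', t)" "(s, t)"] that by (simp add: dist_prod_def dist_real_def)
  obtain n0 where n0: "real n0 > 1 / d" using reals_Archimedean2 by blast
  have lip: "\<bar>integral {0..1} (F s) - integral {0..1} (F s')\<bar> \<le> r / 3"
    if "s \<in> {0..1}" "s' \<in> {0..1}" "\<bar>s - s'\<bar> < d" for s s'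
  proof -
    have "integral {0..1} (F s) - integral {0..1} (F s') = integral {0..1} (\<lambda>t. F s t - F s' t)"
      using that by (intro Henstock_Kurzweil_Integration.integral_diff[symmetric] integrable_continuous_real cF)
    moreover have "norm (integral {0..1} (\<lambda>t. F s t - F s' t)) \<le> r / 3 * (1 - 0)"
      using that d2 by (intro integral_bound continuous_on_diff cF) auto
    ultimately show ?thesis by simp
  qed
  show "\<exists>no. \<forall>n\<ge>no. norm (riemann_sum n (\<lambda>s. riemann_sum n (F s)) -
    integral {0..1} (\<lambda>s. integral {0..1} (F s))) < r"
  proof (intro exI[of _ n0] allI impI)
    fix n assume n: "n \<ge> n0"
    have p: "real n > 1 / d" using n n0 by linarith
    then have n: "0 < n" using d(1) by (metis of_nat_0_less_iff less_trans zero_less_divide_1_iff)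
    have nd: "1 / real n < d" using p d(1) n by (simp add: field_simps)
    have 1: "\<bar>riemann_sum n (F s) - integral {0..1} (F s)\<bar> \<le> r / 3" if "s \<in> {0..1}" for s
      using nd d1 n that by (intro riemann_sum_error cF) force+
    have "continuous_on {0..1} (\<lambda>s. integral {0..1} (F s))"
      unfolding cbox_interval[symmetric] using F
      by (intro integral_continuous_on_param) (simp add: cbox_interval)
    then have 2: "\<bar>riemann_sum n (\<lambda>s. integral {0..1} (F s)) -
        integral {0..1} (\<lambda>s. integral {0..1} (F s))\<bar> \<le> r / 3"
      using nd n lip by (intro riemann_sum_error) force+
    have "riemann_sum n (\<lambda>s. riemann_sum n (F s)) - riemann_sum n (\<lambda>s. integral {0..1} (F s)) =
      riemann_sum n (\<lambda>s. riemann_sum n (F s) - integral {0..1} (F s))"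
      unfolding riemann_sum_def[of n "\<lambda>s. riemann_sum n (F s)"]
        riemann_sum_def[of n "\<lambda>s. integral {0..1} (F s)"]
        riemann_sum_def[of n "\<lambda>s. riemann_sum n (F s) - integral {0..1} (F s)"]
      by (simp add: sum_subtractf diff_divide_distrib)
    moreover have "\<bar>\<Sum>k<n. riemann_sum n (F (real k / real n)) - integral {0..1} (F (real k / real n))\<bar>
       \<le> (\<Sum>k<n. r / 3)"
      using n by (intro order_trans[OF sum_abs] sum_mono 1) (auto simp: field_simps)
    then have "\<bar>riemann_sum n (\<lambda>s. riemann_sum n (F s) - integral {0..1} (F s))\<bar> \<le> r / 3"
      unfolding riemann_sum_def[of n "\<lambda>s. riemann_sum n (F s) - integral {0..1} (F s)"]
      using n by (simp add: field_simps)
    ultimately show "norm (riemann_sum n (\<lambda>s. riemann_sum n (F s)) -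
    integral {0..1} (\<lambda>s. integral {0..1} (F s))) < r"
      using r 2 unfolding real_norm_def by linarith
  qed
qed

subsection \<open>One-sided derivatives of the kernel\<close>

text \<open>The primitive is \<open>q * u' - q' * u\<close>. Only one-sided limits of
  \<open>u'\<close> are prescribed at the end points, so \<open>U\<close> puts them in place of
  \<open>u'\<close> there; this admits a \<open>u\<close> with a kink at an end point, as kernel
  sections have on the diagonal.\<close>

lemma integration_by_parts_twice:
  fixes u u' u'' q q' w :: "real \<Rightarrow> real"
  assumes ab: "a < b" and u: "continuous_on {a..b} u"
    and du: "\<And>v. v \<in> {a<..<b} \<Longrightarrow> (u has_real_derivative u' v) (at v)"
    and ddu: "\<And>v. v \<in> {a<..<b} \<Longrightarrow> (u' has_real_derivative u'' v) (at v)"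
    and la: "(u' \<longlongrightarrow> la) (at_right a)" and lb: "(u' \<longlongrightarrow> lb) (at_left b)"
    and dq: "\<And>v. v \<in> {a..b} \<Longrightarrow> (q has_real_derivative q' v) (at v within {a..b})"
    and ddq: "\<And>v. v \<in> {a..b} \<Longrightarrow> (q' has_real_derivative - w v) (at v within {a..b})"
  shows "((\<lambda>v. w v * u v + q v * u'' v) has_integral
    (q b * lb - q' b * u b) - (q a * la - q' a * u a)) {a..b}"
proof -
  define U where "U v = (if v = a then la else if v = b then lb else u' v)" for v
  have U: "continuous_on {a..b} U"
  proof (rule continuous_on_IccI[OF _ _ _ ab])
    have "\<forall>\<^sub>F v in at_right a. u' v = U v"
      using ab unfolding U_def by (intro eventually_at_rightI[of a b]) auto
    moreover have "U a = la" by (simp add: U_def)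
    ultimately show "(U \<longlongrightarrow> U a) (at_right a)" using Lim_transform_eventually[OF la] by simp
    have "\<forall>\<^sub>F v in at_left b. u' v = U v"
      using ab unfolding U_def by (intro eventually_at_leftI[of a b]) auto
    moreover have "U b = lb" using ab by (simp add: U_def)
    ultimately show "(U \<longlongrightarrow> U b) (at_left b)" using Lim_transform_eventually[OF lb] by simp
    fix v assume v: "a < v" "v < b"
    have "isCont u' v" using ddu[of v] v DERIV_isCont by auto
    then have "(u' \<longlongrightarrow> u' v) (at v)" by (simp add: isCont_def)
    moreover have "\<forall>\<^sub>F x in at v. u' x = U x"
      using v by (intro eventually_at_in_open[THEN eventually_mono, of "{a<..<b}"])
        (auto simp: U_def)
    ultimately have "(U \<longlongrightarrow> u' v) (at v)" by (rule Lim_transform_eventually)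
    moreover have "U v = u' v" using v by (simp add: U_def)
    ultimately show "U \<midarrow>v\<rightarrow> U v" by simp
  qed
  have q: "continuous_on {a..b} q" and q': "continuous_on {a..b} q'"
    using DERIV_continuous_on[OF dq] DERIV_continuous_on[OF ddq] by auto
  have "((\<lambda>v. w v * u v + q v * u'' v) has_integral
    (q b * U b - q' b * u b) - (q a * U a - q' a * u a)) {a..b}"
  proof (rule fundamental_theorem_of_calculus_interior)
    show "continuous_on {a..b} (\<lambda>v. q v * U v - q' v * u v)"
      by (intro continuous_intros q q' U u)
    fix v assume v: "v \<in> {a<..<b}"
    have at: "at v within {a..b} = at v" using v by (intro at_within_interior) auto
    have "((\<lambda>v. q v * u' v - q' v * u v) has_real_derivative w v * u v + q v * u'' v) (at v)"
      using v dq[of v] ddq[of v] du[OF v] ddu[OF v] unfolding at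
      by (auto intro!: derivative_eq_intros simp: algebra_simps)
    then have "((\<lambda>v. q v * U v - q' v * u v) has_real_derivative w v * u v + q v * u'' v) (at v)"
      by (rule has_field_derivative_transform_within_open[of _ _ _ "{a<..<b}"])
        (use v in \<open>auto simp: U_def\<close>)
    then show "((\<lambda>v. q v * U v - q' v * u v) has_vector_derivative w v * u v + q v * u'' v) (at v)"
      by (simp add: has_real_derivative_iff_has_vector_derivative)
  qed (use ab in auto)
  then show ?thesis using ab by (simp add: U_def)
qed

lemma
  assumes A: "assumption_A R" and s: "s \<in> {0..1}" and v: "v \<in> {0..1}" and ne: "v \<noteq> s"
  shows kernel_R01: "(R s has_real_derivative R01 R s v) (at v within {0..1})"
    and kernel_R02: "(R01 R s has_real_derivative R02 R s v) (at v within {0..1})"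
proof -
  have off: "(s, v) \<in> off_diagonal" using s v ne by (simp add: off_diagonal_def)
  have "C1_off_diagonal R" "C1_off_diagonal (d_snd R)"
    using A by (simp_all add: assumption_A_def C2_off_diagonal_def)
  then have "R s differentiable (at v within {0..1})" "R01 R s differentiable (at v within {0..1})"
    using off unfolding C1_off_diagonal_def by fastforce+
  then show "(R s has_real_derivative R01 R s v) (at v within {0..1})"
    "(R01 R s has_real_derivative R02 R s v) (at v within {0..1})"
    unfolding has_real_derivative_iff_has_vector_derivative d_snd_def
    by (simp_all only: vector_derivative_works[symmetric])
qed

text \<open>Off the diagonal \<open>R02 R s\<close> is continuous, so a one-sided limit is the
  value. The two cases follow the convention that the limit at 1 comes from the left.\<close>

lemma kernel_R02_plus:
  assumes A: "assumption_A R" and s: "s \<in> {0..1}" and v: "v \<in> {0..1}" and ne: "v \<noteq> s"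
  shows "R02_plus R s v = R02 R s v"
proof -
  have off: "(s, v) \<in> off_diagonal" using s v ne by (simp add: off_diagonal_def)
  have "C1_off_diagonal (d_snd R)"
    using A by (simp_all add: assumption_A_def C2_off_diagonal_def)
  then have c: "continuous_on off_diagonal (\<lambda>(s, t). R02 R s t)"
    unfolding C1_off_diagonal_def by blast
  let ?S = "{0..1} - {s}"
  have p: "continuous_on ?S (\<lambda>u. (s, u))" by (intro continuous_intros)
  have im: "(\<lambda>u. (s, u)) ` ?S \<subseteq> off_diagonal" using s by (auto simp: off_diagonal_def)
  have "continuous_on ?S (R02 R s)" using continuous_on_compose2[OF c p im] by simp
  then have t: "(R02 R s \<longlongrightarrow> R02 R s v) (at v within ?S)"
    using v ne by (simp add: continuous_on_def)
  show ?thesis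
  proof (cases "v < 1")
    case True
    \<comment> \<open>Between \<open>v\<close> and \<open>m\<close> the interval avoids the singular
      point \<open>s\<close> and stays inside the unit interval.\<close>
    define m where "m = (if s > v then s else 1)"
    have m: "v < m" "{v<..<m} \<subseteq> ?S" using v s ne True by (auto simp: m_def split: if_splits)
    have "at_right v = at v within {v<..<m}"
      using m(1) by (subst at_within_nhd[of v "{..<m}" "{v<..}" "{v<..<m}"]) auto
    then have "(R02 R s \<longlongrightarrow> R02 R s v) (at_right v)"
      using tendsto_within_subset[OF t m(2)] by simp
    then show ?thesis using True by (simp add: R02_plus_def tendsto_Lim)
  next
    case False
    then have v1: "v = 1" using v by simp
    have m: "s < v" "{s<..<v} \<subseteq> ?S" using v s ne v1 by auto
    have "at_left v = at v within {s<..<v}"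
      using m(1) by (subst at_within_nhd[of v "{s<..}" "{..<v}" "{s<..<v}"]) auto
    then have "(R02 R s \<longlongrightarrow> R02 R s v) (at_left v)"
      using tendsto_within_subset[OF t m(2)] by simp
    then show ?thesis using v1 by (simp add: R02_plus_def tendsto_Lim)
  qed
qed

text \<open>On the diagonal the limit is granted by (A); elsewhere \<open>R01 R s\<close> is
  differentiable, hence continuous. The second clause identifies the limit at the kink, where it
  becomes part of \<open>alpha\<close>.\<close>

lemma kernel_R01_right_limit:
  assumes A: "assumption_A R" and s: "s \<in> {0..1}" and v: "v \<in> {0..<1}"
  obtains l where "(R01 R s \<longlongrightarrow> l) (at_right v)" "s = v \<Longrightarrow> l = diag_right (R01 R) s"
proof (cases "v = s")
  case True
  then obtain l where l: "(R01 R s \<longlongrightarrow> l) (at_right s)"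
    using A v unfolding assumption_A_def diag_limits_exist_continuous_def by blast
  then have "diag_right (R01 R) s = l" unfolding diag_right_def by (intro tendsto_Lim) auto
  then show ?thesis using that l True by auto
next
  case False
  have "(R01 R s \<longlongrightarrow> R01 R s v) (at v within {0..1})"
    using DERIV_continuous[OF kernel_R02[OF A s _ False]] v by (simp add: continuous_within)
  then have "(R01 R s \<longlongrightarrow> R01 R s v) (at v within {v..1})"
    by (rule tendsto_within_subset) (use v in auto)
  then show ?thesis using that False v by (simp add: at_within_Icc_at_right)
qed

lemma kernel_R01_left_limit:
  assumes A: "assumption_A R" and s: "s \<in> {0..1}" and v: "v \<in> {0<..1}"
  obtains l where "(R01 R s \<longlongrightarrow> l) (at_left v)" "s = v \<Longrightarrow> l = diag_left (R01 R) s"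
proof (cases "v = s")
  case True
  then obtain l where l: "(R01 R s \<longlongrightarrow> l) (at_left s)"
    using A v unfolding assumption_A_def diag_limits_exist_continuous_def by blast
  then have "diag_left (R01 R) s = l" unfolding diag_left_def by (intro tendsto_Lim) auto
  then show ?thesis using that l True by auto
next
  case False
  have "(R01 R s \<longlongrightarrow> R01 R s v) (at v within {0..1})"
    using DERIV_continuous[OF kernel_R02[OF A s _ False]] v by (simp add: continuous_within)
  then have "(R01 R s \<longlongrightarrow> R01 R s v) (at v within {0..v})"
    by (rule tendsto_within_subset) (use v in auto)
  then show ?thesis using that False v by (simp add: at_within_Icc_at_left)
qed

text \<open>The jump \<open>- alpha R s\<close> of \<open>R01 R s\<close> at \<open>s\<close> produces the only term that is not controlled by the
  second derivative.\<close>
lemma kernel_by_parts: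
  assumes A: "assumption_A R" and s: "s \<in> {0..1}" and ab: "0 \<le> a" "a < b" "b \<le> 1"
    and dq: "\<And>v. v \<in> {a..b} \<Longrightarrow> (q has_real_derivative q' v) (at v within {a..b})"
    and ddq: "\<And>v. v \<in> {a..b} \<Longrightarrow> (q' has_real_derivative - w v) (at v within {a..b})"
    and q0: "q a = 0" "q b = 0"
  shows "((\<lambda>v. w v * R s v + q v * R02_plus R s v) has_integral
    (if s \<in> {a<..<b} then alpha R s * q s else 0) + q' a * R s a - q' b * R s b) {a..b}"
proof -
  have cR: "continuous_on {0..1} (R s)"
    using A s continuous_on_section[of "{0..1}" "{0..1}" R s] by (simp add: assumption_A_def)
  \<comment> \<open>The point \<open>s\<close> may be an end point of the piece but not lie inside
    it, so that the section is smooth in the interior.\<close>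
  have piece: "((\<lambda>v. w v * R s v + q v * R02_plus R s v) has_integral
      (q e * le - q' e * R s e) - (q d * ld - q' d * R s d)) {d..e}"
    if de: "a \<le> d" "d < e" "e \<le> b" and sn: "s \<notin> {d<..<e}"
      and ld: "(R01 R s \<longlongrightarrow> ld) (at_right d)" and le: "(R01 R s \<longlongrightarrow> le) (at_left e)" for d e ld le
  proof -
    have at: "at v within {0..1} = at v" if "v \<in> {d<..<e}" for v
      using that de ab by (intro at_within_interior) auto
    have "((\<lambda>v. w v * R s v + q v * R02 R s v) has_integral
      (q e * le - q' e * R s e) - (q d * ld - q' d * R s d)) {d..e}"
    proof (rule integration_by_parts_twice[OF de(2) _ _ _ ld le])
      show "continuous_on {d..e} (R s)" using cR de ab by (auto intro: continuous_on_subset)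
      fix v assume v: "v \<in> {d<..<e}"
      then have v': "v \<in> {0..1}" "v \<noteq> s" using de ab sn by auto
      show "(R s has_real_derivative R01 R s v) (at v)"
        using kernel_R01[OF A s v'] at[OF v] by simp
      show "(R01 R s has_real_derivative R02 R s v) (at v)"
        using kernel_R02[OF A s v'] at[OF v] by simp
    next
      fix v assume v: "v \<in> {d..e}"
      show "(q has_real_derivative q' v) (at v within {d..e})"
        "(q' has_real_derivative - w v) (at v within {d..e})"
        using v de by (auto intro!: DERIV_subset[OF dq] DERIV_subset[OF ddq])
    qed
    \<comment> \<open>The two versions of the second derivative can differ only at the single point
      \<open>s\<close>.\<close>
    then show ?thesis
    proof (rule has_integral_spike_finite[of "{s}", rotated 2])
      fix v assume "v \<in> {d..e} - {s}"
      then show "w v * R s v + q v * R02_plus R s v = w v * R s v + q v * R02 R s v"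
        using kernel_R02_plus[OF A s, of v] de ab by simp
    qed simp
  qed
  obtain la where la: "(R01 R s \<longlongrightarrow> la) (at_right a)"
    using kernel_R01_right_limit[OF A s, of a] ab by auto
  obtain lb where lb: "(R01 R s \<longlongrightarrow> lb) (at_left b)"
    using kernel_R01_left_limit[OF A s, of b] ab by auto
  show ?thesis
  proof (cases "s \<in> {a<..<b}")
    case True
    have sr: "(R01 R s \<longlongrightarrow> diag_right (R01 R) s) (at_right s)"
      using kernel_R01_right_limit[OF A s, of s] True ab by auto
    have sl: "(R01 R s \<longlongrightarrow> diag_left (R01 R) s) (at_left s)"
      using kernel_R01_left_limit[OF A s, of s] True ab by auto
    \<comment> \<open>Split at the kink: the terms with \<open>q' s\<close> cancel, while those with
      \<open>q s\<close> leave the left limit minus the right limit, which is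
      \<open>alpha R s\<close>.\<close>
    have "((\<lambda>v. w v * R s v + q v * R02_plus R s v) has_integral
      ((q s * diag_left (R01 R) s - q' s * R s s) - (q a * la - q' a * R s a)) +
      ((q b * lb - q' b * R s b) - (q s * diag_right (R01 R) s - q' s * R s s))) {a..b}"
      using True by (intro has_integral_combine[of a s b] piece la lb sl sr) auto
    then show ?thesis using True q0 by (simp add: alpha_def algebra_simps)
  next
    case False
    then show ?thesis using piece[OF _ ab(2) _ False la lb] q0 by auto
  qed
qed

section \<open>The error functional of a quadrature rule and its norm\<close>

locale quadrature_functional =
  fixes R :: "real \<Rightarrow> real \<Rightarrow> real" and H :: "(real \<Rightarrow> real) set"
    and ip :: "(real \<Rightarrow> real) \<Rightarrow> (real \<Rightarrow> real) \<Rightarrow> real"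
    and w :: "real \<Rightarrow> real" and c t :: "nat \<Rightarrow> real" and n :: nat
  assumes rk: "is_rkhs {0..1} R H ip"
    and contR: "continuous_on ({0..1} \<times> {0..1}) (\<lambda>(s, t). R s t)"
    and contw: "continuous_on {0..1} w"
    and nodes: "\<And>i. i < n \<Longrightarrow> t i \<in> {0..1}"
begin

text \<open>The functional \<open>\<lambda>\<close> of the overview.\<close>

definition err :: "(real \<Rightarrow> real) \<Rightarrow> real" where
  "err F = integral {0..1} (\<lambda>s. w s * F s) - (\<Sum>i<n. c i * F (t i))"

text \<open>Replacing the density \<open>w\<close> by point masses makes the functional a finite combination of point
  evaluations, to which the Cauchy--Schwarz inequality of the Hilbert space applies directly; no
  vector-valued integrals are needed.\<close>
definition derr :: "nat \<Rightarrow> (real \<Rightarrow> real) \<Rightarrow> real" where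
  "derr N F = riemann_sum N (\<lambda>s. w s * F s) - (\<Sum>i<n. c i * F (t i))"

text \<open>\<open>D\<^sup>2\<close> of the overview: the functional acts on both variables of
  \<open>R\<close>, which gives its squared norm on the Hilbert space.\<close>

definition err2 :: real where "err2 = err (\<lambda>s. err (R s))"
definition derr2 :: "nat \<Rightarrow> real" where "derr2 N = derr N (\<lambda>s. derr N (R s))"

text \<open>Indices in a disjoint sum keep the point k / N of the discretised density apart from a
  design node with the same value, so coefficients never have to be merged.\<close>

definition coef :: "nat \<Rightarrow> nat + nat \<Rightarrow> real" where
  "coef N = case_sum (\<lambda>k. w (real k / real N) / real N) (\<lambda>i. - c i)"
definition node :: "nat \<Rightarrow> nat + nat \<Rightarrow> real" where
  "node N = case_sum (\<lambda>k. real k / real N) t"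

lemma derr_eq_sum: "derr N F = (\<Sum>j\<in>{..<N} <+> {..<n}. coef N j * F (node N j))"
  by (simp add: derr_def riemann_sum_def sum.Plus coef_def node_def sum_negf sum_divide_distrib)

lemma node_in_unit: "j \<in> {..<N} <+> {..<n} \<Longrightarrow> node N j \<in> {0..1}"
  using nodes by (auto simp: node_def)

lemma derr2_eq_sum:
  "derr2 N = (\<Sum>i\<in>{..<N} <+> {..<n}. \<Sum>j\<in>{..<N} <+> {..<n}.
     coef N i * (coef N j * R (node N i) (node N j)))"
  by (simp add: derr2_def derr_eq_sum sum_distrib_left)

lemma derr_bound:
  assumes "u \<in> H" shows "\<bar>derr N u\<bar> \<le> sqrt (ip u u) * sqrt (derr2 N)"
  unfolding derr2_eq_sum unfolding derr_eq_sum
  using node_in_unit by (intro rkhs_functional_bound(1)[OF rk] assms) auto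

lemma derr_tendsto:
  assumes "continuous_on {0..1} F" shows "(\<lambda>N. derr N F) \<longlonglongrightarrow> err F"
  unfolding derr_def err_def
  by (intro tendsto_diff riemann_sum_tendsto tendsto_const continuous_on_mult contw assms)

lemma contR_snd: "s \<in> {0..1} \<Longrightarrow> continuous_on {0..1} (R s)"
  using contR by (rule continuous_on_section)

lemma contR_fst: "v \<in> {0..1} \<Longrightarrow> continuous_on {0..1} (\<lambda>s. R s v)"
  using rkhs_kernel_sym[OF rk] by (intro continuous_on_eq[OF contR_snd[of v]])

lemma contwR: "continuous_on ({0..1} \<times> {0..1}) (\<lambda>(s, v). w v * R s v)"
proof -
  have "continuous_on ({0..1} \<times> {0..1}) (\<lambda>p. w (snd p))"
    by (rule continuous_on_compose2[OF contw continuous_on_snd]) (auto intro: continuous_intros)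
  from continuous_on_mult[OF this contR] show ?thesis by (simp add: case_prod_beta)
qed

lemma continuous_on_partial_integral:
  assumes "0 \<le> a" "b \<le> 1"
  shows "continuous_on {0..1} (\<lambda>s. integral {a..b} (\<lambda>v. w v * R s v))"
proof -
  have "continuous_on ({0..1} \<times> {a..b}) (\<lambda>(s, v). w v * R s v)"
    using assms by (intro continuous_on_subset[OF contwR]) auto
  then show ?thesis
    unfolding cbox_interval[symmetric]
    by (intro integral_continuous_on_param) (simp add: cbox_interval)
qed

text \<open>In \<open>derr N (\<lambda>s. derr N (R s))\<close> the functional and its argument both
  change with \<open>N\<close>, so \<open>derr_tendsto\<close> does not apply directly. Expansion
  separates a double Riemann sum, a single one and finitely many terms at the nodes, and each
  converges by itself.\<close>

lemma derr2_tendsto: "derr2 \<longlonglongrightarrow> err2"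
proof -
  let ?S = "\<lambda>s. w s * (\<Sum>i<n. c i * R s (t i))"
  have cS: "continuous_on {0..1} ?S" using nodes by (intro continuous_intros contw contR_fst) auto
  have "continuous_on ({0..1} \<times> {0..1}) (\<lambda>p. w (fst p))"
    by (rule continuous_on_compose2[OF contw continuous_on_fst]) (auto intro: continuous_intros)
  from continuous_on_mult[OF this contwR]
  have cc: "continuous_on ({0..1} \<times> {0..1}) (\<lambda>(s, v). w s * (w v * R s v))"
    by (simp add: case_prod_beta)
  have "derr2 N = riemann_sum N (\<lambda>s. riemann_sum N (\<lambda>v. w s * (w v * R s v)))
      - riemann_sum N ?S - (\<Sum>i<n. c i * derr N (R (t i)))" for N
  proof -
    have "riemann_sum N (\<lambda>s. w s * derr N (R s)) =
      riemann_sum N (\<lambda>s. riemann_sum N (\<lambda>v. w s * (w v * R s v))) - riemann_sum N ?S"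
      unfolding derr_def riemann_sum_def
      by (simp add: right_diff_distrib sum_subtractf diff_divide_distrib sum_distrib_left)
    then show ?thesis unfolding derr2_def by (subst derr_def) simp
  qed
  then have eq: "derr2 = (\<lambda>N. riemann_sum N (\<lambda>s. riemann_sum N (\<lambda>v. w s * (w v * R s v)))
      - riemann_sum N ?S - (\<Sum>i<n. c i * derr N (R (t i))))" by blast
  have i1: "(\<lambda>s. w s * integral {0..1} (\<lambda>v. w v * R s v)) integrable_on {0..1}"
    by (intro integrable_continuous_real continuous_on_mult contw continuous_on_partial_integral) auto
  have "err2 = integral {0..1} (\<lambda>s. w s * integral {0..1} (\<lambda>v. w v * R s v) - ?S s)
      - (\<Sum>i<n. c i * err (R (t i)))"
    unfolding err2_def by (subst err_def) (simp add: err_def right_diff_distrib)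
  also have "\<dots> = integral {0..1} (\<lambda>s. integral {0..1} (\<lambda>v. w s * (w v * R s v))) -
      integral {0..1} ?S - (\<Sum>i<n. c i * err (R (t i)))"
    using i1 integrable_continuous_real[OF cS]
    by (simp add: Henstock_Kurzweil_Integration.integral_diff)
  finally have eq': "err2 = integral {0..1} (\<lambda>s. integral {0..1} (\<lambda>v. w s * (w v * R s v))) -
      integral {0..1} ?S - (\<Sum>i<n. c i * err (R (t i)))" .
  show ?thesis unfolding eq eq'
    using nodes by (intro tendsto_intros riemann_sum_tendsto_double riemann_sum_tendsto cc cS
      derr_tendsto contR_snd) auto
qed

lemma derr2_nonneg: "0 \<le> derr2 N"
  unfolding derr2_eq_sum using node_in_unit rkhs_zero[OF rk]
  by (intro rkhs_functional_bound(2)[OF rk]) auto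

lemma err2_nonneg: "0 \<le> err2"
  using LIMSEQ_le_const[OF derr2_tendsto] derr2_nonneg by blast

text \<open>For the discrete functional the exchange with the integral over \<open>v\<close> is mere
  linearity, so \<open>derr N L\<close> is the integral of \<open>q v * derr N (G v)\<close>, and
  Cauchy-Schwarz applies under the integral. The limit in \<open>N\<close> is then taken only for
  \<open>L\<close> and for \<open>derr2\<close>, not for the single functions
  \<open>G v\<close>.\<close>

lemma err_integral_bound:
  fixes a b :: real
  assumes G: "\<And>s. s \<in> {0..1} \<Longrightarrow> ((\<lambda>v. q v * G v s) has_integral L s) {a..b}"
    and H: "\<And>v. v \<in> {a..b} \<Longrightarrow> G v \<in> H" "\<And>v. v \<in> {a..b} \<Longrightarrow> sqrt (ip (G v) (G v)) \<le> B"
    and q: "continuous_on {a..b} q" and L: "continuous_on {0..1} L"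
  shows "\<bar>err L\<bar> \<le> B * sqrt err2 * integral {a..b} (\<lambda>v. \<bar>q v\<bar>)"
proof -
  have *: "\<bar>derr N L\<bar> \<le> B * sqrt (derr2 N) * integral {a..b} (\<lambda>v. \<bar>q v\<bar>)" for N
  proof -
    have "((\<lambda>v. \<Sum>j\<in>{..<N} <+> {..<n}. coef N j * (q v * G v (node N j))) has_integral
        (\<Sum>j\<in>{..<N} <+> {..<n}. coef N j * L (node N j))) {a..b}"
      by (intro has_integral_sum has_integral_mult_right G node_in_unit) auto
    then have hi: "((\<lambda>v. q v * derr N (G v)) has_integral derr N L) {a..b}"
      by (simp add: derr_eq_sum sum_distrib_left algebra_simps)
    have "norm (integral {a..b} (\<lambda>v. q v * derr N (G v)))
        \<le> integral {a..b} (\<lambda>v. B * sqrt (derr2 N) * \<bar>q v\<bar>)"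
    proof (rule integral_norm_bound_integral)
      show "(\<lambda>v. q v * derr N (G v)) integrable_on {a..b}" using hi by blast
      show "(\<lambda>v. B * sqrt (derr2 N) * \<bar>q v\<bar>) integrable_on {a..b}"
        by (intro integrable_continuous_real continuous_on_mult continuous_on_const continuous_on_rabs q)
      fix v assume v: "v \<in> {a..b}"
      have "\<bar>derr N (G v)\<bar> \<le> B * sqrt (derr2 N)"
        using derr_bound[OF H(1)[OF v], of N] mult_right_mono[OF H(2)[OF v], of "sqrt (derr2 N)"]
          derr2_nonneg[of N] by simp
      then show "norm (q v * derr N (G v)) \<le> B * sqrt (derr2 N) * \<bar>q v\<bar>"
        by (simp add: abs_mult mult.commute mult_left_mono)
    qed
    then show ?thesis using integral_unique[OF hi] by simp
  qed
  have "(\<lambda>N. \<bar>derr N L\<bar>) \<longlonglongrightarrow> \<bar>err L\<bar>" by (intro tendsto_rabs derr_tendsto L)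
  moreover have "(\<lambda>N. B * sqrt (derr2 N) * integral {a..b} (\<lambda>v. \<bar>q v\<bar>)) \<longlonglongrightarrow>
      B * sqrt err2 * integral {a..b} (\<lambda>v. \<bar>q v\<bar>)"
    by (intro tendsto_intros derr2_tendsto)
  ultimately show ?thesis using * by (intro LIMSEQ_le) auto
qed

lemma err_add:
  assumes "continuous_on {0..1} F" "continuous_on {0..1} G"
  shows "err (\<lambda>s. F s + G s) = err F + err G"
  unfolding err_def using assms
  by (simp add: distrib_left sum.distrib Henstock_Kurzweil_Integration.integral_add
      integrable_continuous_real continuous_on_mult contw)

lemma err_scale: "err (\<lambda>s. a * F s) = a * err F"
  unfolding err_def by (simp add: right_diff_distrib sum_distrib_left mult.left_commute)

end

subsection \<open>The two-point boundary value problem\<close>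

text \<open>The last property compares \<open>q\<close> with the parabola that solves the problem
  for a constant right-hand side \<open>k\<close>. With k = 0 it bounds the size of
  \<open>q\<close>; with \<open>k = w a\<close> it isolates the leading term.\<close>

lemma dirichlet_solution:
  fixes w :: "real \<Rightarrow> real"
  assumes ab: "a < b" and w: "continuous_on {a..b} w"
  obtains q q' where
    "\<And>v. v \<in> {a..b} \<Longrightarrow> (q has_real_derivative q' v) (at v within {a..b})"
    "\<And>v. v \<in> {a..b} \<Longrightarrow> (q' has_real_derivative - w v) (at v within {a..b})"
    "q a = 0" "q b = 0"
    "\<And>k e v. (\<And>v. v \<in> {a..b} \<Longrightarrow> \<bar>w v - k\<bar> \<le> e) \<Longrightarrow> v \<in> {a..b} \<Longrightarrow>
      \<bar>q v - k * ((v - a) * (b - v) / 2)\<bar> \<le> e * (b - a)\<^sup>2"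
proof -
  define P where "P v = integral {a..v} w" for v
  define Q where "Q v = integral {a..v} P" for v
  have dP: "(P has_real_derivative w v) (at v within {a..b})" if "v \<in> {a..b}" for v
    unfolding P_def using integral_has_real_derivative[OF w that] .
  have dQ: "(Q has_real_derivative P v) (at v within {a..b})" if "v \<in> {a..b}" for v
    unfolding Q_def using integral_has_real_derivative[OF DERIV_continuous_on[OF dP] that] .
  define q where "q v = (v - a) * (Q b / (b - a)) - Q v" for v
  define q' where "q' v = Q b / (b - a) - P v" for v
  have dq: "(q has_real_derivative q' v) (at v within {a..b})" if "v \<in> {a..b}" for v
    unfolding q_def q'_def using dQ[OF that] ab by (auto intro!: derivative_eq_intros)
  have ddq: "(q' has_real_derivative - w v) (at v within {a..b})" if "v \<in> {a..b}" for v
    unfolding q'_def using dP[OF that] by (auto intro!: derivative_eq_intros)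
  have q0: "q a = 0" "q b = 0" using ab by (auto simp: q_def Q_def)
  have "\<bar>q v - k * ((v - a) * (b - v) / 2)\<bar> \<le> e * (b - a)\<^sup>2"
    if we: "\<And>v. v \<in> {a..b} \<Longrightarrow> \<bar>w v - k\<bar> \<le> e" and v: "v \<in> {a..b}" for k e v
  proof -
    define r where "r v = q v - k * ((v - a) * (b - v) / 2)" for v
    define r' where "r' v = q' v - k * ((a + b - 2 * v) / 2)" for v
    have dr: "(r has_real_derivative r' v) (at v within {a..b})" if "v \<in> {a..b}" for v
      unfolding r_def r'_def using dq[OF that]
      by (auto intro!: derivative_eq_intros simp: field_simps)
    have ddr: "(r' has_real_derivative k - w v) (at v within {a..b})" if "v \<in> {a..b}" for v
      unfolding r'_def using ddq[OF that] by (auto intro!: derivative_eq_intros)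
    \<comment> \<open>The difference \<open>r\<close> vanishes at both ends, so \<open>r'\<close>
      has a zero \<open>z\<close>. Starting there, the bound \<open>e\<close> on the second
      derivative is integrated twice, at the cost of a factor \<open>b - a\<close> each
      time.\<close>
    have "\<exists>z. a < z \<and> z < b \<and> (*) (r' z) = (\<lambda>v. 0)"
    proof (rule Rolle_deriv[OF ab])
      show "r a = r b" using q0 by (simp add: r_def)
      show "continuous_on {a..b} r" using DERIV_continuous_on[OF dr] .
      fix x assume x: "a < x" "x < b"
      have "at x within {a..b} = at x" using x by (intro at_within_interior) auto
      then show "(r has_derivative (*) (r' x)) (at x)"
        using dr[of x] x by (simp add: has_field_derivative_def)
    qed
    then obtain z where z: "z \<in> {a..b}" "r' z = 0"
      by (metis atLeastAtMost_iff less_eq_real_def mult.right_neutral)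
    have e0: "0 \<le> e" using we[of a] ab by auto
    have len: "\<bar>y - z\<bar> \<le> b - a" if "y \<in> {a..b}" "z \<in> {a..b}" for y z using that by auto
    have r'b: "\<bar>r' y\<bar> \<le> e * (b - a)" if y: "y \<in> {a..b}" for y
    proof -
      have "norm (r' y - r' z) \<le> e * norm (y - z)"
        by (rule field_differentiable_bound[of "{a..b}" r' "\<lambda>v. k - w v"])
          (use ddr we y z in \<open>auto simp: abs_minus_commute\<close>)
      also have "\<dots> \<le> e * (b - a)" using len[OF y z(1)] e0 by (intro mult_left_mono) auto
      finally show ?thesis using z by simp
    qed
    have "norm (r v - r a) \<le> (e * (b - a)) * norm (v - a)"
      by (rule field_differentiable_bound[of "{a..b}" r r'])
        (use dr r'b v ab in auto)
    also have "\<dots> \<le> (e * (b - a)) * (b - a)"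
      using v ab e0 by (intro mult_left_mono) auto
    finally show ?thesis using q0 by (simp add: r_def power2_eq_square mult.assoc)
  qed
  then show ?thesis using that[of q q'] dq ddq q0 by blast
qed

lemma sum_integral_consecutive:
  fixes g :: "real \<Rightarrow> real"
  assumes "m \<le> n" and mono: "\<And>j. m \<le> j \<Longrightarrow> j < n \<Longrightarrow> x j \<le> x (Suc j)"
    and int: "g integrable_on {x m..x n}"
  shows "(\<Sum>j = m..<n. integral {x j..x (Suc j)} g) = integral {x m..x n} g"
proof -
  have le: "x i \<le> x j" if "m \<le> i" "i \<le> j" "j \<le> n" for i j
    using that(2,3)
  proof (induction j rule: dec_induct)
    case (step k) then show ?case using mono[of k] that(1) by auto
  qed simp
  have "(\<Sum>j = m..<k. integral {x j..x (Suc j)} g) = integral {x m..x k} g" if "m \<le> k" "k \<le> n" for k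
    using that
  proof (induction k rule: dec_induct)
    case (step k)
    have "integral {x m..x k} g + integral {x k..x (Suc k)} g = integral {x m..x (Suc k)} g"
      using le[of m k] le[of k "Suc k"] le[of "Suc k" n] step
      by (intro Henstock_Kurzweil_Integration.integral_combine integrable_on_subinterval[OF int]) auto
    then show ?case using step by simp
  qed simp
  then show ?thesis using assms(1) by blast
qed

text \<open>Freeze \<open>w\<close> at the left end. For the constant \<open>k = w a\<close> the
  product \<open>w * q\<close> is \<open>k\<^sup>2\<close> times a parabola with integral
  \<open>(b - a)\<^sup>3 / 12\<close>, the origin of the factor 1 / 12. Every error term carries the
  oscillation \<open>e\<close> of \<open>w\<close>.\<close>

lemma weighted_square_lower_bound:
  fixes w q al :: "real \<Rightarrow> real"
  assumes ab: "a < b" and w: "continuous_on {a..b} w" and q: "continuous_on {a..b} q"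
    and al: "continuous_on {a..b} al" "\<And>v. v \<in> {a..b} \<Longrightarrow> al0 \<le> al v \<and> al v \<le> al1" "0 \<le> al0"
    and W: "\<And>v. v \<in> {a..b} \<Longrightarrow> \<bar>w v\<bar> \<le> W"
    and e: "\<And>v. v \<in> {a..b} \<Longrightarrow> \<bar>w v - w a\<bar> \<le> e"
    and qe: "\<And>v. v \<in> {a..b} \<Longrightarrow> \<bar>q v - w a * ((v - a) * (b - v) / 2)\<bar> \<le> e * (b - a)\<^sup>2"
  shows "integral {a..b} (\<lambda>v. w v * (al v * q v)) \<ge>
    al0 / 12 * (b - a)\<^sup>2 * integral {a..b} (\<lambda>v. (w v)\<^sup>2)
      - (al0 / 6 * W * e + al1 * (2 * W * e + e\<^sup>2)) * (b - a)^3"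
proof -
  define k where "k = w a"
  \<comment> \<open>Bounds the three cross terms of \<open>(k + z) * (k * y + r)\<close>, where
    \<open>z\<close> and \<open>r\<close> are the deviations of \<open>w\<close> and
    \<open>q\<close> from their frozen versions.\<close>
  define E where "E = (2 * W * e + e\<^sup>2) * (b - a)\<^sup>2"
  have e0: "0 \<le> e" and W0: "0 \<le> W" and kW: "\<bar>k\<bar> \<le> W"
    using e[of a] W[of a] ab by (auto simp: k_def)
  have E0: "0 \<le> E" unfolding E_def using e0 W0 by simp
  have pt: "al0 * (k\<^sup>2 * ((v - a) * (b - v) / 2)) - al1 * E \<le> w v * (al v * q v)" if v: "v \<in> {a..b}" for v
  proof -
    define y where "y = (v - a) * (b - v) / 2"
    define r where "r = q v - k * y"
    define z where "z = w v - k"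
    have y0: "0 \<le> y" using v by (simp add: y_def)
    have "(v - a) * (b - v) \<le> (b - a) * (b - a)" using v ab by (intro mult_mono) auto
    then have y1: "y \<le> (b - a)\<^sup>2" using y0 by (simp add: y_def power2_eq_square)
    have r1: "\<bar>r\<bar> \<le> e * (b - a)\<^sup>2" using qe[OF v] by (simp add: r_def y_def k_def)
    have z1: "\<bar>z\<bar> \<le> e" using e[OF v] by (simp add: z_def k_def)
    have "\<bar>k * r\<bar> \<le> W * (e * (b - a)\<^sup>2)"
      unfolding abs_mult using kW r1 W0 by (intro mult_mono) auto
    moreover have "\<bar>z * (k * y)\<bar> \<le> e * (W * (b - a)\<^sup>2)"
      unfolding abs_mult using kW z1 y0 y1 W0 e0 by (intro mult_mono) auto
    moreover have "\<bar>z * r\<bar> \<le> e * (e * (b - a)\<^sup>2)"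
      unfolding abs_mult using z1 r1 e0 by (intro mult_mono) auto
    moreover have "w v * q v = k\<^sup>2 * y + k * r + z * (k * y) + z * r"
      unfolding r_def z_def by (simp add: algebra_simps power2_eq_square)
    moreover have "E = W * (e * (b - a)\<^sup>2) + e * (W * (b - a)\<^sup>2) + e * (e * (b - a)\<^sup>2)"
      unfolding E_def by (simp add: algebra_simps power2_eq_square)
    ultimately have lower: "k\<^sup>2 * y \<le> w v * q v + E" by linarith
    \<comment> \<open>The product \<open>w v * q v\<close> may be negative, so the lower bound of
      \<open>al\<close> is used on the nonnegative frozen term and the upper bound on the
      error.\<close>
    have "al0 * (k\<^sup>2 * y) \<le> al v * (k\<^sup>2 * y)" using al(2)[OF v] y0 by (intro mult_right_mono) auto
    also have "\<dots> \<le> al v * (w v * q v + E)" using lower al(2)[OF v] al(3) by (intro mult_left_mono) auto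
    also have "\<dots> \<le> al v * (w v * q v) + al1 * E"
      using al(2)[OF v] E0 by (simp add: distrib_left mult_right_mono)
    finally show ?thesis by (simp add: y_def mult.left_commute)
  qed
  have par: "((\<lambda>v. (v - a) * (b - v) / 2) has_integral (b - a)^3 / 12) {a..b}"
  proof -
    have "((\<lambda>v. (v - a) * (b - v) / 2) has_integral
       ((b - a)\<^sup>2 * (b - a) / 4 - (b - a)^3 / 6) - ((a - a)\<^sup>2 * (b - a) / 4 - (a - a)^3 / 6)) {a..b}"
    proof (rule fundamental_theorem_of_calculus[OF less_imp_le[OF ab]])
      fix v assume "v \<in> {a..b}"
      have "((\<lambda>v. (v - a)\<^sup>2 * (b - a) / 4 - (v - a)^3 / 6) has_real_derivative
        (v - a) * (b - v) / 2) (at v within {a..b})"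
        by (auto intro!: derivative_eq_intros simp: field_simps power2_eq_square)
      then show "((\<lambda>v. (v - a)\<^sup>2 * (b - a) / 4 - (v - a)^3 / 6) has_vector_derivative
        (v - a) * (b - v) / 2) (at v within {a..b})"
        by (simp add: has_real_derivative_iff_has_vector_derivative)
    qed
    moreover have "((b - a)\<^sup>2 * (b - a) / 4 - (b - a)^3 / 6) - ((a - a)\<^sup>2 * (b - a) / 4 - (a - a)^3 / 6)
      = (b - a)^3 / 12" by (simp add: power2_eq_square power3_eq_cube)
    ultimately show ?thesis by (simp only:)
  qed
  have lo: "((\<lambda>v. al0 * (k\<^sup>2 * ((v - a) * (b - v) / 2)) - al1 * E) has_integral
      al0 * (k\<^sup>2 * ((b - a)^3 / 12)) - (b - a) * (al1 * E)) {a..b}"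
    using has_integral_const_real[of "al1 * E" a b] ab
    by (intro has_integral_diff has_integral_mult_right par) simp
  have I: "al0 * (k\<^sup>2 * ((b - a)^3 / 12)) - (b - a) * (al1 * E) \<le> integral {a..b} (\<lambda>v. w v * (al v * q v))"
    by (rule has_integral_le[OF lo integrable_integral pt])
      (intro integrable_continuous_real continuous_on_mult w q al(1))
  have "integral {a..b} (\<lambda>v. (w v)\<^sup>2) \<le> integral {a..b} (\<lambda>v. k\<^sup>2 + 2 * W * e)"
  proof (rule integral_le)
    show "(\<lambda>v. (w v)\<^sup>2) integrable_on {a..b}"
      by (intro integrable_continuous_real continuous_on_power w)
    fix v assume v: "v \<in> {a..b}"
    have "(w v - k) * (w v + k) \<le> e * (2 * W)"
    proof -
      have "\<bar>(w v - k) * (w v + k)\<bar> \<le> e * (2 * W)"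
        unfolding abs_mult using e[OF v] W[OF v] kW e0 by (intro mult_mono) (auto simp: k_def)
      then show ?thesis by linarith
    qed
    then show "(w v)\<^sup>2 \<le> k\<^sup>2 + 2 * W * e" by (simp add: algebra_simps power2_eq_square)
  qed (intro integrable_continuous_real continuous_on_const)
  then have "integral {a..b} (\<lambda>v. (w v)\<^sup>2) \<le> (b - a) * (k\<^sup>2 + 2 * W * e)" using ab by simp
  then have "al0 / 12 * (b - a)\<^sup>2 * integral {a..b} (\<lambda>v. (w v)\<^sup>2)
      \<le> al0 / 12 * (b - a)\<^sup>2 * ((b - a) * (k\<^sup>2 + 2 * W * e))"
    using al(3) by (intro mult_left_mono) auto
  moreover have "al0 / 12 * (b - a)\<^sup>2 * ((b - a) * (k\<^sup>2 + 2 * W * e)) =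
      al0 * (k\<^sup>2 * ((b - a)^3 / 12)) + al0 / 6 * W * e * (b - a)^3"
    by (simp add: field_simps power2_eq_square power3_eq_cube)
  moreover have "(b - a) * (al1 * E) = al1 * (2 * W * e + e\<^sup>2) * (b - a)^3"
    by (simp add: E_def power2_eq_square power3_eq_cube)
  ultimately show ?thesis
    using I unfolding distrib_right[of "al0 / 6 * W * e" "al1 * (2 * W * e + e\<^sup>2)"] by linarith
qed


section \<open>Contribution of a single interval to the squared norm\<close>

context quadrature_functional begin

text \<open>The functional is applied, in \<open>s\<close>, to the identity of
  \<open>kernel_by_parts\<close>. The boundary terms are multiples of sections at \<open>a\<close>
  and \<open>b\<close>, which it annihilates; on the jump term only the integral acts, as no node
  lies inside; the term with the second derivative is the remainder.\<close>

lemma interval_estimate: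
  assumes A: "assumption_A R"
    and al: "continuous_on {0..1} al" "\<And>s. s \<in> {0<..<1} \<Longrightarrow> alpha R s = al s"
    and C: "\<And>v. v \<in> {0..1} \<Longrightarrow> (\<lambda>s\<in>{0..1}. R02_plus R s v) \<in> H"
      "\<And>v. v \<in> {0..1} \<Longrightarrow>
        sqrt (ip (\<lambda>s\<in>{0..1}. R02_plus R s v) (\<lambda>s\<in>{0..1}. R02_plus R s v)) \<le> B"
    and ab: "0 \<le> a" "a < b" "b \<le> 1"
    and zero: "err (\<lambda>s. R s a) = 0" "err (\<lambda>s. R s b) = 0"
    and out: "\<And>i. i < n \<Longrightarrow> t i \<notin> {a<..<b}"
    and dq: "\<And>v. v \<in> {a..b} \<Longrightarrow> (q has_real_derivative q' v) (at v within {a..b})"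
    and ddq: "\<And>v. v \<in> {a..b} \<Longrightarrow> (q' has_real_derivative - w v) (at v within {a..b})"
    and q0: "q a = 0" "q b = 0"
  shows "\<bar>err (\<lambda>s. integral {a..b} (\<lambda>v. w v * R s v)) - integral {a..b} (\<lambda>v. w v * (al v * q v))\<bar>
    \<le> B * sqrt err2 * integral {a..b} (\<lambda>v. \<bar>q v\<bar>)"
proof -
  define I where "I s = integral {a..b} (\<lambda>v. w v * R s v)" for s
  \<comment> \<open>Clamping the argument of \<open>q\<close> extends the jump term continuously by
    zero, since \<open>q\<close> vanishes at \<open>a\<close> and \<open>b\<close>.\<close>
  define E where "E s = al s * q (max a (min b s))" for s
  \<comment> \<open>This is the integral of \<open>q v * R02_plus R s v\<close> over
    \<open>v\<close>, solved from integration by parts; in this form its continuity in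
    \<open>s\<close> is visible.\<close>
  define L where "L s = E s + (q' a * R s a + ((- q' b) * R s b + (- 1) * I s))" for s
  have q: "continuous_on {a..b} q" using DERIV_continuous_on[OF dq] .
  have cI: "continuous_on {0..1} I"
    unfolding I_def using ab by (intro continuous_on_partial_integral) auto
  have "continuous_on {0..1} (\<lambda>s. q (max a (min b s)))"
    using ab by (intro continuous_on_compose2[OF q] continuous_intros) auto
  then have cE: "continuous_on {0..1} E" unfolding E_def by (intro continuous_on_mult al(1))
  have cRa: "continuous_on {0..1} (\<lambda>s. R s a)" and cRb: "continuous_on {0..1} (\<lambda>s. R s b)"
    using ab by (auto intro!: contR_fst)
  have E0: "E s = 0" if "s \<notin> {a<..<b}" for s
    using that q0 ab by (cases "s \<le> a") (auto simp: E_def max_def min_def)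
  have Eab: "E s = al s * q s" if "s \<in> {a..b}" for s using that by (auto simp: E_def)
  have "\<bar>err L\<bar> \<le> B * sqrt err2 * integral {a..b} (\<lambda>v. \<bar>q v\<bar>)"
  proof (rule err_integral_bound[where G = "\<lambda>v. \<lambda>s\<in>{0..1}. R02_plus R s v"])
    fix s :: real assume s: "s \<in> {0..1}"
    have "(if s \<in> {a<..<b} then alpha R s * q s else 0) = E s"
      using E0 Eab[of s] al(2)[of s] ab by auto
    then have 1: "((\<lambda>v. w v * R s v + q v * R02_plus R s v) has_integral
        E s + q' a * R s a - q' b * R s b) {a..b}"
      using kernel_by_parts[OF A s ab dq ddq q0] by simp
    have 2: "((\<lambda>v. w v * R s v) has_integral I s) {a..b}"
      unfolding I_def using s ab
      by (intro integrable_integral integrable_continuous_real continuous_on_mult)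
        (auto intro: continuous_on_subset[OF contw] continuous_on_subset[OF contR_snd[OF s]])
    have "((\<lambda>v. q v * R02_plus R s v) has_integral L s) {a..b}"
      using has_integral_diff[OF 1 2] by (simp add: L_def algebra_simps)
    then show "((\<lambda>v. q v * (\<lambda>s\<in>{0..1}. R02_plus R s v) s) has_integral L s) {a..b}"
      using s by simp
  next
    show "continuous_on {0..1} L" unfolding L_def
      by (intro continuous_on_add continuous_on_mult continuous_on_const cE cRa cRb cI)
  qed (use C ab q in auto)
  also have "err L = err E - err I"
  proof -
    note cs = continuous_on_add continuous_on_mult continuous_on_const cE cRa cRb cI
    have "err L = err E + (err (\<lambda>s. q' a * R s a) + (err (\<lambda>s. (- q' b) * R s b) + err (\<lambda>s. (- 1) * I s)))"
      unfolding L_def by (subst err_add, (intro cs)+)+ simp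
    then show ?thesis unfolding err_scale zero by simp
  qed
  also have "err E = integral {a..b} (\<lambda>v. w v * (al v * q v))"
  proof -
    have "integral {0..1} (\<lambda>v. w v * E v) =
        integral {0..1} (\<lambda>v. if v \<in> {a..b} then w v * (al v * q v) else 0)"
      using E0 Eab by (intro arg_cong[of _ _ "integral {0..1}"] ext) auto
    also have "\<dots> = integral ({a..b} \<inter> {0..1}) (\<lambda>v. w v * (al v * q v))"
      by (rule integral_restrict_Int)
    also have "{a..b} \<inter> {0..1} = {a..b}" using ab by auto
    finally show ?thesis using E0 out by (simp add: err_def)
  qed
  finally show ?thesis unfolding I_def by (simp add: abs_minus_commute)
qed

text \<open>Since \<open>0\<close> is not a design point, nothing vanishes at the left end of the first interval.\<close>
lemma end_interval_estimate:
  assumes ab: "0 \<le> a" "a \<le> b" "b \<le> 1" and zero: "err (\<lambda>s. R s b) = 0"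
    and th: "\<And>v. v \<in> {a..b} \<Longrightarrow> sqrt (R v v - 2 * R v b + R b b) \<le> B"
  shows "\<bar>err (\<lambda>s. integral {a..b} (\<lambda>v. w v * R s v))\<bar>
    \<le> B * sqrt err2 * integral {a..b} (\<lambda>v. \<bar>w v\<bar>)"
proof -
  define I where "I s = integral {a..b} (\<lambda>v. w v * R s v)" for s
  \<comment> \<open>Subtracting a multiple of the section at \<open>b\<close>, which
    \<open>err\<close> annihilates, turns the sections \<open>R s v\<close> into increments of norm
    at most \<open>B\<close>.\<close>
  define L where "L s = I s + (- integral {a..b} w) * R s b" for s
  have w: "continuous_on {a..b} w" using ab by (intro continuous_on_subset[OF contw]) auto
  have cI: "continuous_on {0..1} I"
    unfolding I_def using ab by (intro continuous_on_partial_integral) auto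
  have cRb: "continuous_on {0..1} (\<lambda>s. R s b)" using ab by (auto intro!: contR_fst)
  have "\<bar>err L\<bar> \<le> B * sqrt err2 * integral {a..b} (\<lambda>v. \<bar>w v\<bar>)"
  proof (rule err_integral_bound[where G = "\<lambda>v. \<lambda>s\<in>{0..1}. R s v - R s b"])
    fix s :: real assume s: "s \<in> {0..1}"
    have 2: "((\<lambda>v. w v * R s v) has_integral I s) {a..b}"
      unfolding I_def using s ab
      by (intro integrable_integral integrable_continuous_real continuous_on_mult w)
        (auto intro: continuous_on_subset[OF contR_snd[OF s]])
    have 3: "((\<lambda>v. w v * R s b) has_integral integral {a..b} w * R s b) {a..b}"
      by (intro has_integral_mult_left integrable_integral integrable_continuous_real w)
    have "((\<lambda>v. w v * (R s v - R s b)) has_integral L s) {a..b}"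
      using has_integral_diff[OF 2 3] by (simp add: L_def algebra_simps)
    then show "((\<lambda>v. w v * (\<lambda>s\<in>{0..1}. R s v - R s b) s) has_integral L s) {a..b}"
      using s by simp
  next
    fix v assume v: "v \<in> {a..b}"
    have v': "v \<in> {0..1}" "b \<in> {0..1}" using v ab by auto
    show "(\<lambda>s\<in>{0..1}. R s v - R s b) \<in> H" using rkhs_kernel_diff(1)[OF rk v'] .
    show "sqrt (ip (\<lambda>s\<in>{0..1}. R s v - R s b) (\<lambda>s\<in>{0..1}. R s v - R s b)) \<le> B"
      unfolding rkhs_kernel_diff(2)[OF rk v'] using th[OF v] .
  next
    show "continuous_on {0..1} L" unfolding L_def
      by (intro continuous_on_add continuous_on_mult continuous_on_const cRb cI)
  qed (rule w)
  also have "err L = err I"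
  proof -
    have "err L = err I + err (\<lambda>s. (- integral {a..b} w) * R s b)"
      unfolding L_def by (intro err_add continuous_on_mult continuous_on_const cRb cI)
    then show ?thesis unfolding err_scale zero by simp
  qed
  finally show ?thesis unfolding I_def .
qed

text \<open>The inner functional is an integral minus a combination of sections at the nodes, and
  the outer functional annihilates the latter.\<close>

lemma err2_eq_err_integral:
  assumes zero: "\<And>i. i < n \<Longrightarrow> err (\<lambda>s. R s (t i)) = 0"
  shows "err2 = err (\<lambda>s. integral {0..1} (\<lambda>v. w v * R s v))"
proof -
  have lin: "err (\<lambda>s. \<Sum>i<m. c i * R s (t i)) = 0" if "m \<le> n" for m
    using that
  proof (induction m)
    case 0 then show ?case by (simp add: err_def)
  next
    case (Suc m)
    have "err (\<lambda>s. (\<Sum>i<m. c i * R s (t i)) + c m * R s (t m)) =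
      err (\<lambda>s. \<Sum>i<m. c i * R s (t i)) + err (\<lambda>s. c m * R s (t m))"
      using nodes Suc.prems
      by (intro err_add continuous_on_sum continuous_on_mult continuous_on_const contR_fst) auto
    then show ?case using Suc zero[of m] by (simp add: err_scale)
  qed
  have "err2 = err (\<lambda>s. integral {0..1} (\<lambda>v. w v * R s v) + (- 1) * (\<Sum>i<n. c i * R s (t i)))"
    unfolding err2_def by (simp add: err_def[of "R _"])
  also have "\<dots> = err (\<lambda>s. integral {0..1} (\<lambda>v. w v * R s v)) + err (\<lambda>s. (- 1) * (\<Sum>i<n. c i * R s (t i)))"
    using nodes by (intro err_add continuous_on_partial_integral continuous_on_sum
      continuous_on_mult continuous_on_const contR_fst) auto
  finally show ?thesis unfolding err_scale using lin[of n] by simp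
qed

end

lemma
  fixes a b c d :: real
  assumes "c \<le> d"
  shows indicat_Icc_integrable: "indicat_real {c..d} integrable_on {a..b}"
    and integral_indicat_Icc_le: "integral {a..b} (indicat_real {c..d}) \<le> d - c"
proof -
  have eq: "indicat_real {c..d} = (\<lambda>v. if v \<in> {c..d} then 1 else 0)"
    by (auto simp: indicator_def)
  have int: "{c..d} \<inter> {a..b} = {max c a..min d b}" by auto
  show "indicat_real {c..d} integrable_on {a..b}"
    unfolding eq by (subst integrable_restrict_Int) (simp add: int integrable_continuous_real)
  show "integral {a..b} (indicat_real {c..d}) \<le> d - c"
    unfolding eq by (subst integral_restrict_Int) (use assms in \<open>auto simp: int\<close>)
qed

context quadrature_functional begin

lemma err_cong:
  assumes "\<And>s. s \<in> {0..1} \<Longrightarrow> F s = G s" shows "err F = err G"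
proof -
  have "integral {0..1} (\<lambda>s. w s * F s) = integral {0..1} (\<lambda>s. w s * G s)"
    using assms by (intro Henstock_Kurzweil_Integration.integral_cong) auto
  then show ?thesis using assms nodes unfolding err_def by simp
qed

text \<open>All errors are expressed through the length that the interval shares with a window of
  width \<open>4 * h\<close>, so that they sum to a multiple of h and not of the number of
  intervals. If \<open>w\<close> is nonzero somewhere in the interval, then, as
  \<open>b - a \<le> h\<close>, the interval lies within distance \<open>2 * h\<close> of
  \<open>x\<close> and \<xi> equals 1 on it. If \<open>w\<close> vanishes on it, so does
  \<open>q\<close>, and \<open>S\<close> is 0.\<close>

lemma interval_estimate_indicator:
  assumes A: "assumption_A R"
    and al: "continuous_on {0..1} al" "\<And>s. s \<in> {0<..<1} \<Longrightarrow> alpha R s = al s"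
      "\<And>s. s \<in> {0..1} \<Longrightarrow> al0 \<le> al s \<and> al s \<le> al1" "0 \<le> al0"
    and C: "\<And>v. v \<in> {0..1} \<Longrightarrow> (\<lambda>s\<in>{0..1}. R02_plus R s v) \<in> H"
      "\<And>v. v \<in> {0..1} \<Longrightarrow>
        sqrt (ip (\<lambda>s\<in>{0..1}. R02_plus R s v) (\<lambda>s\<in>{0..1}. R02_plus R s v)) \<le> B"
    and ab: "0 \<le> a" "a < b" "b \<le> 1"
    and zero: "err (\<lambda>s. R s a) = 0" "err (\<lambda>s. R s b) = 0"
    and out: "\<And>i. i < n \<Longrightarrow> t i \<notin> {a<..<b}"
    and W: "\<And>v. v \<in> {0..1} \<Longrightarrow> \<bar>w v\<bar> \<le> W"
    and supp: "\<And>v. v \<in> {0..1} \<Longrightarrow> w v \<noteq> 0 \<Longrightarrow> \<bar>v - x\<bar> \<le> h"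
    and lip: "\<And>u v. u \<in> {0..1} \<Longrightarrow> v \<in> {0..1} \<Longrightarrow> \<bar>w u - w v\<bar> \<le> \<Lambda> * \<bar>u - v\<bar>"
    and d: "0 \<le> dmin" "dmin \<le> b - a" "b - a \<le> dmax" "dmax \<le> h"
    and \<xi>: "\<xi> = indicat_real {x - 2 * h..x + 2 * h}"
  shows "\<exists>S. \<bar>err (\<lambda>s. integral {a..b} (\<lambda>v. w v * R s v)) - S\<bar>
        \<le> B * sqrt err2 * (W * dmax\<^sup>2) * integral {a..b} \<xi> \<and>
      S \<le> al1 * W\<^sup>2 * dmax\<^sup>2 * integral {a..b} \<xi> \<and>
      S \<ge> al0 / 12 * dmin\<^sup>2 * integral {a..b} (\<lambda>v. (w v)\<^sup>2)
        - (al0 / 6 * W * (\<Lambda> * dmax) + al1 * (2 * W * (\<Lambda> * dmax) + (\<Lambda> * dmax)\<^sup>2)) * dmax\<^sup>2 * integral {a..b} \<xi>"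
proof -
  have w: "continuous_on {a..b} w" and ala: "continuous_on {a..b} al"
    using ab by (auto intro: continuous_on_subset[OF contw] continuous_on_subset[OF al(1)])
  obtain q q' where
    dq: "\<And>v. v \<in> {a..b} \<Longrightarrow> (q has_real_derivative q' v) (at v within {a..b})" and
    ddq: "\<And>v. v \<in> {a..b} \<Longrightarrow> (q' has_real_derivative - w v) (at v within {a..b})" and
    q0: "q a = 0" "q b = 0" and
    qb: "\<And>k e v. (\<And>v. v \<in> {a..b} \<Longrightarrow> \<bar>w v - k\<bar> \<le> e) \<Longrightarrow> v \<in> {a..b} \<Longrightarrow>
      \<bar>q v - k * ((v - a) * (b - v) / 2)\<bar> \<le> e * (b - a)\<^sup>2"
    using dirichlet_solution[OF ab(2) w] by metis
  have q: "continuous_on {a..b} q" using DERIV_continuous_on[OF dq] .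
  define S where "S = integral {a..b} (\<lambda>v. w v * (al v * q v))"
  have iS: "(\<lambda>v. w v * (al v * q v)) integrable_on {a..b}"
    by (intro integrable_continuous_real continuous_on_mult w q ala)
  have iq: "(\<lambda>v. \<bar>q v\<bar>) integrable_on {a..b}"
    by (intro integrable_continuous_real continuous_on_rabs q)
  have main: "\<bar>err (\<lambda>s. integral {a..b} (\<lambda>v. w v * R s v)) - S\<bar>
    \<le> B * sqrt err2 * integral {a..b} (\<lambda>v. \<bar>q v\<bar>)"
    unfolding S_def using interval_estimate[OF A al(1,2) C ab zero out dq ddq q0] .
  have B0: "0 \<le> B"
    by (rule order_trans[OF real_sqrt_ge_zero[OF rkhs_ip_nonneg[OF rk C(1)[of 0]]] C(2)[of 0]]) auto
  have W0: "0 \<le> W" using W[of 0] by auto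
  have L0: "0 \<le> \<Lambda>" using lip[of 0 1] by auto
  have al10: "0 \<le> al1" using al(3)[of 0] al(4) by auto
  have dm: "0 < b - a" "(b - a)\<^sup>2 \<le> dmax\<^sup>2" "dmin\<^sup>2 \<le> (b - a)\<^sup>2" "0 \<le> dmax"
    using ab d by (auto intro!: power_mono)
  show ?thesis
  proof (cases "\<exists>v0\<in>{a..b}. w v0 \<noteq> 0")
    case True
    then obtain v0 where v0: "v0 \<in> {a..b}" "\<bar>v0 - x\<bar> \<le> h" using supp ab by force
    then have "\<xi> v = 1" if "v \<in> {a..b}" for v
      using that d unfolding \<xi> by (auto simp: indicator_def)
    then have "integral {a..b} \<xi> = integral {a..b} (\<lambda>v. 1)"
      by (intro Henstock_Kurzweil_Integration.integral_cong) auto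
    then have X: "integral {a..b} \<xi> = b - a" using ab by simp
    have qW: "\<bar>q v\<bar> \<le> W * dmax\<^sup>2" if v: "v \<in> {a..b}" for v
    proof -
      have "\<bar>q v\<bar> \<le> W * (b - a)\<^sup>2" using qb[of 0 W v] W v ab by auto
      also have "\<dots> \<le> W * dmax\<^sup>2" using dm W0 by (intro mult_left_mono) auto
      finally show ?thesis .
    qed
    have "integral {a..b} (\<lambda>v. \<bar>q v\<bar>) \<le> integral {a..b} (\<lambda>v. W * dmax\<^sup>2)"
      using qW by (intro integral_le iq integrable_continuous_real continuous_on_const) auto
    then have q1: "integral {a..b} (\<lambda>v. \<bar>q v\<bar>) \<le> W * dmax\<^sup>2 * (b - a)" using ab by (simp add: mult_ac)
    have 1: "\<bar>err (\<lambda>s. integral {a..b} (\<lambda>v. w v * R s v)) - S\<bar>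
        \<le> B * sqrt err2 * (W * dmax\<^sup>2) * integral {a..b} \<xi>"
      unfolding X using main mult_left_mono[OF q1, of "B * sqrt err2"] B0 err2_nonneg
      by (simp add: mult.assoc)
    have "S \<le> integral {a..b} (\<lambda>v. W * (al1 * (W * dmax\<^sup>2)))"
      unfolding S_def
    proof (intro integral_le iS)
      fix v assume v: "v \<in> {a..b}"
      then have v': "v \<in> {0..1}" using ab by auto
      have "\<bar>w v * (al v * q v)\<bar> \<le> W * (al1 * (W * dmax\<^sup>2))"
        unfolding abs_mult using W[OF v'] al(3)[OF v'] al(4) qW[OF v] W0 al10
        by (intro mult_mono) auto
      then show "w v * (al v * q v) \<le> W * (al1 * (W * dmax\<^sup>2))" by linarith
    qed (intro integrable_continuous_real continuous_on_const)
    then have 2: "S \<le> al1 * W\<^sup>2 * dmax\<^sup>2 * integral {a..b} \<xi>"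
      unfolding X using ab by (simp add: power2_eq_square algebra_simps)
    define e where "e = \<Lambda> * dmax"
    have e: "\<bar>w v - w a\<bar> \<le> e" if v: "v \<in> {a..b}" for v
    proof -
      have "\<bar>w v - w a\<bar> \<le> \<Lambda> * \<bar>v - a\<bar>" using lip[of v a] v ab by auto
      also have "\<dots> \<le> e" unfolding e_def using v d L0 by (intro mult_left_mono) auto
      finally show ?thesis .
    qed
    have e0: "0 \<le> e" unfolding e_def using L0 dm by simp
    define \<kappa> where "\<kappa> = al0 / 6 * W * e + al1 * (2 * W * e + e\<^sup>2)"
    have \<kappa>0: "0 \<le> \<kappa>" unfolding \<kappa>_def using al(4) al10 W0 e0 by simp
    have "al0 / 12 * dmin\<^sup>2 * integral {a..b} (\<lambda>v. (w v)\<^sup>2) - \<kappa> * dmax\<^sup>2 * (b - a) \<le>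
      al0 / 12 * (b - a)\<^sup>2 * integral {a..b} (\<lambda>v. (w v)\<^sup>2) - \<kappa> * (b - a)^3"
    proof (rule diff_mono)
      show "al0 / 12 * dmin\<^sup>2 * integral {a..b} (\<lambda>v. (w v)\<^sup>2)
          \<le> al0 / 12 * (b - a)\<^sup>2 * integral {a..b} (\<lambda>v. (w v)\<^sup>2)"
        using dm al(4) by (intro mult_right_mono mult_left_mono
          Henstock_Kurzweil_Integration.integral_nonneg integrable_continuous_real continuous_on_power w) auto
      have "\<kappa> * (b - a)^3 = \<kappa> * (b - a)\<^sup>2 * (b - a)" by (simp add: power2_eq_square power3_eq_cube)
      also have "\<dots> \<le> \<kappa> * dmax\<^sup>2 * (b - a)" using dm \<kappa>0 by (intro mult_right_mono mult_left_mono) auto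
      finally show "\<kappa> * (b - a)^3 \<le> \<kappa> * dmax\<^sup>2 * (b - a)" .
    qed
    also have "\<dots> \<le> S" unfolding S_def \<kappa>_def
    proof (rule weighted_square_lower_bound[OF ab(2) w q ala _ al(4)])
      fix v assume v: "v \<in> {a..b}"
      then have v': "v \<in> {0..1}" using ab by auto
      show "al0 \<le> al v \<and> al v \<le> al1" "\<bar>w v\<bar> \<le> W" using al(3)[OF v'] W[OF v'] by auto
      show "\<bar>w v - w a\<bar> \<le> e" using e[OF v] .
      show "\<bar>q v - w a * ((v - a) * (b - v) / 2)\<bar> \<le> e * (b - a)\<^sup>2" using qb[OF e v] .
    qed
    finally have 3: "al0 / 12 * dmin\<^sup>2 * integral {a..b} (\<lambda>v. (w v)\<^sup>2) - \<kappa> * dmax\<^sup>2 * (b - a) \<le> S" .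
    show ?thesis using 1 2 3 unfolding X \<kappa>_def e_def by blast
  next
    case False
    then have w0: "w v = 0" if "v \<in> {a..b}" for v using that by blast
    then have "\<bar>q v\<bar> = 0" if "v \<in> {a..b}" for v using qb[of 0 0 v] that by simp
    then have "integral {a..b} (\<lambda>v. \<bar>q v\<bar>) = integral {a..b} (\<lambda>v. 0)"
      by (intro Henstock_Kurzweil_Integration.integral_cong) auto
    then have q1: "integral {a..b} (\<lambda>v. \<bar>q v\<bar>) = 0" by simp
    have "S = integral {a..b} (\<lambda>v. 0)" unfolding S_def
      using w0 by (intro Henstock_Kurzweil_Integration.integral_cong) auto
    then have S0: "S = 0" by simp
    have "integral {a..b} (\<lambda>v. (w v)\<^sup>2) = integral {a..b} (\<lambda>v. 0)"
      using w0 by (intro Henstock_Kurzweil_Integration.integral_cong) auto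
    then have w2: "integral {a..b} (\<lambda>v. (w v)\<^sup>2) = 0" by simp
    have X: "0 \<le> integral {a..b} \<xi>"
      unfolding \<xi> using d dm
      by (intro Henstock_Kurzweil_Integration.integral_nonneg indicat_Icc_integrable) auto
    have e0: "0 \<le> \<Lambda> * dmax" using L0 dm by simp
    show ?thesis
      using main X B0 W0 al10 e0 al(4) err2_nonneg unfolding q1 S0 w2
      by (intro exI[of _ 0]) auto
  qed
qed

text \<open>The unit interval is cut at the nodes. As \<open>t m = 1\<close>, the only piece without
  a node at both ends is the one before \<open>t 0\<close>, which goes to
  \<open>end_interval_estimate\<close>; the other pieces add up, with total window length at most
  \<open>4 * h\<close>.\<close>

lemma err2_estimate:
  assumes A: "assumption_A R"
    and al: "continuous_on {0..1} al" "\<And>s. s \<in> {0<..<1} \<Longrightarrow> alpha R s = al s"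
      "\<And>s. s \<in> {0..1} \<Longrightarrow> al0 \<le> al s \<and> al s \<le> al1" "0 \<le> al0"
    and C: "\<And>v. v \<in> {0..1} \<Longrightarrow> (\<lambda>s\<in>{0..1}. R02_plus R s v) \<in> H"
      "\<And>v. v \<in> {0..1} \<Longrightarrow>
        sqrt (ip (\<lambda>s\<in>{0..1}. R02_plus R s v) (\<lambda>s\<in>{0..1}. R02_plus R s v)) \<le> B"
    and grid: "n = Suc m" "t m = 1" "\<And>j. j < m \<Longrightarrow> t j < t (Suc j)"
    and zero: "\<And>i. i < n \<Longrightarrow> err (\<lambda>s. R s (t i)) = 0"
    and W: "\<And>v. v \<in> {0..1} \<Longrightarrow> \<bar>w v\<bar> \<le> W"
    and supp: "\<And>v. v \<in> {0..1} \<Longrightarrow> w v \<noteq> 0 \<Longrightarrow> \<bar>v - x\<bar> \<le> h"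
    and lip: "\<And>u v. u \<in> {0..1} \<Longrightarrow> v \<in> {0..1} \<Longrightarrow> \<bar>w u - w v\<bar> \<le> \<Lambda> * \<bar>u - v\<bar>"
    and d: "0 \<le> dmin" "0 \<le> dmax" "dmax \<le> h"
      "\<And>j. j < m \<Longrightarrow> dmin \<le> t (Suc j) - t j \<and> t (Suc j) - t j \<le> dmax"
    and \<theta>: "\<And>v. v \<in> {0..t 0} \<Longrightarrow> sqrt (R v v - 2 * R v (t 0) + R (t 0) (t 0)) \<le> \<theta>"
  shows "\<exists>S. \<bar>err2 - S\<bar> \<le> sqrt err2 *
        (B * (W * dmax\<^sup>2) * (4 * h) + \<theta> * integral {0..t 0} (\<lambda>v. \<bar>w v\<bar>)) \<and>
      S \<le> al1 * W\<^sup>2 * dmax\<^sup>2 * (4 * h) \<and>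
      S \<ge> al0 / 12 * dmin\<^sup>2 * integral {t 0..1} (\<lambda>v. (w v)\<^sup>2)
        - (al0 / 6 * W * (\<Lambda> * dmax) + al1 * (2 * W * (\<Lambda> * dmax) + (\<Lambda> * dmax)\<^sup>2)) * dmax\<^sup>2 * (4 * h)"
proof -
  define \<xi> where "\<xi> = indicat_real {x - 2 * h..x + 2 * h}"
  define \<kappa> where "\<kappa> = al0 / 6 * W * (\<Lambda> * dmax) + al1 * (2 * W * (\<Lambda> * dmax) + (\<Lambda> * dmax)\<^sup>2)"
  \<comment> \<open>The share of an interval in \<open>err2\<close>: additive under concatenation,
    and equal to \<open>err2\<close> for the whole unit interval.\<close>
  define J where "J a b = err (\<lambda>s. integral {a..b} (\<lambda>v. w v * R s v))" for a b
  have mono: "t i \<le> t j" if "i \<le> j" "j \<le> m" for i j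
    using that
  proof (induction j rule: dec_induct)
    case (step k) then show ?case using grid(3)[of k] by auto
  qed simp
  have h0: "0 \<le> h" using d by simp
  have B0: "0 \<le> B"
    by (rule order_trans[OF real_sqrt_ge_zero[OF rkhs_ip_nonneg[OF rk C(1)[of 0]]] C(2)[of 0]]) auto
  have W0: "0 \<le> W" using W[of 0] by auto
  have L0: "0 \<le> \<Lambda>" using lip[of 0 1] by auto
  have al10: "0 \<le> al1" using al(3)[of 0] al(4) by auto
  have \<kappa>0: "0 \<le> \<kappa>" unfolding \<kappa>_def using al(4) al10 W0 L0 d(2) by simp
  have "\<exists>S. \<bar>J (t j) (t (Suc j)) - S\<bar> \<le> B * sqrt err2 * (W * dmax\<^sup>2) * integral {t j..t (Suc j)} \<xi> \<and>
      S \<le> al1 * W\<^sup>2 * dmax\<^sup>2 * integral {t j..t (Suc j)} \<xi> \<and>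
      S \<ge> al0 / 12 * dmin\<^sup>2 * integral {t j..t (Suc j)} (\<lambda>v. (w v)\<^sup>2)
        - \<kappa> * dmax\<^sup>2 * integral {t j..t (Suc j)} \<xi>" if j: "j < m" for j
    unfolding J_def \<kappa>_def
  proof (rule interval_estimate_indicator[OF A al C _ _ _ _ _ _ W supp lip _ _ _ _ \<xi>_def])
    show "0 \<le> t j" "t (Suc j) \<le> 1" using nodes[of j] nodes[of "Suc j"] j grid(1) by auto
    show "t j < t (Suc j)" using grid(3) j .
    show "err (\<lambda>s. R s (t j)) = 0" "err (\<lambda>s. R s (t (Suc j))) = 0" using zero j grid(1) by auto
    fix i assume "i < n"
    then show "t i \<notin> {t j<..<t (Suc j)}"
      using mono[of i j] mono[of "Suc j" i] j grid(1) by (cases "i \<le> j") auto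
  qed (use d j in auto)
  then obtain S where
    S1: "\<And>j. j < m \<Longrightarrow> \<bar>J (t j) (t (Suc j)) - S j\<bar> \<le> B * sqrt err2 * (W * dmax\<^sup>2) * integral {t j..t (Suc j)} \<xi>" and
    S2: "\<And>j. j < m \<Longrightarrow> S j \<le> al1 * W\<^sup>2 * dmax\<^sup>2 * integral {t j..t (Suc j)} \<xi>" and
    S3: "\<And>j. j < m \<Longrightarrow> S j \<ge> al0 / 12 * dmin\<^sup>2 * integral {t j..t (Suc j)} (\<lambda>v. (w v)\<^sup>2)
        - \<kappa> * dmax\<^sup>2 * integral {t j..t (Suc j)} \<xi>" by metis
  have t0: "0 \<le> t 0" "t 0 \<le> 1" using nodes[of 0] grid(1) by auto
  have i\<xi>: "\<xi> integrable_on {a..b}" for a b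
    unfolding \<xi>_def using h0 by (intro indicat_Icc_integrable) auto
  have sum\<xi>: "(\<Sum>j<m. integral {t j..t (Suc j)} \<xi>) \<le> 4 * h"
  proof -
    have "(\<Sum>j<m. integral {t j..t (Suc j)} \<xi>) = integral {t 0..t m} \<xi>"
      using sum_integral_consecutive[of 0 m t \<xi>] i\<xi> mono by (simp add: lessThan_atLeast0)
    also have "\<dots> \<le> (x + 2 * h) - (x - 2 * h)"
      unfolding \<xi>_def using h0 by (intro integral_indicat_Icc_le) auto
    finally show ?thesis by simp
  qed
  have sumw: "(\<Sum>j<m. integral {t j..t (Suc j)} (\<lambda>v. (w v)\<^sup>2)) = integral {t 0..1} (\<lambda>v. (w v)\<^sup>2)"
  proof -
    have "(\<lambda>v. (w v)\<^sup>2) integrable_on {t 0..t m}"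
      using t0 grid(2) by (intro integrable_continuous_real continuous_on_power
        continuous_on_subset[OF contw]) auto
    then show ?thesis
      using sum_integral_consecutive[of 0 m t "\<lambda>v. (w v)\<^sup>2"] mono grid(2)
      by (simp add: lessThan_atLeast0)
  qed
  have J_add: "J a b + J b c = J a c" if "0 \<le> a" "a \<le> b" "b \<le> c" "c \<le> 1" for a b c
  proof -
    have "J a b + J b c = err (\<lambda>s. integral {a..b} (\<lambda>v. w v * R s v) + integral {b..c} (\<lambda>v. w v * R s v))"
      unfolding J_def using that by (intro err_add[symmetric] continuous_on_partial_integral) auto
    also have "\<dots> = J a c"
    proof -
      have *: "integral {a..b} (\<lambda>v. w v * R s v) + integral {b..c} (\<lambda>v. w v * R s v) =
          integral {a..c} (\<lambda>v. w v * R s v)" if "s \<in> {0..1}" for s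
        using \<open>0 \<le> a\<close> \<open>a \<le> b\<close> \<open>b \<le> c\<close> \<open>c \<le> 1\<close>
        by (intro Henstock_Kurzweil_Integration.integral_combine integrable_continuous_real
          continuous_on_mult continuous_on_subset[OF contw] continuous_on_subset[OF contR_snd[OF that]]) auto
      show ?thesis
        unfolding J_def by (rule err_cong) (rule *)
    qed
    finally show ?thesis .
  qed
  have "(\<Sum>j<k. J (t j) (t (Suc j))) = J (t 0) (t k)" if "k \<le> m" for k
    using that
  proof (induction k)
    case 0
    then show ?case by (simp add: J_def err_def)
  next
    case (Suc k)
    then show ?case
      using J_add[of "t 0" "t k" "t (Suc k)"] mono[of 0 k] mono[of k "Suc k"] mono[of "Suc k" m] t0 grid(2)
      by simp
  qed
  from this[of m] have "err2 = J 0 (t 0) + (\<Sum>j<m. J (t j) (t (Suc j)))"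
    using J_add[of 0 "t 0" 1] t0 grid(2) err2_eq_err_integral[OF zero] by (simp add: J_def)
  then have "\<bar>err2 - (\<Sum>j<m. S j)\<bar> \<le> \<bar>J 0 (t 0)\<bar> + \<bar>\<Sum>j<m. J (t j) (t (Suc j)) - S j\<bar>"
    by (simp add: sum_subtractf)
  also have "\<bar>\<Sum>j<m. J (t j) (t (Suc j)) - S j\<bar> \<le> (\<Sum>j<m. B * sqrt err2 * (W * dmax\<^sup>2) * integral {t j..t (Suc j)} \<xi>)"
    using S1 by (intro order_trans[OF sum_abs] sum_mono) auto
  also have "\<dots> = B * sqrt err2 * (W * dmax\<^sup>2) * (\<Sum>j<m. integral {t j..t (Suc j)} \<xi>)"
    by (simp add: sum_distrib_left)
  also have "\<dots> \<le> B * sqrt err2 * (W * dmax\<^sup>2) * (4 * h)"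
    using B0 W0 err2_nonneg by (intro mult_left_mono sum\<xi>) auto
  also have "\<bar>J 0 (t 0)\<bar> \<le> \<theta> * sqrt err2 * integral {0..t 0} (\<lambda>v. \<bar>w v\<bar>)"
    unfolding J_def using t0 zero[of 0] grid(1) \<theta> by (intro end_interval_estimate) auto
  finally have 1: "\<bar>err2 - (\<Sum>j<m. S j)\<bar> \<le> sqrt err2 *
        (B * (W * dmax\<^sup>2) * (4 * h) + \<theta> * integral {0..t 0} (\<lambda>v. \<bar>w v\<bar>))"
    by (simp add: algebra_simps)
  have "(\<Sum>j<m. S j) \<le> al1 * W\<^sup>2 * dmax\<^sup>2 * (\<Sum>j<m. integral {t j..t (Suc j)} \<xi>)"
    unfolding sum_distrib_left using S2 by (intro sum_mono) auto
  also have "\<dots> \<le> al1 * W\<^sup>2 * dmax\<^sup>2 * (4 * h)" using al10 by (intro mult_left_mono sum\<xi>) auto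
  finally have 2: "(\<Sum>j<m. S j) \<le> al1 * W\<^sup>2 * dmax\<^sup>2 * (4 * h)" .
  have "al0 / 12 * dmin\<^sup>2 * integral {t 0..1} (\<lambda>v. (w v)\<^sup>2) - \<kappa> * dmax\<^sup>2 * (4 * h) \<le>
    al0 / 12 * dmin\<^sup>2 * integral {t 0..1} (\<lambda>v. (w v)\<^sup>2) - \<kappa> * dmax\<^sup>2 * (\<Sum>j<m. integral {t j..t (Suc j)} \<xi>)"
    using \<kappa>0 by (intro diff_left_mono mult_left_mono sum\<xi>) auto
  also have "\<dots> = (\<Sum>j<m. al0 / 12 * dmin\<^sup>2 * integral {t j..t (Suc j)} (\<lambda>v. (w v)\<^sup>2)
        - \<kappa> * dmax\<^sup>2 * integral {t j..t (Suc j)} \<xi>)"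
    unfolding sumw[symmetric] by (simp add: sum_subtractf sum_distrib_left)
  also have "\<dots> \<le> (\<Sum>j<m. S j)" using S3 by (intro sum_mono) auto
  finally have 3: "(\<Sum>j<m. S j) \<ge> al0 / 12 * dmin\<^sup>2 * integral {t 0..1} (\<lambda>v. (w v)\<^sup>2)
    - \<kappa> * dmax\<^sup>2 * (4 * h)" .
  show ?thesis using 1 2 3 unfolding \<kappa>_def by blast
qed

end

subsection \<open>The smoothing kernel and the design\<close>

text \<open>The derivative is continuous, and it vanishes outside [-1, 1] because \<open>K\<close>
  is zero on that open set. Being bounded, it supplies a global Lipschitz constant.\<close>

lemma smoothing_kernel_bounds:
  assumes K: "smoothing_kernel K"
  obtains Kb Kd where "0 < Kb" "\<And>u. \<bar>K u\<bar> \<le> Kb" "0 \<le> Kd" "\<And>u v. \<bar>K u - K v\<bar> \<le> Kd * \<bar>u - v\<bar>"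
    "\<And>u. K u \<noteq> 0 \<Longrightarrow> \<bar>u\<bar> \<le> 1" "continuous_on UNIV K"
proof -
  obtain D where D: "\<And>u. (K has_vector_derivative D u) (at u)" "continuous_on UNIV D"
    using K unfolding smoothing_kernel_def C1_differentiable_on_def by auto
  have dK: "(K has_real_derivative D u) (at u)" for u
    using D(1) by (simp add: has_real_derivative_iff_has_vector_derivative)
  have cK: "continuous_on UNIV K" using DERIV_continuous_on[of UNIV K D] dK by simp
  have K0: "\<bar>u\<bar> \<le> 1" if "K u \<noteq> 0" for u
  proof -
    have "u \<in> closure {t. K t \<noteq> 0}" using that closure_subset[of "{t. K t \<noteq> 0}"] by auto
    moreover have "closure {t. K t \<noteq> 0} = {-1..1}" using K by (simp add: smoothing_kernel_def)
    ultimately show ?thesis by auto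
  qed
  have D0: "D u = 0" if "\<bar>u\<bar> > 1" for u
  proof -
    have z: "0 = K v" if "v \<in> {u. 1 < \<bar>u\<bar>}" for v using K0[of v] that by auto
    have eq: "{u::real. 1 < \<bar>u\<bar>} = {..<-1} \<union> {1<..}" by auto
    have op: "open {u::real. 1 < \<bar>u\<bar>}" unfolding eq by (intro open_Un open_lessThan open_greaterThan)
    have "(K has_real_derivative 0) (at u)"
      by (rule has_field_derivative_transform_within_open[OF DERIV_const op _ z]) (use that in auto)
    then show ?thesis using dK DERIV_unique by blast
  qed
  have bd: "\<exists>b\<ge>0. \<forall>u. \<bar>G u\<bar> \<le> b" if "continuous_on UNIV G" "\<And>u. \<bar>u\<bar> > 1 \<Longrightarrow> G u = 0" for G :: "real \<Rightarrow> real"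
  proof -
    have "compact (G ` {-1..1})" using that by (intro compact_continuous_image) (auto intro: continuous_on_subset)
    then obtain b where "\<forall>y\<in>G ` {-1..1}. norm y \<le> b" using compact_imp_bounded bounded_iff by blast
    then have b: "\<bar>G u\<bar> \<le> b" if "u \<in> {-1..1}" for u using that by auto
    have "\<bar>G u\<bar> \<le> b" for u
    proof (cases "\<bar>u\<bar> > 1")
      case True then show ?thesis using that(2) b[of 0] by auto
    next
      case False
      then have "-1 \<le> u" "u \<le> 1" by linarith+
      then show ?thesis using b[of u] by auto
    qed
    moreover have "0 \<le> b" using b[of 0] abs_ge_zero[of "G 0"] by (simp del: abs_ge_zero)
    ultimately show ?thesis by blast
  qed
  have Kz: "K v = 0" if "\<bar>v\<bar> > 1" for v using K0[of v] that by auto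
  obtain Kb where Kb: "0 \<le> Kb" "\<And>u. \<bar>K u\<bar> \<le> Kb" using bd[OF cK Kz] by blast
  obtain Kd where Kd: "0 \<le> Kd" "\<And>u. \<bar>D u\<bar> \<le> Kd" using bd[OF D(2) D0] by blast
  have "\<bar>K u - K v\<bar> \<le> Kd * \<bar>u - v\<bar>" for u v
    using field_differentiable_bound[of UNIV K D Kd u v] dK Kd by simp
  moreover have "\<bar>K u\<bar> \<le> Kb + 1" for u using Kb(2)[of u] by linarith
  \<comment> \<open>The added 1 makes the bound strictly positive, so that one may divide by it
    later.\<close>
  ultimately show ?thesis using that[of "Kb + 1" Kd] Kb(1) Kd(1) K0 cK by auto
qed

text \<open>If \<open>K\<close> were zero on a subinterval, its interior would miss the closure of
  the nonzero set, which is all of [-1, 1].\<close>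

lemma smoothing_kernel_square_pos:
  assumes K: "smoothing_kernel K" and ab: "a < b" "{a..b} \<subseteq> {-1..1}"
  shows "0 < integral {a..b} (\<lambda>u. (K u)\<^sup>2)"
proof -
  have cK: "continuous_on UNIV K" using smoothing_kernel_bounds[OF K] by blast
  then have c: "continuous_on {a..b} (\<lambda>u. (K u)\<^sup>2)"
    by (intro continuous_on_power) (auto intro: continuous_on_subset)
  have "0 \<le> integral {a..b} (\<lambda>u. (K u)\<^sup>2)"
    by (intro Henstock_Kurzweil_Integration.integral_nonneg integrable_continuous_real c) auto
  moreover have "integral {a..b} (\<lambda>u. (K u)\<^sup>2) \<noteq> 0"
  proof
    assume "integral {a..b} (\<lambda>u. (K u)\<^sup>2) = 0"
    then have "\<forall>u\<in>{a..b}. (K u)\<^sup>2 = 0" using ab(1) by (subst (asm) integral_eq_0_iff[OF c]) auto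
    then have "{a<..<b} \<inter> {u. K u \<noteq> 0} = {}" by auto
    then have "{a<..<b} \<inter> closure {u. K u \<noteq> 0} = {}"
      using open_Int_closure_eq_empty[of "{a<..<b}"] by auto
    moreover have "(a + b) / 2 \<in> {a<..<b}" "(a + b) / 2 \<in> {a..b}" using ab by auto
    ultimately show False using ab K unfolding smoothing_kernel_def by blast
  qed
  ultimately show ?thesis by simp
qed

text \<open>The constants come before \<open>x\<close> and \<open>h\<close>, because the final
  bounds must not depend on \<open>x\<close>. For the square integral, the window may stick out of
  the unit interval, but as h < 1 one of the half windows [x - h/2, x] and [x, x + h/2] lies
  inside.\<close>

lemma
  assumes K: "smoothing_kernel K"
  shows phi_bounds: "\<exists>Kb>0. \<exists>Kd\<ge>0. \<forall>x h. 0 < h \<longrightarrow>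
     (\<forall>s. \<bar>phi K x h s\<bar> \<le> Kb / h) \<and>
     (\<forall>s s'. \<bar>phi K x h s - phi K x h s'\<bar> \<le> Kd / h\<^sup>2 * \<bar>s - s'\<bar>) \<and>
     (\<forall>s. phi K x h s \<noteq> 0 \<longrightarrow> \<bar>s - x\<bar> \<le> h) \<and> continuous_on {0..1} (phi K x h)"
    and phi_square_lower: "\<exists>cK>0. \<forall>x h. 0 < x \<longrightarrow> x < 1 \<longrightarrow> 0 < h \<longrightarrow> h < 1 \<longrightarrow>
     cK / h \<le> integral {0..1} (\<lambda>s. (phi K x h s)\<^sup>2)"
proof -
  obtain Kb Kd where b: "0 < Kb" "\<And>u. \<bar>K u\<bar> \<le> Kb" "0 \<le> Kd" "\<And>u v. \<bar>K u - K v\<bar> \<le> Kd * \<bar>u - v\<bar>"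
    "\<And>u. K u \<noteq> 0 \<Longrightarrow> \<bar>u\<bar> \<le> 1" and cK: "continuous_on UNIV K"
    using smoothing_kernel_bounds[OF K] by blast
  have cphi: "continuous_on S (phi K x h)" if "0 < h" for x h S
    unfolding phi_def by (intro continuous_intros continuous_on_compose2[OF cK]) (use that in auto)
  have "\<bar>phi K x h s\<bar> \<le> Kb / h" if "0 < h" for x h s
    unfolding phi_def using b(2)[of "(x - s) / h"] that by (simp add: abs_mult field_simps)
  moreover have "\<bar>phi K x h s - phi K x h s'\<bar> \<le> Kd / h\<^sup>2 * \<bar>s - s'\<bar>" if h: "0 < h" for x h s s'
  proof -
    have "\<bar>phi K x h s - phi K x h s'\<bar> = (1 / h) * \<bar>K ((x - s) / h) - K ((x - s') / h)\<bar>"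
      unfolding phi_def right_diff_distrib[symmetric] abs_mult using h by simp
    also have "\<dots> \<le> (1 / h) * (Kd * \<bar>(x - s) / h - (x - s') / h\<bar>)"
      using h by (intro mult_left_mono b(4)) auto
    also have "\<bar>(x - s) / h - (x - s') / h\<bar> = \<bar>s - s'\<bar> / h"
      using h by (simp add: diff_divide_distrib[symmetric] abs_minus_commute)
    finally show ?thesis using h by (simp add: power2_eq_square)
  qed
  moreover have "\<bar>s - x\<bar> \<le> h" if h: "0 < h" "phi K x h s \<noteq> 0" for x h s
    using b(5)[of "(x - s) / h"] h by (simp add: phi_def abs_minus_commute)
  ultimately show "\<exists>Kb>0. \<exists>Kd\<ge>0. \<forall>x h. 0 < h \<longrightarrow>
     (\<forall>s. \<bar>phi K x h s\<bar> \<le> Kb / h) \<and>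
     (\<forall>s s'. \<bar>phi K x h s - phi K x h s'\<bar> \<le> Kd / h\<^sup>2 * \<bar>s - s'\<bar>) \<and>
     (\<forall>s. phi K x h s \<noteq> 0 \<longrightarrow> \<bar>s - x\<bar> \<le> h) \<and> continuous_on {0..1} (phi K x h)"
    using b(1,3) cphi by (intro exI[of _ Kb] exI[of _ Kd] conjI) auto
  \<comment> \<open>The substitution u = (x - s) / h reverses orientation: [0, 1/2] belongs to the
    half window left of \<open>x\<close>, [-1/2, 0] to the one on the right.\<close>
  define cK where "cK = min (integral {0..1/2} (\<lambda>u. (K u)\<^sup>2)) (integral {-1/2..0} (\<lambda>u. (K u)\<^sup>2))"
  have "0 < cK" unfolding cK_def min_less_iff_conj
    by (intro conjI smoothing_kernel_square_pos[OF K]) auto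
  moreover have "cK / h \<le> integral {0..1} (\<lambda>s. (phi K x h s)\<^sup>2)"
    if xh: "0 < x" "x < 1" "0 < h" "h < 1" for x h
  proof -
    have i: "(\<lambda>s. (phi K x h s)\<^sup>2) integrable_on {p..r}" for p r
      using xh by (intro integrable_continuous_real continuous_on_power cphi)
    have sub: "integral {x - h * r..x - h * p} (\<lambda>s. (phi K x h s)\<^sup>2) = integral {p..r} (\<lambda>u. (K u)\<^sup>2) / h"
      if pr: "p \<le> r" for p r
    proof -
      have "(\<lambda>u. (K u)\<^sup>2) integrable_on {p..r}"
        by (intro integrable_continuous_real continuous_on_power continuous_on_subset[OF cK]) auto
      then have "((\<lambda>u. (K u)\<^sup>2) has_integral integral {p..r} (\<lambda>u. (K u)\<^sup>2)) (cbox p r)"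
        unfolding cbox_interval by (rule integrable_integral)
      from has_integral_affinity[OF this, of "- 1 / h" "x / h"]
      have 1: "((\<lambda>s. (K ((- 1 / h) * s + x / h))\<^sup>2) has_integral h * integral {p..r} (\<lambda>u. (K u)\<^sup>2))
        ((\<lambda>s. (- h) * s + x) ` {p..r})"
        using xh by simp
      have 2: "(\<lambda>s. (- h) * s + x) ` {p..r} = {x - h * r..x - h * p}"
        using xh pr image_affinity_atLeastAtMost[of "- h" x p r] by (auto simp: algebra_simps)
      have "(\<lambda>s. (1 / h)\<^sup>2 * (K ((- 1 / h) * s + x / h))\<^sup>2) = (\<lambda>s. (phi K x h s)\<^sup>2)"
        unfolding phi_def by (simp add: power_mult_distrib power_divide diff_divide_distrib)
      then have "((\<lambda>s. (phi K x h s)\<^sup>2) has_integral (1 / h)\<^sup>2 * (h * integral {p..r} (\<lambda>u. (K u)\<^sup>2)))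
         {x - h * r..x - h * p}"
        using has_integral_mult_right[OF 1[unfolded 2], of "(1 / h)\<^sup>2"] by simp
      then show ?thesis using xh by (simp add: integral_unique power2_eq_square)
    qed
    have le: "integral {x - h * r..x - h * p} (\<lambda>s. (phi K x h s)\<^sup>2) \<le> integral {0..1} (\<lambda>s. (phi K x h s)\<^sup>2)"
      if "{x - h * r..x - h * p} \<subseteq> {0..1}" for p r
      using that by (intro integral_subset_le i) auto
    show ?thesis
    proof (cases "x \<ge> 1 / 2")
      case True
      then have in01: "{x - h * (1/2)..x - h * 0} \<subseteq> {0..1}" using xh by auto
      have "cK / h \<le> integral {0..1/2} (\<lambda>u. (K u)\<^sup>2) / h"
        using xh by (intro divide_right_mono) (auto simp: cK_def)
      also have "\<dots> = integral {x - h * (1/2)..x - h * 0} (\<lambda>s. (phi K x h s)\<^sup>2)"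
        by (rule sub[symmetric]) simp
      finally show ?thesis using le[OF in01] by linarith
    next
      case False
      then have in01: "{x - h * 0..x - h * (- 1/2)} \<subseteq> {0..1}" using xh by auto
      have "cK / h \<le> integral {-1/2..0} (\<lambda>u. (K u)\<^sup>2) / h"
        using xh by (intro divide_right_mono) (auto simp: cK_def)
      also have "\<dots> = integral {x - h * 0..x - h * (- 1/2)} (\<lambda>s. (phi K x h s)\<^sup>2)"
        by (rule sub[symmetric]) simp
      finally show ?thesis using le[OF in01] by linarith
    qed
  qed
  ultimately show "\<exists>cK>0. \<forall>x h. 0 < x \<longrightarrow> x < 1 \<longrightarrow> 0 < h \<longrightarrow> h < 1 \<longrightarrow>
     cK / h \<le> integral {0..1} (\<lambda>s. (phi K x h s)\<^sup>2)" by blast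
qed

text \<open>Applied both to the design density and to the jump function. A real number strictly
  below the infimum bounds \<open>u\<close> on the open interval, and continuity carries the bound
  to the closure.\<close>

lemma continuous_bounds_of_INF_pos:
  fixes u :: "real \<Rightarrow> real"
  assumes c: "continuous_on {0..1} u" and inf: "(INF t\<in>{0<..<1}. ereal (u t)) > 0"
  obtains u0 u1 where "0 < u0" "\<And>t. t \<in> {0..1} \<Longrightarrow> u0 \<le> u t \<and> u t \<le> u1"
proof -
  obtain z where z: "0 < z" "z < (INF t\<in>{0<..<1}. ereal (u t))" using dense[OF inf] by blast
  then obtain u0 where u0: "0 < u0" "ereal u0 < (INF t\<in>{0<..<1}. ereal (u t))"
    by (cases z) auto
  have lo: "u0 \<le> u t" if "t \<in> {0<..<1}" for t
    using less_le_trans[OF u0(2) INF_lower[OF that]] by simp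
  have cl: "closure {0<..<1::real} = {0..1}" by simp
  have lo: "u0 \<le> u t" if "t \<in> {0..1}" for t
    using continuous_ge_on_closure[of "{0<..<1}" u t u0] c lo that by (simp only: cl)
  have "compact (u ` {0..1})" using c by (intro compact_continuous_image) auto
  then obtain u1 where "\<forall>y\<in>u ` {0..1}. norm y \<le> u1" using compact_imp_bounded bounded_iff by blast
  then have u1: "\<bar>u t\<bar> \<le> u1" if "t \<in> {0..1}" for t using that by auto
  have "u t \<le> u1" if "t \<in> {0..1}" for t using u1[OF that] by linarith
  then show ?thesis using that[OF u0(1)] lo by blast
qed

section \<open>Regular designs and their gaps\<close>

lemma design_density_bounds:
  assumes f: "design_density f"
  obtains f0 f1 where "0 < f0" "continuous_on {0..1} f"
    "\<And>t. t \<in> {0..1} \<Longrightarrow> f0 \<le> f t \<and> f t \<le> f1"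
proof -
  obtain f' where "\<And>t. t \<in> {0..1} \<Longrightarrow> (f has_real_derivative f' t) (at t within {0..1})"
    using f unfolding design_density_def C2_on_def by blast
  then have c: "continuous_on {0..1} f" by (rule DERIV_continuous_on)
  show ?thesis
    using continuous_bounds_of_INF_pos[OF c] f that[OF _ c] unfolding design_density_def by blast
qed

text \<open>The distribution function has slopes between \<open>f0\<close> and \<open>f1\<close>,
  and it increases by 1 / n from one point to the next. As it is 0 at 0, this includes the gap
  before the first design point; the gap with index n, from 1 to 1, is empty and must be left
  out.\<close>

lemma design_points:
  assumes f: "design_density f"
    and b: "0 < f0" "continuous_on {0..1} f" "\<And>t. t \<in> {0..1} \<Longrightarrow> f0 \<le> f t \<and> f t \<le> f1" and n: "0 < n"
  shows "i \<le> n \<Longrightarrow> design_pt f n i \<in> {0..1}" "design_pt f n n = 1"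
    "i < n \<Longrightarrow> 1 / (f1 * real n) \<le> gap f n i \<and> gap f n i \<le> 1 / (f0 * real n)"
proof -
  define F where "F = distribution_fun f"
  have int: "f integrable_on {a..c}" if "0 \<le> a" "c \<le> 1" for a c
    using that by (intro integrable_continuous_real continuous_on_subset[OF b(2)]) auto
  have Fdiff: "f0 * (v - u) \<le> F v - F u \<and> F v - F u \<le> f1 * (v - u)" if uv: "0 \<le> u" "u \<le> v" "v \<le> 1" for u v
  proof -
    have "integral {0..u} f + integral {u..v} f = integral {0..v} f"
      using uv by (intro Henstock_Kurzweil_Integration.integral_combine int) auto
    then have "F v - F u = integral {u..v} f" by (simp add: F_def distribution_fun_def)
    moreover have "integral {u..v} (\<lambda>_. f0) \<le> integral {u..v} f"
      using uv b(3) by (intro integral_le int integrable_continuous_real continuous_on_const) auto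
    moreover have "integral {u..v} f \<le> integral {u..v} (\<lambda>_. f1)"
      using uv b(3) by (intro integral_le int integrable_continuous_real continuous_on_const) auto
    ultimately show ?thesis using uv by (simp add: mult.commute)
  qed
  have F01: "F 0 = 0" "F 1 = 1" using f by (auto simp: F_def distribution_fun_def design_density_def)
  have cF: "continuous_on {0..1} F"
    unfolding F_def distribution_fun_def
    using indefinite_integral_continuous_1[OF int[of 0 1]] by simp
  have mono: "F u < F v" if "0 \<le> u" "u < v" "v \<le> 1" for u v
  proof -
    have "0 < f0 * (v - u)" using that b(1) by simp
    then show ?thesis using Fdiff[of u v] that by linarith
  qed
  have inj: "inj_on F {0..1}"
  proof (rule inj_onI)
    fix u v :: real assume "u \<in> {0..1}" "v \<in> {0..1}" "F u = F v"
    then show "u = v" using mono[of u v] mono[of v u] by (cases u v rule: linorder_cases) auto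
  qed
  have surj: "\<exists>v\<in>{0..1}. F v = y" if "y \<in> {0..1}" for y
    using IVT'[of F 0 y 1] F01 cF that by auto
  have pt: "design_pt f n i \<in> {0..1} \<and> F (design_pt f n i) = real i / real n" if i: "i \<le> n" for i
  proof (cases "i = 0")
    case True then show ?thesis using F01 by (simp add: design_pt_def)
  next
    case False
    have "real i / real n \<in> {0..1}" using i n by simp
    then obtain v where v: "v \<in> {0..1}" "F v = real i / real n" using surj by blast
    then have "the_inv_into {0..1} F (real i / real n) = v" using the_inv_into_f_f[OF inj v(1)] by simp
    then show ?thesis using v False i by (simp add: design_pt_def F_def)
  qed
  show "i \<le> n \<Longrightarrow> design_pt f n i \<in> {0..1}" using pt by blast
  show "design_pt f n n = 1" using pt[of n] n F01 inj_onD[OF inj, of "design_pt f n n" 1] by simp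
  assume i: "i < n"
  define u v where "u = design_pt f n i" and "v = design_pt f n (i + 1)"
  have uv: "u \<in> {0..1}" "v \<in> {0..1}" "F v - F u = 1 / real n"
    using pt[of i] pt[of "i + 1"] i n by (auto simp: u_def v_def field_simps)
  have "u \<le> v"
  proof (rule ccontr)
    assume "\<not> u \<le> v"
    then have "F v < F u" using mono[of v u] uv by auto
    moreover have "0 < 1 / real n" using n by simp
    ultimately show False using uv(3) by linarith
  qed
  then have "f0 * (v - u) \<le> 1 / real n" "1 / real n \<le> f1 * (v - u)" using Fdiff[of u v] uv by auto
  moreover have "0 < f1" using b(1) b(3)[of 0] by auto
  ultimately show "1 / (f1 * real n) \<le> gap f n i \<and> gap f n i \<le> 1 / (f0 * real n)"
    using b(1) n unfolding gap_def u_def v_def by (simp add: field_simps)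
qed

subsection \<open>Weights and variance of the estimator\<close>

text \<open>Multiplying the weights by the covariance matrix undoes the inverse in their definition.
  In the overview's terms, \<open>p\<close> vanishes at the nodes. Most of the work shows that
  \<open>mat_inverse\<close> really returns an inverse.\<close>

lemma weights_solve:
  assumes R: "nonsingular_kernel R" and ts: "distinct ts" "set ts \<subseteq> {0..1}" and k: "k < length ts"
  shows "(\<Sum>i<length ts. vec_index (weights R K x h ts) i * R (ts ! i) (ts ! k)) = f_xh R K x h (ts ! k)"
proof -
  let ?N = "length ts"
  define A where "A = cov_matrix R ts"
  define v where "v = vec_of_list (map (f_xh R K x h) ts)"
  have A: "A \<in> carrier_mat ?N ?N" by (simp add: A_def cov_matrix_def)
  have "invertible_mat A" using R ts by (simp add: nonsingular_kernel_def A_def)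
  then obtain B where B: "A * B = 1\<^sub>m ?N" "B * A = 1\<^sub>m (dim_row B)"
    using A unfolding invertible_mat_def inverts_mat_def by auto
  have "dim_col (A * B) = ?N" "dim_col (B * A) = dim_row B" using B by simp_all
  then have Bc: "B \<in> carrier_mat ?N ?N" using A by (intro carrier_matI) auto
  have "mat_inverse A \<noteq> None"
  proof
    assume "mat_inverse A = None"
    then have "A \<notin> Units (ring_mat TYPE(real) ?N ())" by (rule mat_inverse(1)[OF A])
    moreover have "A \<in> Units (ring_mat TYPE(real) ?N ())"
      using A Bc B unfolding Units_def ring_mat_def by auto
    ultimately show False by contradiction
  qed
  then obtain C where C: "mat_inverse A = Some C" by blast
  have CA: "C * A = 1\<^sub>m ?N" and Cc: "C \<in> carrier_mat ?N ?N"
    using mat_inverse(2)[OF A C, THEN conjunct2] by (rule conjunct1, rule conjunct2)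
  have v: "v \<in> carrier_vec ?N" unfolding v_def by (rule carrier_vecI) simp
  have vr: "mat_of_row v \<in> carrier_mat 1 ?N" using v by simp
  define r where "r = mat_of_row v * C"
  have rc: "r \<in> carrier_mat 1 ?N" using vr Cc by (simp add: r_def)
  have "r * A = mat_of_row v * (C * A)" unfolding r_def by (rule assoc_mult_mat[OF vr Cc A])
  also have "\<dots> = mat_of_row v" unfolding CA using right_mult_one_mat[OF vr] .
  finally have "(r * A) $$ (0, k) = v $ k" using v k by (simp add: mat_of_row_def)
  moreover have "(r * A) $$ (0, k) = (\<Sum>i<?N. Matrix.row r 0 $ i * A $$ (i, k))"
    using rc A k by (auto simp: scalar_prod_def lessThan_atLeast0 intro!: sum.cong)
  moreover have "weights R K x h ts = Matrix.row r 0"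
    using C by (simp add: weights_def r_def v_def A_def)
  ultimately show ?thesis using k by (simp add: A_def cov_matrix_def v_def vec_of_list_index)
qed

section \<open>Variance of linear estimators built from i.i.d. copies\<close>

context prob_space begin

lemma variance_sum_indep_centered:
  fixes Z :: "nat \<Rightarrow> 'a \<Rightarrow> real"
  assumes ind: "indep_vars (\<lambda>_. borel) Z I" and fin: "finite I"
    and sq: "\<And>j. j \<in> I \<Longrightarrow> integrable M (\<lambda>\<omega>. (Z j \<omega>)\<^sup>2)"
    and mean: "\<And>j. j \<in> I \<Longrightarrow> expectation (Z j) = 0"
    and var: "\<And>j. j \<in> I \<Longrightarrow> expectation (\<lambda>\<omega>. (Z j \<omega>)\<^sup>2) = V"
  shows "variance (\<lambda>\<omega>. a + b * (\<Sum>j\<in>I. Z j \<omega>)) = b\<^sup>2 * (real (card I) * V)"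
proof -
  have rv: "Z j \<in> borel_measurable M" if "j \<in> I" for j
    using ind that unfolding indep_vars_def by auto
  have int: "integrable M (Z j)" if "j \<in> I" for j
    using square_integrable_imp_integrable[OF rv sq] that by auto
  have cross: "integrable M (\<lambda>\<omega>. Z i \<omega> * Z j \<omega>) \<and>
      expectation (\<lambda>\<omega>. Z i \<omega> * Z j \<omega>) = (if i = j then V else 0)" if ij: "i \<in> I" "j \<in> I" for i j
  proof (cases "i = j")
    case True then show ?thesis using sq[OF ij(1)] var[OF ij(1)] by (simp add: power2_eq_square)
  next
    case False
    have "indep_vars (\<lambda>_. borel) Z {i, j}" using ij by (intro indep_vars_subset[OF ind]) auto
    moreover have "\<And>k. k \<in> {i, j} \<Longrightarrow> integrable M (Z k)" using int ij by auto
    ultimately show ?thesis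
      using indep_vars_integrable[of "{i, j}" Z] indep_vars_lebesgue_integral[of "{i, j}" Z]
        mean ij False by simp
  qed
  define S where "S \<omega> = (\<Sum>j\<in>I. Z j \<omega>)" for \<omega>
  have ES: "expectation S = 0" unfolding S_def using int mean by simp
  have iS: "integrable M S" unfolding S_def using int by simp
  have "variance (\<lambda>\<omega>. a + b * S \<omega>) = expectation (\<lambda>\<omega>. b\<^sup>2 * (S \<omega>)\<^sup>2)"
    using iS ES by (simp add: prob_space power_mult_distrib)
  also have "\<dots> = b\<^sup>2 * expectation (\<lambda>\<omega>. \<Sum>i\<in>I. \<Sum>j\<in>I. Z i \<omega> * Z j \<omega>)"
    by (simp add: S_def power2_eq_square sum_product)
  also have "expectation (\<lambda>\<omega>. \<Sum>i\<in>I. \<Sum>j\<in>I. Z i \<omega> * Z j \<omega>) = (\<Sum>i\<in>I. \<Sum>j\<in>I. if i = j then V else 0)"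
    using cross by (simp add: Bochner_Integration.integral_sum)
  also have "\<dots> = real (card I) * V" using fin by (simp add: sum.delta)
  finally show ?thesis by (simp add: S_def)
qed

text \<open>The weighted noise of one copy is a fixed measurable functional \<phi> of its sample
  path. Independence and equality of path distributions therefore pass to the real variables
  \<open>Z j\<close>, whose second moment is the quadratic form; averaging m of them divides it by
  m.\<close>

lemma variance_linear_estimator:
  fixes t :: "nat \<Rightarrow> real"
  assumes so: "second_order_process M eps" and ce: "centered_process M eps"
    and R: "autocovariance M eps R" and iid: "iid_copies M eps m epss" and m: "1 \<le> m"
    and t: "\<And>i. i < n \<Longrightarrow> t i \<in> {0..1}"
  shows "variance (\<lambda>\<omega>. \<Sum>i<n. c i * Ybar g epss m (t i) \<omega>) =
    (\<Sum>i<n. \<Sum>j<n. c i * (c j * R (t i) (t j))) / real m"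
proof -
  define \<phi> where "\<phi> p = (\<Sum>i<n. c i * p (t i))" for p :: "real \<Rightarrow> real"
  have \<phi>: "\<phi> \<in> borel_measurable path_space"
    unfolding \<phi>_def using t by (intro borel_measurable_sum borel_measurable_times) auto
  define Z where "Z j \<omega> = (\<Sum>i<n. c i * epss j (t i) \<omega>)" for j \<omega>
  define E where "E \<omega> = (\<Sum>i<n. c i * eps (t i) \<omega>)" for \<omega>
  have ZE: "\<phi> (sample_path (epss j) \<omega>) = Z j \<omega>" "\<phi> (sample_path eps \<omega>) = E \<omega>" for j \<omega>
    using t by (simp_all add: \<phi>_def sample_path_def Z_def E_def)
  have rv: "eps s \<in> borel_measurable M" and sq: "integrable M (\<lambda>\<omega>. (eps s \<omega>)\<^sup>2)"
    and mean: "expectation (eps s) = 0" if "s \<in> {0..1}" for s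
    using so ce that by (auto simp: second_order_process_def centered_process_def)
  have int: "integrable M (eps s)" if "s \<in> {0..1}" for s
    using square_integrable_imp_integrable[OF rv sq] that by auto
  have path: "sample_path eps \<in> measurable M path_space"
    unfolding sample_path_def using rv by (intro measurable_restrict) auto
  have ind: "indep_vars (\<lambda>_. path_space) (\<lambda>j. sample_path (epss j)) {1..m}"
    and dis: "\<And>j. j \<in> {1..m} \<Longrightarrow> distr M path_space (sample_path (epss j)) = distr M path_space (sample_path eps)"
    using iid by (auto simp: iid_copies_def)
  have pathj: "sample_path (epss j) \<in> measurable M path_space" if "j \<in> {1..m}" for j
    using ind that unfolding indep_vars_def by auto
  have indZ: "indep_vars (\<lambda>_. borel) Z {1..m}"
  proof -
    have "indep_vars (\<lambda>_. borel) (\<lambda>j \<omega>. \<phi> (sample_path (epss j) \<omega>)) {1..m}"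
      by (rule indep_vars_compose2[OF ind]) (rule \<phi>)
    then show ?thesis by (simp add: ZE Z_def[abs_def])
  qed
  have cross: "integrable M (\<lambda>\<omega>. eps r \<omega> * eps s \<omega>) \<and> expectation (\<lambda>\<omega>. eps r \<omega> * eps s \<omega>) = R r s"
    if rs: "r \<in> {0..1}" "s \<in> {0..1}" for r s
  proof -
    have "integrable M (\<lambda>\<omega>. eps r \<omega> * eps s \<omega>)"
    proof (rule Bochner_Integration.integrable_bound[of M "\<lambda>\<omega>. (eps r \<omega>)\<^sup>2 + (eps s \<omega>)\<^sup>2"])
      show "integrable M (\<lambda>\<omega>. (eps r \<omega>)\<^sup>2 + (eps s \<omega>)\<^sup>2)" using sq rs by auto
      show "(\<lambda>\<omega>. eps r \<omega> * eps s \<omega>) \<in> borel_measurable M"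
        using rv rs by (intro borel_measurable_times) auto
      have "\<bar>a * b\<bar> \<le> a\<^sup>2 + b\<^sup>2" for a b :: real
      proof -
        have "2 * (\<bar>a\<bar> * \<bar>b\<bar>) \<le> a\<^sup>2 + b\<^sup>2"
          using sum_squares_bound[of "\<bar>a\<bar>" "\<bar>b\<bar>"] by (simp add: mult.assoc)
        moreover have "0 \<le> \<bar>a\<bar> * \<bar>b\<bar>" by simp
        ultimately show ?thesis unfolding abs_mult by linarith
      qed
      then show "AE \<omega> in M. norm (eps r \<omega> * eps s \<omega>) \<le> norm ((eps r \<omega>)\<^sup>2 + (eps s \<omega>)\<^sup>2)" by simp
    qed
    moreover have "R r s = expectation (\<lambda>\<omega>. eps r \<omega> * eps s \<omega>)"
      using R rs mean[OF rs(1)] mean[OF rs(2)] unfolding autocovariance_def by simp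
    ultimately show ?thesis by simp
  qed
  have E2: "(E \<omega>)\<^sup>2 = (\<Sum>i<n. \<Sum>j<n. c i * (c j * (eps (t i) \<omega> * eps (t j) \<omega>)))" for \<omega>
    unfolding E_def power2_eq_square sum_product by (intro sum.cong refl) (simp add: mult_ac)
  have EE: "expectation E = 0" unfolding E_def using int mean t by simp
  have ci: "integrable M (\<lambda>\<omega>. c i * (c j * (eps (t i) \<omega> * eps (t j) \<omega>)))"
    and ev: "expectation (\<lambda>\<omega>. c i * (c j * (eps (t i) \<omega> * eps (t j) \<omega>))) = c i * (c j * R (t i) (t j))"
    if "i < n" "j < n" for i j
    using cross[OF t t, OF that] by simp_all
  have iE2: "integrable M (\<lambda>\<omega>. (E \<omega>)\<^sup>2)"
    unfolding E2 by (intro Bochner_Integration.integrable_sum ci) auto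
  have EE2: "expectation (\<lambda>\<omega>. (E \<omega>)\<^sup>2) = (\<Sum>i<n. \<Sum>j<n. c i * (c j * R (t i) (t j)))"
  proof -
    have "expectation (\<lambda>\<omega>. (E \<omega>)\<^sup>2) =
        (\<Sum>i<n. expectation (\<lambda>\<omega>. \<Sum>j<n. c i * (c j * (eps (t i) \<omega> * eps (t j) \<omega>))))"
      unfolding E2 by (intro Bochner_Integration.integral_sum Bochner_Integration.integrable_sum ci) auto
    also have "\<dots> = (\<Sum>i<n. \<Sum>j<n. expectation (\<lambda>\<omega>. c i * (c j * (eps (t i) \<omega> * eps (t j) \<omega>))))"
      by (intro sum.cong refl Bochner_Integration.integral_sum ci) auto
    also have "\<dots> = (\<Sum>i<n. \<Sum>j<n. c i * (c j * R (t i) (t j)))"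
      by (intro sum.cong refl ev) auto
    finally show ?thesis .
  qed
  \<comment> \<open>Moments of a copy are moments of the original process, as both are integrals
    over the common path distribution.\<close>
  have tr: "integrable M (\<lambda>\<omega>. F (Z j \<omega>)) = integrable M (\<lambda>\<omega>. F (E \<omega>))"
    "expectation (\<lambda>\<omega>. F (Z j \<omega>)) = expectation (\<lambda>\<omega>. F (E \<omega>))"
    if j: "j \<in> {1..m}" and F: "F \<in> borel_measurable borel" for j and F :: "real \<Rightarrow> real"
  proof -
    have meas: "(\<lambda>p. F (\<phi> p)) \<in> borel_measurable path_space" using \<phi> F by simp
    show "integrable M (\<lambda>\<omega>. F (Z j \<omega>)) = integrable M (\<lambda>\<omega>. F (E \<omega>))"
      using integrable_distr_eq[OF pathj[OF j] meas] integrable_distr_eq[OF path meas] dis[OF j]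
      by (simp add: ZE)
    show "expectation (\<lambda>\<omega>. F (Z j \<omega>)) = expectation (\<lambda>\<omega>. F (E \<omega>))"
      using integral_distr[OF pathj[OF j] meas] integral_distr[OF path meas] dis[OF j]
      by (simp add: ZE)
  qed
  have "(\<Sum>i<n. c i * Ybar g epss m (t i) \<omega>) = (\<Sum>i<n. c i * g (t i)) + 1 / real m * (\<Sum>j\<in>{1..m}. Z j \<omega>)" for \<omega>
  proof -
    have "Ybar g epss m s \<omega> = g s + 1 / real m * (\<Sum>j=1..m. epss j s \<omega>)" for s
      using m by (simp add: Ybar_def Y_def sum.distrib field_simps)
    then have "(\<Sum>i<n. c i * Ybar g epss m (t i) \<omega>) =
        (\<Sum>i<n. c i * g (t i)) + (\<Sum>i<n. c i * (1 / real m * (\<Sum>j=1..m. epss j (t i) \<omega>)))"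
      by (simp add: distrib_left sum.distrib)
    also have "(\<Sum>i<n. c i * (1 / real m * (\<Sum>j=1..m. epss j (t i) \<omega>))) =
        1 / real m * (\<Sum>i<n. \<Sum>j=1..m. c i * epss j (t i) \<omega>)"
      by (simp add: sum_distrib_left sum_divide_distrib)
    also have "(\<Sum>i<n. \<Sum>j=1..m. c i * epss j (t i) \<omega>) = (\<Sum>j\<in>{1..m}. Z j \<omega>)"
      unfolding Z_def by (rule sum.swap)
    finally show ?thesis .
  qed
  then have "variance (\<lambda>\<omega>. \<Sum>i<n. c i * Ybar g epss m (t i) \<omega>) =
    variance (\<lambda>\<omega>. (\<Sum>i<n. c i * g (t i)) + 1 / real m * (\<Sum>j\<in>{1..m}. Z j \<omega>))" by presburger
  also have "\<dots> = (1 / real m)\<^sup>2 * (real (card {1..m}) * (\<Sum>i<n. \<Sum>j<n. c i * (c j * R (t i) (t j))))"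
    using tr(1)[of _ "\<lambda>z. z\<^sup>2"] tr(2)[of _ "\<lambda>z. z\<^sup>2"] tr(2)[of _ "\<lambda>z. z"] EE iE2 EE2
    by (intro variance_sum_indep_centered[OF indZ]) auto
  finally show ?thesis using m by (simp add: power2_eq_square)
qed

end

subsection \<open>Asymptotics of the residual\<close>

text \<open>Gathers every constant that is fixed before \<open>x\<close>, \<open>h\<close>,
  \<open>n\<close> and \<open>m\<close>. Whatever is bounded below in terms of these parameters
  alone is uniform in \<open>x\<close>.\<close>

locale design_setting =
  fixes R :: "real \<Rightarrow> real \<Rightarrow> real" and H :: "(real \<Rightarrow> real) set"
    and ip :: "(real \<Rightarrow> real) \<Rightarrow> (real \<Rightarrow> real) \<Rightarrow> real"
    and K f al :: "real \<Rightarrow> real" and al0 al1 B Kb Kd cK f0 f1 :: real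
  assumes rkhs: "is_rkhs {0..1} R H ip" and A: "assumption_A R" and nonsing: "nonsingular_kernel R"
    and al: "continuous_on {0..1} al" "\<And>s. s \<in> {0<..<1} \<Longrightarrow> alpha R s = al s"
      "\<And>s. s \<in> {0..1} \<Longrightarrow> al0 \<le> al s \<and> al s \<le> al1" "0 < al0"
    and C: "\<And>v. v \<in> {0..1} \<Longrightarrow> (\<lambda>s\<in>{0..1}. R02_plus R s v) \<in> H"
      "\<And>v. v \<in> {0..1} \<Longrightarrow>
        sqrt (ip (\<lambda>s\<in>{0..1}. R02_plus R s v) (\<lambda>s\<in>{0..1}. R02_plus R s v)) \<le> B"
    and f: "design_density f" "0 < f0" "continuous_on {0..1} f"
      "\<And>t. t \<in> {0..1} \<Longrightarrow> f0 \<le> f t \<and> f t \<le> f1"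
    and Kb: "0 < Kb" "\<And>x h s. 0 < h \<Longrightarrow> \<bar>phi K x h s\<bar> \<le> Kb / h"
    and Kd: "0 \<le> Kd" "\<And>x h s s'. 0 < h \<Longrightarrow> \<bar>phi K x h s - phi K x h s'\<bar> \<le> Kd / h\<^sup>2 * \<bar>s - s'\<bar>"
    and supp: "\<And>x h s. 0 < h \<Longrightarrow> phi K x h s \<noteq> 0 \<Longrightarrow> \<bar>s - x\<bar> \<le> h"
    and cphi: "\<And>x h. 0 < h \<Longrightarrow> continuous_on {0..1} (phi K x h)"
    and cK: "0 < cK" "\<And>x h. 0 < x \<Longrightarrow> x < 1 \<Longrightarrow> 0 < h \<Longrightarrow> h < 1 \<Longrightarrow>
      cK / h \<le> integral {0..1} (\<lambda>s. (phi K x h s)\<^sup>2)"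
begin

text \<open>Nodes are counted from 0, as list positions are: \<open>pt n 0\<close> is the first
  design point and not the conventional value 0.\<close>

definition pt :: "nat \<Rightarrow> nat \<Rightarrow> real" where "pt n i = design_pt f n (Suc i)"
definition cw :: "real \<Rightarrow> real \<Rightarrow> nat \<Rightarrow> nat \<Rightarrow> real" where
  "cw x h n i = vec_index (weights R K x h (design_list f n)) i"
text \<open>This is m times the variance of the estimator.\<close>

definition quad :: "real \<Rightarrow> real \<Rightarrow> nat \<Rightarrow> real" where
  "quad x h n = (\<Sum>i<n. \<Sum>j<n. cw x h n i * (cw x h n j * R (pt n i) (pt n j)))"

lemma f1_pos: "0 < f1" using f(2) f(4)[of 0] by auto

lemma grid_gap:
  assumes "Suc j < n"
  shows "1 / (f1 * real n) \<le> pt n (Suc j) - pt n j \<and> pt n (Suc j) - pt n j \<le> 1 / (f0 * real n)"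
  using design_points(3)[OF f, of n "Suc j"] assms by (simp add: pt_def gap_def)

lemma grid_first:
  assumes "0 < n" shows "0 < pt n 0" "pt n 0 \<le> 1 / (f0 * real n)"
proof -
  have "1 / (f1 * real n) \<le> pt n 0 \<and> pt n 0 \<le> 1 / (f0 * real n)"
    using design_points(3)[OF f, of n 0] assms by (simp add: pt_def gap_def design_pt_def)
  moreover have "0 < 1 / (f1 * real n)" using f1_pos assms by simp
  ultimately show "0 < pt n 0" "pt n 0 \<le> 1 / (f0 * real n)" by linarith+
qed

lemma grid_strict: "Suc j < n \<Longrightarrow> pt n j < pt n (Suc j)"
proof -
  assume j: "Suc j < n"
  then have "0 < 1 / (f1 * real n)" using f1_pos by simp
  then show ?thesis using grid_gap[OF j] by linarith
qed

lemma grid_in_unit: "i < n \<Longrightarrow> pt n i \<in> {0..1}"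
  using design_points(1)[OF f, of n "Suc i"] by (simp add: pt_def)

lemma grid_last: "pt (Suc m) m = 1"
  using design_points(2)[OF f, of "Suc m"] by (simp add: pt_def)

lemma design_list_nth: "i < n \<Longrightarrow> design_list f n ! i = pt n i"
  by (simp add: design_list_def pt_def del: upt_Suc)

lemma design_list_length: "length (design_list f n) = n"
  by (simp add: design_list_def del: upt_Suc)

lemma design_list_set: "set (design_list f n) \<subseteq> {0..1}"
  using grid_in_unit by (auto simp: in_set_conv_nth design_list_length design_list_nth)

lemma design_list_distinct: "distinct (design_list f n)"
proof -
  have mono: "pt n i < pt n j" if "i < j" "j < n" for i j
    using that
  proof (induction j)
    case (Suc j)
    then show ?case using grid_strict[of j n] by (cases "i = j") auto
  qed simp
  then show ?thesis
    by (auto simp: distinct_conv_nth design_list_length design_list_nth) (metis less_irrefl linorder_neqE_nat)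
qed

lemma cw_solve:
  assumes "k < n"
  shows "(\<Sum>i<n. cw x h n i * R (pt n i) (pt n k)) = f_xh R K x h (pt n k)"
proof -
  have "(\<Sum>i<length (design_list f n). vec_index (weights R K x h (design_list f n)) i *
      R (design_list f n ! i) (design_list f n ! k)) = f_xh R K x h (design_list f n ! k)"
    using assms design_list_length
    by (intro weights_solve[OF nonsing design_list_distinct design_list_set]) simp
  then show ?thesis using assms by (simp add: design_list_length design_list_nth cw_def)
qed

text \<open>The equations for the weights turn the mixed term between the density and the nodes into
  \<open>quad\<close>, so the difference is exactly \<open>err2\<close>. The bounds then come from
  \<open>err2_estimate\<close> with size \<open>Kb / h\<close>, Lipschitz constant
  \<open>Kd / h\<^sup>2\<close> and gaps between 1 / (f1 n) and 1 / (f0 n).\<close>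

lemma residual_estimate:
  assumes n: "0 < n" and h: "0 < h" "1 / (f0 * real n) \<le> h"
    and \<theta>: "\<And>v. v \<in> {0..pt n 0} \<Longrightarrow> sqrt (R v v - 2 * R v (pt n 0) + R (pt n 0) (pt n 0)) \<le> \<theta>"
  defines "d \<equiv> 1 / (f0 * real n)"
  shows "0 \<le> sigma2 R K x h - quad x h n" and
    "\<exists>S. \<bar>(sigma2 R K x h - quad x h n) - S\<bar> \<le> sqrt (sigma2 R K x h - quad x h n) *
        (B * (Kb / h * d\<^sup>2) * (4 * h) + \<theta> * integral {0..pt n 0} (\<lambda>v. \<bar>phi K x h v\<bar>)) \<and>
      S \<le> al1 * (Kb / h)\<^sup>2 * d\<^sup>2 * (4 * h) \<and>
      S \<ge> al0 / 12 * (1 / (f1 * real n))\<^sup>2 * integral {pt n 0..1} (\<lambda>v. (phi K x h v)\<^sup>2)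
        - (al0 / 6 * (Kb / h) * (Kd / h\<^sup>2 * d) + al1 * (2 * (Kb / h) * (Kd / h\<^sup>2 * d) + (Kd / h\<^sup>2 * d)\<^sup>2)) * d\<^sup>2 * (4 * h)"
proof -
  have cR: "continuous_on ({0..1} \<times> {0..1}) (\<lambda>(s, t). R s t)" using A by (simp add: assumption_A_def)
  interpret Q: quadrature_functional R H ip "phi K x h" "cw x h n" "pt n" n
    using rkhs cR cphi[OF h(1)] grid_in_unit by unfold_locales auto
  have fx: "f_xh R K x h v = integral {0..1} (\<lambda>s. phi K x h s * R s v)" for v
    unfolding f_xh_def by (simp add: mult.commute)
  have zero: "Q.err (\<lambda>s. R s (pt n k)) = 0" if "k < n" for k
    unfolding Q.err_def fx[symmetric] using cw_solve[OF that] by simp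
  have "integral {0..1} (\<lambda>v. phi K x h v * R (pt n i) v) = (\<Sum>j<n. cw x h n j * R (pt n i) (pt n j))"
    if i: "i < n" for i
  proof -
    have sym: "R (pt n i) v = R v (pt n i)" if "v \<in> {0..1}" for v
      using rkhs_kernel_sym[OF rkhs grid_in_unit[OF i] that] .
    have "integral {0..1} (\<lambda>v. phi K x h v * R (pt n i) v) = f_xh R K x h (pt n i)"
      unfolding fx using sym by (intro Henstock_Kurzweil_Integration.integral_cong) auto
    also have "\<dots> = (\<Sum>j<n. cw x h n j * R (pt n j) (pt n i))" using cw_solve[OF i] by simp
    also have "\<dots> = (\<Sum>j<n. cw x h n j * R (pt n i) (pt n j))"
      using sym grid_in_unit by (intro sum.cong refl) auto
    finally show ?thesis .
  qed
  then have quad_eq: "(\<Sum>i<n. cw x h n i * integral {0..1} (\<lambda>v. phi K x h v * R (pt n i) v)) = quad x h n"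
    unfolding quad_def by (intro sum.cong refl) (simp add: sum_distrib_left)
  have "sigma2 R K x h = integral {0..1} (\<lambda>s. phi K x h s * integral {0..1} (\<lambda>v. phi K x h v * R s v))"
    unfolding sigma2_def by (simp add: mult_ac flip: integral_mult_right)
  then have E: "sigma2 R K x h - quad x h n = Q.err2"
    using Q.err2_eq_err_integral[OF zero] by (simp add: Q.err_def quad_eq)
  show "0 \<le> sigma2 R K x h - quad x h n" unfolding E by (rule Q.err2_nonneg)
  obtain m where m: "n = Suc m" using n gr0_implies_Suc by blast
  show "\<exists>S. \<bar>(sigma2 R K x h - quad x h n) - S\<bar> \<le> sqrt (sigma2 R K x h - quad x h n) *
        (B * (Kb / h * d\<^sup>2) * (4 * h) + \<theta> * integral {0..pt n 0} (\<lambda>v. \<bar>phi K x h v\<bar>)) \<and>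
      S \<le> al1 * (Kb / h)\<^sup>2 * d\<^sup>2 * (4 * h) \<and>
      S \<ge> al0 / 12 * (1 / (f1 * real n))\<^sup>2 * integral {pt n 0..1} (\<lambda>v. (phi K x h v)\<^sup>2)
        - (al0 / 6 * (Kb / h) * (Kd / h\<^sup>2 * d) + al1 * (2 * (Kb / h) * (Kd / h\<^sup>2 * d) + (Kd / h\<^sup>2 * d)\<^sup>2)) * d\<^sup>2 * (4 * h)"
    unfolding E
  proof (rule Q.err2_estimate[OF A al(1,2,3) less_imp_le[OF al(4)] C m _ _ zero Kb(2)[OF h(1)] supp[OF h(1)] Kd(2)[OF h(1)]])
    show "pt n m = 1" using grid_last m by simp
    show "pt n j < pt n (Suc j)" if "j < m" for j using grid_strict that m by simp
    show "0 \<le> 1 / (f1 * real n)" "0 \<le> d" using f1_pos f(2) by (simp_all add: d_def)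
    show "d \<le> h" using h by (simp add: d_def)
    show "1 / (f1 * real n) \<le> pt n (Suc j) - pt n j \<and> pt n (Suc j) - pt n j \<le> d" if "j < m" for j
      using grid_gap[of j n] that m by (simp add: d_def)
  qed (use \<theta> in auto)
qed

end

text \<open>The unknown also enters its own error term. Absorbing half of \<open>Y\<close> by 2 z b
  \<le> z^2 + b^2, with z the root of \<open>Y\<close>, gives an a priori upper bound; with it the
  error drops below c / 2, which is the purpose of the threshold for \<open>b\<close>.\<close>

lemma quadratic_perturbation_bounds:
  fixes Y a b c d :: real
  assumes Y: "0 \<le> Y" and pert: "\<bar>Y - a\<bar> \<le> sqrt Y * b" and a: "c \<le> a" "a \<le> d" "0 \<le> d" "0 < c"
    and b: "0 \<le> b" "b \<le> 1" "b \<le> c / (2 * (d + 1))"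
  shows "c / 2 \<le> Y" "Y \<le> 2 * d + 1"
proof -
  define z where "z = sqrt Y"
  have z: "0 \<le> z" "z\<^sup>2 = Y" using Y by (auto simp: z_def)
  have "0 \<le> (z - b)\<^sup>2" by simp
  then have "2 * (z * b) \<le> Y + b\<^sup>2" using z by (simp add: power2_diff)
  moreover have "b\<^sup>2 \<le> 1" using b by (simp add: power_le_one)
  moreover have "Y \<le> a + z * b" using pert unfolding z_def by linarith
  ultimately show Yd: "Y \<le> 2 * d + 1" using a by linarith
  \<comment> \<open>Bounds the root of \<open>Y\<close> by \<open>d + 1\<close>, which keeps square
    roots out of the threshold for \<open>b\<close>.\<close>
  have "2 * d + 1 \<le> (d + 1)\<^sup>2" by (simp add: power2_eq_square algebra_simps)
  then have "z\<^sup>2 \<le> (d + 1)\<^sup>2" using Yd z by linarith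
  then have zd: "z \<le> d + 1" using a by (intro power2_le_imp_le[of z]) auto
  have "z * b \<le> (d + 1) * (c / (2 * (d + 1)))" using z b zd a by (intro mult_mono) auto
  also have "\<dots> = c / 2" using a by (simp add: field_simps)
  finally have "z * b \<le> c / 2" .
  moreover have "a - z * b \<le> Y" using pert unfolding z_def by linarith
  ultimately show "c / 2 \<le> Y" using a by linarith
qed

section \<open>Scaling and passage to the limit\<close>

context design_setting begin

text \<open>The bound \<open>al1 * W\<^sup>2 * dmax\<^sup>2 * (4 * h)\<close> of the main term after
  multiplication by n^2 h; all powers of n and h cancel.\<close>

definition upper where "upper = 4 * al1 * Kb\<^sup>2 / f0\<^sup>2"
text \<open>Here \<rho> is the ratio of the gap bound 1 / (f0 n) to the bandwidth. The part with
  \<open>Kb\<^sup>2 * \<rho>\<close> pays for the mass of \<open>w\<^sup>2\<close> before the first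
  node, the rest for the oscillation of \<open>w\<close> within a gap. At \<rho> = 0 only
  \<open>al0 * cK / (12 * f1\<^sup>2)\<close> remains.\<close>

definition lower where "lower \<rho> = al0 / (12 * f1\<^sup>2) * (cK - Kb\<^sup>2 * \<rho>)
  - 4 / f0\<^sup>2 * (al0 / 6 * (Kb * Kd * \<rho>) + al1 * (2 * (Kb * Kd * \<rho>) + Kd\<^sup>2 * \<rho>\<^sup>2))"

text \<open>Brings the estimate into the shape of \<open>quadratic_perturbation_bounds\<close>. The
  factor n^2 h is split into equal halves \<open>n * sqrt h\<close>: one turns the root of the
  residual into the root of \<open>y\<close>, the other scales the remainder.\<close>

lemma scaled_residual_estimate:
  assumes n: "0 < n" and h: "0 < h" "h < 1" "1 / (f0 * real n) \<le> h" and x: "0 < x" "x < 1"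
    and \<theta>: "0 < \<theta>" "\<And>v. v \<in> {0..pt n 0} \<Longrightarrow> sqrt (R v v - 2 * R v (pt n 0) + R (pt n 0) (pt n 0)) \<le> \<theta>"
    and t0: "pt n 0 \<le> x / 2"
  defines "y \<equiv> (real n)\<^sup>2 * h * (sigma2 R K x h - quad x h n)"
  shows "0 \<le> y" "\<exists>a. \<bar>y - a\<bar> \<le> sqrt y * (4 * B * Kb / (f0\<^sup>2 * real n) + \<theta> * Kb / (f0 * sqrt (x / 2))) \<and>
    lower (1 / (f0 * real n * h)) \<le> a \<and> a \<le> upper"
proof -
  define E where "E = sigma2 R K x h - quad x h n"
  define d where "d = 1 / (f0 * real n)"
  define \<rho> where "\<rho> = 1 / (f0 * real n * h)"
  define I where "I = integral {0..pt n 0} (\<lambda>v. \<bar>phi K x h v\<bar>)"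
  have d0: "0 < d" using f(2) n by (simp add: d_def)
  have nd: "real n * d = 1 / f0" using n by (simp add: d_def)
  have d\<rho>: "d = \<rho> * h" using h by (simp add: d_def \<rho>_def)
  have B0: "0 \<le> B"
    by (rule order_trans[OF real_sqrt_ge_zero[OF rkhs_ip_nonneg[OF rkhs C(1)[of 0]]] C(2)[of 0]]) auto
  have E0: "0 \<le> E" using residual_estimate(1)[OF n h(1,3) \<theta>(2)] by (simp add: E_def)
  have YE: "y = (real n)\<^sup>2 * h * E" by (simp add: y_def E_def)
  show y0: "0 \<le> y" using E0 h by (simp add: YE)
  have p0: "0 < pt n 0" "pt n 0 \<le> d" "pt n 0 \<le> 1"
    using grid_first[OF n] grid_in_unit[OF n] by (auto simp: d_def)
  have cphi': "continuous_on {a..b} (phi K x h)" if "0 \<le> a" "b \<le> 1" for a b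
    using that by (intro continuous_on_subset[OF cphi[OF h(1)]]) auto
  obtain S where S: "\<bar>E - S\<bar> \<le> sqrt E * (B * (Kb / h * d\<^sup>2) * (4 * h) + \<theta> * I)"
    "S \<le> al1 * (Kb / h)\<^sup>2 * d\<^sup>2 * (4 * h)"
    "S \<ge> al0 / 12 * (1 / (f1 * real n))\<^sup>2 * integral {pt n 0..1} (\<lambda>v. (phi K x h v)\<^sup>2)
        - (al0 / 6 * (Kb / h) * (Kd / h\<^sup>2 * d) + al1 * (2 * (Kb / h) * (Kd / h\<^sup>2 * d) + (Kd / h\<^sup>2 * d)\<^sup>2)) * d\<^sup>2 * (4 * h)"
    using residual_estimate(2)[OF n h(1,3) \<theta>(2)] unfolding E_def d_def I_def by blast
  define a where "a = (real n)\<^sup>2 * h * S"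
  have sqY: "sqrt y = real n * sqrt h * sqrt E" by (simp add: YE real_sqrt_mult)
  have nh: "0 \<le> (real n)\<^sup>2 * h" using h by simp
  \<comment> \<open>The remainder from the second derivative scales to \<open>sqrt h\<close> times a
    multiple of 1 / n, and h < 1.\<close>
  have 1: "real n * sqrt h * (B * (Kb / h * d\<^sup>2) * (4 * h)) \<le> 4 * B * Kb / (f0\<^sup>2 * real n)"
  proof -
    have "real n * sqrt h * (B * (Kb / h * d\<^sup>2) * (4 * h)) = sqrt h * (4 * B * Kb / (f0\<^sup>2 * real n))"
      using h n f(2) by (simp add: d_def field_simps power2_eq_square)
    also have "\<dots> \<le> 1 * (4 * B * Kb / (f0\<^sup>2 * real n))"
      using h B0 Kb(1) by (intro mult_right_mono) auto
    finally show ?thesis by simp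
  qed
  have 2: "real n * sqrt h * (\<theta> * I) \<le> \<theta> * Kb / (f0 * sqrt (x / 2))"
  proof (cases "\<exists>v\<in>{0..pt n 0}. phi K x h v \<noteq> 0")
    case True
    then obtain v where v: "v \<in> {0..pt n 0}" "phi K x h v \<noteq> 0" by blast
    \<comment> \<open>As \<open>x\<close> is fixed, the kernel can reach the first interval only if \<open>h\<close> is bounded below.\<close>
    then have xh: "x / 2 \<le> h" using supp[OF h(1) v(2)] t0 by auto
    have "I \<le> integral {0..pt n 0} (\<lambda>v. Kb / h)" unfolding I_def
      using p0 Kb(2)[OF h(1)]
      by (intro integral_le integrable_continuous_real continuous_on_rabs continuous_on_const cphi') auto
    also have "\<dots> = pt n 0 * (Kb / h)" using p0 by simp
    also have "\<dots> \<le> d * (Kb / h)" using p0 Kb(1) h by (intro mult_right_mono) auto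
    finally have "real n * sqrt h * (\<theta> * I) \<le> real n * sqrt h * (\<theta> * (d * (Kb / h)))"
      using \<theta>(1) h by (intro mult_left_mono) auto
    also have "\<dots> = \<theta> * Kb * (real n * d) * (sqrt h / h)" by simp
    also have "\<dots> = \<theta> * Kb / (f0 * sqrt h)"
    proof -
      have "sqrt h / h = 1 / sqrt h" using h by (simp add: frac_eq_eq)
      then show ?thesis unfolding nd by simp
    qed
    also have "\<dots> \<le> \<theta> * Kb / (f0 * sqrt (x / 2))"
      using xh x f(2) Kb(1) \<theta>(1) by (intro divide_left_mono mult_left_mono mult_pos_pos) auto
    finally show ?thesis .
  next
    case False
    then have "I = integral {0..pt n 0} (\<lambda>v. 0)" unfolding I_def
      by (intro Henstock_Kurzweil_Integration.integral_cong) auto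
    then have "I = 0" by simp
    then show ?thesis using \<theta>(1) Kb(1) f(2) x by simp
  qed
  have "\<bar>y - a\<bar> = (real n)\<^sup>2 * h * \<bar>E - S\<bar>"
    unfolding YE a_def right_diff_distrib[symmetric] abs_mult using h by simp
  also have "\<dots> \<le> (real n)\<^sup>2 * h * (sqrt E * (B * (Kb / h * d\<^sup>2) * (4 * h) + \<theta> * I))"
    using S(1) nh by (rule mult_left_mono)
  also have "\<dots> = sqrt y * (real n * sqrt h * (B * (Kb / h * d\<^sup>2) * (4 * h)) + real n * sqrt h * (\<theta> * I))"
  proof -
    have "(real n)\<^sup>2 * h = (real n * sqrt h) * (real n * sqrt h)" using h by (simp add: power2_eq_square)
    then show ?thesis unfolding sqY distrib_left[symmetric] by (simp only: mult_ac)
  qed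
  also have "\<dots> \<le> sqrt y * (4 * B * Kb / (f0\<^sup>2 * real n) + \<theta> * Kb / (f0 * sqrt (x / 2)))"
    using y0 by (intro mult_left_mono add_mono 1 2) auto
  finally have res1: "\<bar>y - a\<bar> \<le> sqrt y * (4 * B * Kb / (f0\<^sup>2 * real n) + \<theta> * Kb / (f0 * sqrt (x / 2)))" .
  have "a \<le> (real n)\<^sup>2 * h * (al1 * (Kb / h)\<^sup>2 * d\<^sup>2 * (4 * h))"
    unfolding a_def using S(2) nh by (rule mult_left_mono)
  also have "\<dots> = upper"
    using h n f(2) by (simp add: upper_def d_def field_simps power2_eq_square)
  finally have res2: "a \<le> upper" .
  define J where "J = integral {pt n 0..1} (\<lambda>v. (phi K x h v)\<^sup>2)"
  \<comment> \<open>The lower bound \<open>cK / h\<close> holds for the whole unit interval; the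
    part before the first node is at most \<open>d * (Kb / h)\<^sup>2\<close> and is given
    up.\<close>
  have J: "cK - Kb\<^sup>2 * \<rho> \<le> h * J"
  proof -
    have "integral {0..pt n 0} (\<lambda>v. (phi K x h v)\<^sup>2) + J = integral {0..1} (\<lambda>v. (phi K x h v)\<^sup>2)"
      unfolding J_def using p0
      by (intro Henstock_Kurzweil_Integration.integral_combine integrable_continuous_real
        continuous_on_power cphi') auto
    moreover have "integral {0..pt n 0} (\<lambda>v. (phi K x h v)\<^sup>2) \<le> integral {0..pt n 0} (\<lambda>v. (Kb / h)\<^sup>2)"
    proof (intro integral_le integrable_continuous_real continuous_on_power continuous_on_const cphi')
      fix v
      show "(phi K x h v)\<^sup>2 \<le> (Kb / h)\<^sup>2"
        using power_mono[OF Kb(2)[OF h(1)] abs_ge_zero, of x v 2] by simp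
    qed (use p0 in auto)
    moreover have "integral {0..pt n 0} (\<lambda>v. (Kb / h)\<^sup>2) \<le> d * (Kb / h)\<^sup>2"
      using p0 by (simp add: mult_right_mono)
    moreover have "cK / h \<le> integral {0..1} (\<lambda>v. (phi K x h v)\<^sup>2)" using cK(2) x h by blast
    ultimately have "cK / h - d * (Kb / h)\<^sup>2 \<le> J" by linarith
    then have "h * (cK / h - d * (Kb / h)\<^sup>2) \<le> h * J" using h by (intro mult_left_mono) auto
    moreover have "h * (cK / h - d * (Kb / h)\<^sup>2) = cK - Kb\<^sup>2 * \<rho>"
      unfolding d\<rho> using h by (simp add: field_simps power2_eq_square)
    ultimately show ?thesis by simp
  qed
  have "lower \<rho> \<le> al0 / (12 * f1\<^sup>2) * (h * J)
      - 4 / f0\<^sup>2 * (al0 / 6 * (Kb * Kd * \<rho>) + al1 * (2 * (Kb * Kd * \<rho>) + Kd\<^sup>2 * \<rho>\<^sup>2))"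
    unfolding lower_def using J al(4) by (intro diff_right_mono mult_left_mono) auto
  also have "\<dots> = (real n)\<^sup>2 * h * (al0 / 12 * (1 / (f1 * real n))\<^sup>2 * J
        - (al0 / 6 * (Kb / h) * (Kd / h\<^sup>2 * d) + al1 * (2 * (Kb / h) * (Kd / h\<^sup>2 * d) + (Kd / h\<^sup>2 * d)\<^sup>2)) * d\<^sup>2 * (4 * h))"
  proof -
    define \<kappa> where "\<kappa> = al0 / 6 * (Kb / h) * (Kd / h\<^sup>2 * d) + al1 * (2 * (Kb / h) * (Kd / h\<^sup>2 * d) + (Kd / h\<^sup>2 * d)\<^sup>2)"
    have k: "h\<^sup>2 * \<kappa> = al0 / 6 * (Kb * Kd * \<rho>) + al1 * (2 * (Kb * Kd * \<rho>) + Kd\<^sup>2 * \<rho>\<^sup>2)"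
      unfolding \<kappa>_def d\<rho> using h by (simp add: field_simps power2_eq_square)
    have "(real n)\<^sup>2 * h * (\<kappa> * d\<^sup>2 * (4 * h)) = 4 * (real n * d)\<^sup>2 * (h\<^sup>2 * \<kappa>)"
      by (simp add: power2_eq_square)
    also have "\<dots> = 4 / f0\<^sup>2 * (h\<^sup>2 * \<kappa>)" unfolding nd by (simp add: power_divide)
    finally have 3: "(real n)\<^sup>2 * h * (\<kappa> * d\<^sup>2 * (4 * h)) = 4 / f0\<^sup>2 * (h\<^sup>2 * \<kappa>)" .
    have 4: "(real n)\<^sup>2 * h * (al0 / 12 * (1 / (f1 * real n))\<^sup>2 * J) = al0 / (12 * f1\<^sup>2) * (h * J)"
      using n f1_pos by (simp add: field_simps power2_eq_square)
    show ?thesis unfolding right_diff_distrib \<kappa>_def[symmetric] 3 4 k ..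
  qed
  also have "\<dots> \<le> a" unfolding a_def using S(3)[folded J_def] nh by (rule mult_left_mono)
  finally have res3: "lower \<rho> \<le> a" .
  show "\<exists>a. \<bar>y - a\<bar> \<le> sqrt y * (4 * B * Kb / (f0\<^sup>2 * real n) + \<theta> * Kb / (f0 * sqrt (x / 2))) \<and>
    lower (1 / (f0 * real n * h)) \<le> a \<and> a \<le> upper"
    using res1 res2 res3 unfolding \<rho>_def by blast
qed

lemma kernel_increment_uniform:
  assumes "0 < \<theta>"
  obtains \<delta> where "0 < \<delta>" "\<And>u v. u \<in> {0..1} \<Longrightarrow> v \<in> {0..1} \<Longrightarrow> \<bar>u - v\<bar> < \<delta> \<Longrightarrow>
    sqrt (R v v - 2 * R v u + R u u) \<le> \<theta>"
proof -
  have "continuous_on ({0..1} \<times> {0..1}) (\<lambda>(s, t). R s t)" using A by (simp add: assumption_A_def)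
  moreover have "compact ({0..1::real} \<times> {0..1::real})" by (intro compact_Times) auto
  ultimately have "uniformly_continuous_on ({0..1} \<times> {0..1}) (\<lambda>(s, t). R s t)"
    by (rule compact_uniformly_continuous)
  moreover have "0 < \<theta>\<^sup>2 / 2" using assms by simp
  ultimately obtain \<delta> where \<delta>: "0 < \<delta>"
    "\<And>p q. p \<in> {0..1} \<times> {0..1} \<Longrightarrow> q \<in> {0..1} \<times> {0..1} \<Longrightarrow> dist q p < \<delta> \<Longrightarrow>
      dist (case q of (s, t) \<Rightarrow> R s t) (case p of (s, t) \<Rightarrow> R s t) < \<theta>\<^sup>2 / 2"
    unfolding uniformly_continuous_on_def by metis
  have "sqrt (R v v - 2 * R v u + R u u) \<le> \<theta>" if uv: "u \<in> {0..1}" "v \<in> {0..1}" "\<bar>u - v\<bar> < \<delta>" for u v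
  proof -
    have "\<bar>R v v - R v u\<bar> < \<theta>\<^sup>2 / 2"
      using \<delta>(2)[of "(v, u)" "(v, v)"] uv by (simp add: dist_prod_def dist_real_def abs_minus_commute)
    moreover have "\<bar>R u u - R v u\<bar> < \<theta>\<^sup>2 / 2"
      using \<delta>(2)[of "(v, u)" "(u, u)"] uv by (simp add: dist_prod_def dist_real_def abs_minus_commute)
    ultimately have "R v v - 2 * R v u + R u u \<le> \<theta>\<^sup>2" by linarith
    then have "sqrt (R v v - 2 * R v u + R u u) \<le> sqrt (\<theta>\<^sup>2)" by (rule real_sqrt_le_mono)
    then show ?thesis using assms by simp
  qed
  then show ?thesis using that \<delta>(1) by blast
qed

text \<open>The choices are made in the order \<open>e\<close>, \<theta>, \<delta>, and then n
  large. Only \<theta>, and through it \<delta> and the threshold for n, depend on \<open>x\<close>;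
  the bounds themselves do not.\<close>

lemma scaled_residual_asymptotics:
  fixes h :: "nat \<Rightarrow> real"
  assumes h: "\<And>n. n \<ge> 1 \<Longrightarrow> 0 < h n \<and> h n < 1" and nh: "(\<lambda>n. 1 / (real n * h n)) \<longlonglongrightarrow> 0"
    and x: "0 < x" "x < 1"
  shows "\<forall>\<^sub>F n in sequentially. lower 0 / 4 \<le> (real n)\<^sup>2 * h n * (sigma2 R K x (h n) - quad x (h n) n) \<and>
    (real n)\<^sup>2 * h n * (sigma2 R K x (h n) - quad x (h n) n) \<le> 2 * upper + 1"
proof -
  \<comment> \<open>One half of \<open>lower 0\<close> is given up so that \<rho> need only be
    small, and half of the rest goes to the perturbation, which makes
    \<open>lower 0 / 4\<close>.\<close>
  define c where "c = lower 0 / 2"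
  have c0: "0 < c" unfolding c_def lower_def using al(4) f1_pos cK(1) by simp
  have u0: "0 \<le> upper" unfolding upper_def using al(3)[of 0] al(4) by simp
  have B0: "0 \<le> B"
    by (rule order_trans[OF real_sqrt_ge_zero[OF rkhs_ip_nonneg[OF rkhs C(1)[of 0]]] C(2)[of 0]]) auto
  define e where "e = min 1 (c / (2 * (upper + 1)))"
  have e0: "0 < e" unfolding e_def using c0 u0 by simp
  \<comment> \<open>Solved from the requirement that the scaled contribution of the end interval be
    exactly e / 2; the other e / 2 is for the remainder of order 1 / n.\<close>
  define \<theta> where "\<theta> = e / 2 * (f0 * sqrt (x / 2)) / Kb"
  have \<theta>0: "0 < \<theta>" unfolding \<theta>_def using e0 f(2) x Kb(1) by simp
  have \<theta>e: "\<theta> * Kb / (f0 * sqrt (x / 2)) = e / 2" unfolding \<theta>_def using f(2) x Kb(1) by simp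
  obtain \<delta> where \<delta>: "0 < \<delta>" "\<And>u v. u \<in> {0..1} \<Longrightarrow> v \<in> {0..1} \<Longrightarrow> \<bar>u - v\<bar> < \<delta> \<Longrightarrow>
    sqrt (R v v - 2 * R v u + R u u) \<le> \<theta>" using kernel_increment_uniform[OF \<theta>0] by blast
  have lim_n: "(\<lambda>n. a / real n) \<longlonglongrightarrow> 0" for a by (rule lim_const_over_n)
  have "(\<lambda>n. 1 / f0 * (1 / (real n * h n))) \<longlonglongrightarrow> 1 / f0 * 0" by (intro tendsto_intros nh)
  then have \<rho>: "(\<lambda>n. 1 / (f0 * real n * h n)) \<longlonglongrightarrow> 0" by (simp add: mult.assoc)
  have "(\<lambda>n. lower (1 / (f0 * real n * h n))) \<longlonglongrightarrow> lower 0"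
    unfolding lower_def by (intro tendsto_intros \<rho>)
  then have e1: "\<forall>\<^sub>F n in sequentially. c < lower (1 / (f0 * real n * h n))"
    using c0 by (intro order_tendstoD) (auto simp: c_def)
  have e2: "\<forall>\<^sub>F n in sequentially. 1 / (f0 * real n * h n) < 1" using order_tendstoD(2)[OF \<rho>] by simp
  have e3: "\<forall>\<^sub>F n in sequentially. (1 / f0) / real n < min \<delta> (x / 2)"
    by (rule order_tendstoD(2)[OF lim_n]) (use \<delta>(1) x in simp)
  have e4: "\<forall>\<^sub>F n in sequentially. (4 * B * Kb / f0\<^sup>2) / real n < e / 2"
    by (rule order_tendstoD(2)[OF lim_n]) (use e0 in simp)
  have e5: "\<forall>\<^sub>F n in sequentially. 1 \<le> n" by (rule eventually_ge_at_top)
  show ?thesis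
    using e1 e2 e3 e4 e5
  proof eventually_elim
    case (elim n)
    have n: "0 < n" and hn: "0 < h n" "h n < 1" using elim h[of n] by auto
    have d: "1 / (f0 * real n) \<le> h n" using elim(2) hn n f(2) by (simp add: field_simps)
    have p: "0 < pt n 0" "pt n 0 < \<delta>" "pt n 0 \<le> x / 2" "pt n 0 \<in> {0..1}"
      using grid_first[OF n] grid_in_unit[OF n] elim(3) by auto
    have th: "sqrt (R v v - 2 * R v (pt n 0) + R (pt n 0) (pt n 0)) \<le> \<theta>" if "v \<in> {0..pt n 0}" for v
      using that p by (intro \<delta>(2)) auto
    note est = scaled_residual_estimate[OF n hn d x \<theta>0 th p(3)]
    obtain a where a: "\<bar>(real n)\<^sup>2 * h n * (sigma2 R K x (h n) - quad x (h n) n) - a\<bar>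
        \<le> sqrt ((real n)\<^sup>2 * h n * (sigma2 R K x (h n) - quad x (h n) n)) *
          (4 * B * Kb / (f0\<^sup>2 * real n) + \<theta> * Kb / (f0 * sqrt (x / 2)))"
      "lower (1 / (f0 * real n * h n)) \<le> a" "a \<le> upper" using est(2) by blast
    define b where "b = 4 * B * Kb / (f0\<^sup>2 * real n) + \<theta> * Kb / (f0 * sqrt (x / 2))"
    have "b \<le> e" "0 \<le> b" using elim(4) e0 B0 Kb(1) unfolding b_def \<theta>e by simp_all
    then have b: "0 \<le> b" "b \<le> 1" "b \<le> c / (2 * (upper + 1))" unfolding e_def by auto
    have ca: "c \<le> a" using elim(1) a(2) by linarith
    show ?case
      using quadratic_perturbation_bounds[OF est(1) a(1)[folded b_def] ca a(3) u0 c0 b]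
      by (simp add: c_def)
  qed
qed

end

theorem proposition7:
  fixes M :: "'w measure"
    and eps :: "real \<Rightarrow> 'w \<Rightarrow> real"
    and epss :: "nat \<Rightarrow> nat \<Rightarrow> real \<Rightarrow> 'w \<Rightarrow> real"
    and R :: "real \<Rightarrow> real \<Rightarrow> real"
    and g K f :: "real \<Rightarrow> real"
    and h :: "nat \<Rightarrow> real"
  assumes "prob_space M"
    and "C2_on {0..1} g"
    and "second_order_process M eps"
    and "centered_process M eps"
    and "autocovariance M eps R"
    and "nonsingular_kernel R"
    and "\<And>m. m \<ge> 1 \<Longrightarrow> iid_copies M eps m (epss m)"
    and "smoothing_kernel K"
    and "\<And>n. n \<ge> 1 \<Longrightarrow> 0 < h n \<and> h n < 1"
    and "assumption_A R"
    and "assumption_B R"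
    and "assumption_C R"
    and "design_density f"
    and "\<forall>\<^sub>F n in sequentially. real n * h n \<ge> 1"
    and "\<forall>\<^sub>F n in sequentially. (1 / h n) * (MAX i\<in>{1..n}. gap f n i) \<le> 1"
  shows "\<exists>C>0. \<exists>C'>0. \<forall>x\<in>{0<..<1}.
           (\<forall>\<^sub>F n in sequentially. set (design_list f n) \<inter> {x - h n..x + h n} \<noteq> {}) \<and>
           assumption_E f h x \<longrightarrow>
           (\<forall>m\<ge>1.
              limsup (\<lambda>n. ereal (real m * (real n)\<^sup>2 * h n *
                (sigma2 R K x (h n) / real m -
                 prob_space.variance M
                   (g_pro R K x (h n) (design_list f n) (Ybar g (epss m) m))))) \<le> ereal C \<and>
              liminf (\<lambda>n. ereal (real m * (real n)\<^sup>2 * h n *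
                (sigma2 R K x (h n) / real m -
                 prob_space.variance M
                   (g_pro R K x (h n) (design_list f n) (Ybar g (epss m) m))))) \<ge> ereal C')"
proof -
  interpret prob_space M by fact
  obtain f0 f1 where f: "0 < f0" "continuous_on {0..1} f" "\<And>t. t \<in> {0..1} \<Longrightarrow> f0 \<le> f t \<and> f t \<le> f1"
    using design_density_bounds[OF \<open>design_density f\<close>] by blast
  obtain Kb Kd where Kb: "0 < Kb" "0 \<le> Kd" "\<forall>x h. 0 < h \<longrightarrow>
     (\<forall>s. \<bar>phi K x h s\<bar> \<le> Kb / h) \<and>
     (\<forall>s s'. \<bar>phi K x h s - phi K x h s'\<bar> \<le> Kd / h\<^sup>2 * \<bar>s - s'\<bar>) \<and>
     (\<forall>s. phi K x h s \<noteq> 0 \<longrightarrow> \<bar>s - x\<bar> \<le> h) \<and> continuous_on {0..1} (phi K x h)"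
    using phi_bounds[OF \<open>smoothing_kernel K\<close>] by blast
  obtain cK where cK: "0 < cK" "\<forall>x h. 0 < x \<longrightarrow> x < 1 \<longrightarrow> 0 < h \<longrightarrow> h < 1 \<longrightarrow>
     cK / h \<le> integral {0..1} (\<lambda>s. (phi K x h s)\<^sup>2)"
    using phi_square_lower[OF \<open>smoothing_kernel K\<close>] by blast
  \<comment> \<open>At 0 and 1 \<open>alpha\<close> involves a limit from outside the unit interval,
    about which nothing is known. Its Lipschitz continuity inside provides a continuous extension to
    use instead.\<close>
  obtain al where al: "continuous_on {0..1} al" "\<And>s. s \<in> {0<..<1} \<Longrightarrow> alpha R s = al s"
  proof -
    obtain L where "L-lipschitz_on {0<..<1} (alpha R)"
      using \<open>assumption_B R\<close> unfolding assumption_B_def by blast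
    then have "uniformly_continuous_on {0<..<1} (alpha R)" by (rule lipschitz_on_uniformly_continuous)
    from uniformly_continuous_on_extension_on_closure[OF this]
    obtain al where "uniformly_continuous_on (closure {0<..<1}) al" "\<And>s. s \<in> {0<..<1} \<Longrightarrow> alpha R s = al s"
      by metis
    then show ?thesis using that[of al] uniformly_continuous_imp_continuous[of "{0..1}" al] by simp
  qed
  have "(INF t\<in>{0<..<1}. ereal (al t)) = (INF t\<in>{0<..<1}. ereal (alpha R t))"
    using al(2) by (intro INF_cong) auto
  then have "(INF t\<in>{0<..<1}. ereal (al t)) > 0"
    using \<open>assumption_B R\<close> unfolding assumption_B_def by simp
  then obtain al0 al1 where al01: "0 < al0" "\<And>t. t \<in> {0..1} \<Longrightarrow> al0 \<le> al t \<and> al t \<le> al1"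
    using continuous_bounds_of_INF_pos[OF al(1)] by blast
  obtain H ip where rk: "is_rkhs {0..1} R H ip"
    and C1: "\<And>t. t \<in> {0..1} \<Longrightarrow> (\<lambda>s\<in>{0..1}. R02_plus R s t) \<in> H"
    and C2: "(SUP t\<in>{0..1}. ereal (sqrt (ip (\<lambda>s\<in>{0..1}. R02_plus R s t)
                                        (\<lambda>s\<in>{0..1}. R02_plus R s t)))) < \<infinity>"
    using \<open>assumption_C R\<close> unfolding assumption_C_def by blast
  \<comment> \<open>The supremum is real: finite from above by (C), and not minus infinity as the
    index set contains 0.\<close>
  obtain B where B: "\<And>t. t \<in> {0..1} \<Longrightarrow>
      sqrt (ip (\<lambda>s\<in>{0..1}. R02_plus R s t) (\<lambda>s\<in>{0..1}. R02_plus R s t)) \<le> B"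
  proof -
    define N where "N t = sqrt (ip (\<lambda>s\<in>{0..1}. R02_plus R s t) (\<lambda>s\<in>{0..1}. R02_plus R s t))" for t
    define s where "s = (SUP t\<in>{0..1}. ereal (N t))"
    have ub: "ereal (N t) \<le> s" if "t \<in> {0..1}" for t unfolding s_def using that by (intro SUP_upper)
    have "s < \<infinity>" using C2 by (simp add: s_def N_def)
    then obtain b where "s = ereal b" using ub[of 0] by (cases s) auto
    then have "N t \<le> b" if "t \<in> {0..1}" for t using ub[OF that] by simp
    then show ?thesis using that[of b] unfolding N_def by blast
  qed
  interpret D: design_setting R H ip K f al al0 al1 B Kb Kd cK f0 f1
    using rk \<open>assumption_A R\<close> \<open>nonsingular_kernel R\<close> al al01 C1 B \<open>design_density f\<close> f Kb cK
    by unfold_locales blast+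
  have pos: "0 < 2 * D.upper + 1" "0 < D.lower 0 / 4"
    using D.f1_pos al01(1) al01(2)[of 0] cK(1) by (auto simp: D.upper_def D.lower_def intro!: add_nonneg_pos)
  \<comment> \<open>Both witnesses are built from the constants of the locale, so they precede
    \<open>x\<close> and \<open>m\<close>.\<close>
  show ?thesis
  proof (rule exI[of _ "2 * D.upper + 1"], rule conjI[OF pos(1)], rule exI[of _ "D.lower 0 / 4"],
      rule conjI[OF pos(2)], intro ballI impI allI conjI; elim conjE)
    fix x m assume x: "x \<in> {0<..<1}" and E: "assumption_E f h x" and m: "(1::nat) \<le> m"
    \<comment> \<open>The largest gap is at least the first one, hence at least 1 / (f1 n). So the
      second limit in (E) forces n h to infinity.\<close>
    have "(\<lambda>n. 1 / (real n * h n)) \<longlonglongrightarrow> 0"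
    proof (rule tendsto_sandwich[OF _ _ tendsto_const])
      have "(\<lambda>n. (1 / h n) * (MAX j\<in>{0..n}. gap f n j)) \<longlonglongrightarrow> 0" using E by (simp add: assumption_E_def)
      then show "(\<lambda>n. f1 * ((1 / h n) * (MAX j\<in>{0..n}. gap f n j))) \<longlonglongrightarrow> 0"
        using tendsto_mult_right_zero by blast
      show "\<forall>\<^sub>F n in sequentially. 0 \<le> 1 / (real n * h n)"
        using eventually_ge_at_top[of 1] by eventually_elim (use assms(9) in \<open>auto simp: less_imp_le\<close>)
      show "\<forall>\<^sub>F n in sequentially. 1 / (real n * h n) \<le> f1 * ((1 / h n) * (MAX j\<in>{0..n}. gap f n j))"
        using eventually_ge_at_top[of 1]
      proof eventually_elim
        case (elim n)
        have hn: "0 < h n" using assms(9)[OF elim] by simp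
        have "1 / (f1 * real n) \<le> gap f n 0" using design_points(3)[OF \<open>design_density f\<close> f, of n 0] elim by simp
        also have "\<dots> \<le> (MAX j\<in>{0..n}. gap f n j)" by (intro Max_ge) auto
        finally have "f1 * ((1 / h n) * (1 / (f1 * real n))) \<le> f1 * ((1 / h n) * (MAX j\<in>{0..n}. gap f n j))"
          using D.f1_pos hn by (intro mult_left_mono) auto
        then show ?case using D.f1_pos by (simp add: mult.commute)
      qed
    qed
    from D.scaled_residual_asymptotics[OF assms(9) this, of x] x
    have ev: "\<forall>\<^sub>F n in sequentially. D.lower 0 / 4 \<le> (real n)\<^sup>2 * h n * (sigma2 R K x (h n) - D.quad x (h n) n) \<and>
      (real n)\<^sup>2 * h n * (sigma2 R K x (h n) - D.quad x (h n) n) \<le> 2 * D.upper + 1" by simp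
    have var: "variance (g_pro R K x (h n) (design_list f n) (Ybar g (epss m) m)) = D.quad x (h n) n / real m" for n
    proof -
      have "g_pro R K x (h n) (design_list f n) (Ybar g (epss m) m) =
          (\<lambda>\<omega>. \<Sum>i<n. D.cw x (h n) n i * Ybar g (epss m) m (D.pt n i) \<omega>)"
        by (auto simp: g_pro_def D.design_list_length D.design_list_nth D.cw_def)
      then show ?thesis
        unfolding D.quad_def
        using variance_linear_estimator[OF assms(3-5) assms(7)[OF m] m D.grid_in_unit] by simp
    qed
    \<comment> \<open>The variance is \<open>D.quad\<close> divided by m, so m cancels and the
      bounds hold for all m at once.\<close>
    have eq: "real m * (real n)\<^sup>2 * h n * (sigma2 R K x (h n) / real m -
        variance (g_pro R K x (h n) (design_list f n) (Ybar g (epss m) m))) =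
      (real n)\<^sup>2 * h n * (sigma2 R K x (h n) - D.quad x (h n) n)" for n
      unfolding var using m by (simp add: field_simps)
    show "limsup (\<lambda>n. ereal (real m * (real n)\<^sup>2 * h n *
        (sigma2 R K x (h n) / real m -
         variance (g_pro R K x (h n) (design_list f n) (Ybar g (epss m) m))))) \<le> ereal (2 * D.upper + 1)"
      unfolding eq using ev by (intro Limsup_bounded) (auto elim: eventually_mono)
    show "ereal (D.lower 0 / 4) \<le> liminf (\<lambda>n. ereal (real m * (real n)\<^sup>2 * h n *
        (sigma2 R K x (h n) / real m -
         variance (g_pro R K x (h n) (design_list f n) (Ybar g (epss m) m)))))"
      unfolding eq using ev by (intro Liminf_bounded) (auto elim: eventually_mono)
  qed
qed

end
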